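(* Let $\mathscr{P}_\bullet$ be an irreducible subfactor planar algebra. For any $x\in\mathscr{P}_{2,\pm}$ with $\|x\|_2=1$ and any $0<p,q<\infty$, $$\left(\frac1p-\frac12\right)h_{p/2}(|x|^2)+\left(\frac12-\frac1q\right)h_{q/2}\left(|\mathfrak{F}_s(x)|^2\right)\ \ge\ -\log K(1/p,1/q).$$
   Context: Let $\mathscr{P}_\bullet=\{\mathscr{P}_{n,\pm}\}_{n\ge 0}$ be a subfactor planar algebra in the sense of Jones, with $\delta$ the square root of the Jones index (the value of a closed loop). It is irreducible if $\mathscr{P}_{1,\pm}$ is one-dimensional. Each $\mathscr{P}_{n,\pm}$ is a finite-dimensional C$^*$-algebra and $tr_2$ denotes the unnormalized Markov trace on $\mathscr{P}_{2,\pm}$, so $tr_2(1)=\delta^2$. The string Fourier transform $\mathfrak{F}_s:\mathscr{P}_{2,\pm}\to\mathscr{P}_{2,\mp}$ is the clockwise 1-click rotation. For $x\in\mathscr{P}_{2,\pm}$, $|x|=(x^*x)^{1/2}$ and $\|x\|_p=(tr_2(|x|^p))^{1/p}$ for $0<p<\infty$. The Rényi entropy of order $r\in(0,1)\cup(1,\infty)$ of $x$ is $h_r(x)=\frac{r}{1-r}\log\|x\|_r$. For an element $y\ge 0$ with $tr_2(y)=1$, the order-one entropy is $h_1(y)=-tr_2(y\log y)$ (the limit as $r\to1$), so that when $p=2$ (resp. $q=2$) the first (resp. second) term on the left-hand side is $0$. Define the regions $R_F=\{(s,t): s,t\ge 0,\ s+t\le 1,\ t\le 1/2\}$, $R_T=\{(s,t):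 s,t\ge 0,\ s+t\ge 1,\ s\ge 1/2\}$, $R_{TF}=\{(s,t): s,t\ge 0,\ s\le 1/2,\ t\ge 1/2\}$, and the function $K$ on $[0,\infty)^2$ by $K(s,t)=\delta^{1-2s}$ for $(s,t)\in R_F$, $K(s,t)=\delta^{2t-1}$ for $(s,t)\in R_T$, $K(s,t)=\delta^{2t-2s}$ for $(s,t)\in R_{TF}$ (the formulas agree on overlaps). *)

theory Defs
  imports Complex_Main "HOL-Library.Multiset"
begin

section \<open>Shaded planar tangles\<close>

text \<open>
  The planar operad acts through isotopy classes of shaded planar tangles, and such a class is
  encoded here by its combinatorial data.

  Disc 0 is the output disc, discs 1, 2, ... are the input discs.  A disc of colour \<open>(k, e)\<close> has
  \<open>2 * k\<close> boundary points, and its marked boundary interval touches an unshaded region iff \<open>e\<close>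
  (so \<open>(k, True)\<close> is the colour of $P_{k,+}$ and \<open>(k, False)\<close> that of $P_{k,-}$).
  Going clockwise around any disc, input or output, from its marked interval one meets
  interval 0 (the marked one), point 0, interval 1, point 1, ..., interval \<open>2 * k - 1\<close>,
  point \<open>2 * k - 1\<close>.  If \<open>k = 0\<close> the only interval is the whole circle, interval 0.
  The pair \<open>(i, j)\<close> stands for the \<open>j\<close>-th point, or the \<open>j\<close>-th interval, of disc \<open>i\<close>.

  The field \<open>partner\<close> maps a boundary point to the other end of its string, \<open>reg\<close> maps an interval
  to (a label of) the region it touches, and \<open>loops\<close> lists the closed strings, each given by the
  pair (region on its unshaded side, region on its shaded side).  Values of \<open>partner\<close> and \<open>reg\<close>
  outside the points and intervals of the tangle are irrelevant.
\<close>

type_synonym color = "nat \<times> bool"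

record tangle =
  discs :: "color list"
  partner :: "nat \<times> nat \<Rightarrow> nat \<times> nat"
  reg :: "nat \<times> nat \<Rightarrow> nat"
  loops :: "(nat \<times> nat) multiset"

definition npts :: "tangle \<Rightarrow> nat \<Rightarrow> nat" where
  "npts T i = 2 * fst (discs T ! i)"

definition points :: "tangle \<Rightarrow> (nat \<times> nat) set" where
  "points T = {(i, j). i < length (discs T) \<and> j < npts T i}"

definition intervals :: "tangle \<Rightarrow> (nat \<times> nat) set" where
  "intervals T = {(i, j). i < length (discs T) \<and> j < max 1 (npts T i)}"

definition regions :: "tangle \<Rightarrow> nat set" where
  "regions T = reg T ` intervals T \<union> fst ` set_mset (loops T) \<union> snd ` set_mset (loops T)"

text \<open>
  The intervals to the left and to the right of a boundary point, for an observer at that point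
  who looks along the string into the tangle (away from an input disc, into the output disc).
\<close>

definition lft :: "tangle \<Rightarrow> nat \<times> nat \<Rightarrow> nat \<times> nat" where
  "lft T p = (case p of (i, j) \<Rightarrow> if i = 0 then (i, Suc j mod npts T i) else (i, j))"

definition rgt :: "tangle \<Rightarrow> nat \<times> nat \<Rightarrow> nat \<times> nat" where
  "rgt T p = (case p of (i, j) \<Rightarrow> if i = 0 then (i, j) else (i, Suc j mod npts T i))"

definition unshaded :: "tangle \<Rightarrow> nat \<times> nat \<Rightarrow> bool" where
  "unshaded T a = (case a of (i, j) \<Rightarrow> snd (discs T ! i) = even j)"

definition eqcl :: "('b \<times> 'b) set \<Rightarrow> ('b \<times> 'b) set" where
  "eqcl r = (r \<union> r\<inverse>)\<^sup>*"

text \<open>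
  The boundary curves of the regions, as far as they meet a disc: the classes of intervals joined
  by running along one side of a string.
\<close>

definition curves :: "tangle \<Rightarrow> (nat \<times> nat) set set" where
  "curves T = intervals T // eqcl {(lft T p, rgt T (partner T p)) | p. p \<in> points T}"

text \<open>
  The last clause says that the Euler characteristic is 2.  The closed oriented surface obtained
  by gluing the data together (the outside of the output disc being one more disc) consists of
  the discs (contributing 1 each), the strings (\<open>-1\<close> each), the loops (0 each), and, for each
  region, a sphere with as many holes as it has boundary curves (\<open>2 -\<close> number of boundary
  curves); a loop is a boundary curve on both of its sides.  As the surface is connected by the
  preceding clause, Euler characteristic 2 means that it is a sphere, i.e. that the tangle can be
  drawn in the output disc; the drawing is then unique up to isotopy.
\<close>

definition planar_tangle :: "tangle \<Rightarrow> bool" where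
  "planar_tangle T \<longleftrightarrow>
     discs T \<noteq> [] \<and>
     (\<forall>p \<in> points T. partner T p \<in> points T \<and> partner T p \<noteq> p \<and> partner T (partner T p) = p) \<and>
     (\<forall>p \<in> points T. reg T (lft T p) = reg T (rgt T (partner T p))) \<and>
     (\<exists>col. (\<forall>a \<in> intervals T. col (reg T a) = unshaded T a) \<and>
            (\<forall>(u, v) \<in> set_mset (loops T). col u \<and> \<not> col v)) \<and>
     (\<forall>u \<in> regions T. \<forall>v \<in> regions T. (u, v) \<in>
        eqcl ({(reg T a, reg T b) | a b. a \<in> intervals T \<and> b \<in> intervals T \<and> fst a = fst b} \<union>
              set_mset (loops T))) \<and>
     length (discs T) + 2 * card (regions T) =
       2 + (\<Sum>c\<leftarrow>discs T. fst c) + card (curves T) + 2 * size (loops T)"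

text \<open>
  \<open>isotopic \<sigma> T T'\<close>: the same tangle up to planar isotopy (a renaming of the regions) and a
  renumbering \<open>\<sigma>\<close> of the input discs.
\<close>

definition isotopic :: "(nat \<Rightarrow> nat) \<Rightarrow> tangle \<Rightarrow> tangle \<Rightarrow> bool" where
  "isotopic \<sigma> T T' \<longleftrightarrow>
     bij_betw \<sigma> {..<length (discs T)} {..<length (discs T')} \<and> \<sigma> 0 = 0 \<and>
     (\<forall>i < length (discs T). discs T' ! \<sigma> i = discs T ! i) \<and>
     (\<forall>p \<in> points T. partner T' (map_prod \<sigma> id p) = map_prod \<sigma> id (partner T p)) \<and>
     (\<exists>f. bij_betw f (regions T) (regions T') \<and>
          (\<forall>a \<in> intervals T. reg T' (map_prod \<sigma> id a) = f (reg T a)) \<and>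
          loops T' = image_mset (map_prod f f) (loops T))"

text \<open>
  Gluing of a tangle \<open>S\<close> into the \<open>i\<close>-th input disc of \<open>T\<close>.  Points, intervals and regions of
  \<open>T\<close> (resp. \<open>S\<close>) are tagged with \<open>Inl\<close> (resp. \<open>Inr\<close>).  The input discs of the result are those
  of \<open>T\<close> with the \<open>i\<close>-th one replaced by the list of input discs of \<open>S\<close>.
\<close>

definition kept ::
    "nat \<Rightarrow> (nat \<times> nat) set \<Rightarrow> (nat \<times> nat) set \<Rightarrow> (nat \<times> nat + nat \<times> nat) set" where
  "kept i X Y = Inl ` {a \<in> X. fst a \<noteq> i} \<union> Inr ` {b \<in> Y. fst b \<noteq> 0}"

definition emb :: "nat \<Rightarrow> tangle \<Rightarrow> nat \<times> nat + nat \<times> nat \<Rightarrow> nat \<times> nat" where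
  "emb i S a = (case a of
      Inl (d, j) \<Rightarrow> (if d < i then d else d + length (tl (discs S)) - 1, j)
    | Inr (d, j) \<Rightarrow> (i + d - 1, j))"

definition strands :: "tangle \<Rightarrow> nat \<Rightarrow> tangle \<Rightarrow> ((nat \<times> nat + nat \<times> nat) rel)" where
  "strands T i S = eqcl
     ({(Inl p, Inl (partner T p)) | p. p \<in> points T} \<union>
      {(Inr p, Inr (partner S p)) | p. p \<in> points S} \<union>
      {(Inl (i, j), Inr (0, j)) | j. (i, j) \<in> points T})"

definition closed_strands :: "tangle \<Rightarrow> nat \<Rightarrow> tangle \<Rightarrow> (nat \<times> nat + nat \<times> nat) set set" where
  "closed_strands T i S = {c \<in> (points T <+> points S) // strands T i S.
                             c \<inter> kept i (points T) (points S) = {}}"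

text \<open>
  The regions to the two sides of the string ending in \<open>p\<close>, the unshaded one first.
\<close>

definition sides :: "tangle \<Rightarrow> nat \<times> nat \<Rightarrow> nat \<times> nat" where
  "sides T p = (if unshaded T (lft T p) then (reg T (lft T p), reg T (rgt T p))
                else (reg T (rgt T p), reg T (lft T p)))"

text \<open>
  \<open>glued T i S U\<close>: the tangle \<open>U\<close> is the result of the gluing; \<open>h\<close> sends a region of \<open>T\<close> or \<open>S\<close> to
  the region of \<open>U\<close> that contains it.  Since regions carry arbitrary labels, the result is
  determined up to isotopy only.  Every closed strand contains a point of the \<open>i\<close>-th disc of \<open>T\<close>,
  and all of its points have the same sides in \<open>U\<close>.
\<close>

definition glued :: "tangle \<Rightarrow> nat \<Rightarrow> tangle \<Rightarrow> tangle \<Rightarrow> bool" where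
  "glued T i S U \<longleftrightarrow>
     1 \<le> i \<and> i < length (discs T) \<and> discs T ! i = discs S ! 0 \<and>
     discs U = take i (discs T) @ tl (discs S) @ drop (Suc i) (discs T) \<and>
     (\<forall>a \<in> kept i (points T) (points S). \<forall>b \<in> kept i (points T) (points S).
        a \<noteq> b \<and> (a, b) \<in> strands T i S \<longrightarrow> partner U (emb i S a) = emb i S b) \<and>
     (\<exists>h. (\<forall>u \<in> regions T <+> regions S. \<forall>v \<in> regions T <+> regions S.
             h u = h v \<longleftrightarrow>
             (u, v) \<in> eqcl {(Inl (reg T (i, j)), Inr (reg S (0, j))) | j. (i, j) \<in> intervals T}) \<and>
          (\<forall>a \<in> kept i (intervals T) (intervals S).
             reg U (emb i S a) = h (map_sum (reg T) (reg S) a)) \<and>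
          loops U =
            image_mset (map_prod (h \<circ> Inl) (h \<circ> Inl)) (loops T) +
            image_mset (map_prod (h \<circ> Inr) (h \<circ> Inr)) (loops S) +
            image_mset (\<lambda>c. map_prod (h \<circ> Inl) (h \<circ> Inl) (sides T (SOME p. Inl p \<in> c)))
              (mset_set (closed_strands T i S)))"

text \<open>The mirror image; marked intervals are mirrored to marked intervals.\<close>

definition reflect :: "tangle \<Rightarrow> tangle" where
  "reflect T =
     (let r = (\<lambda>(i, j). (i, npts T i - 1 - j)) in
      T\<lparr>partner := (\<lambda>p. r (partner T (r p))),
        reg := (\<lambda>(i, j). reg T (i, (npts T i - j) mod npts T i))\<rparr>)"


subsection \<open>Particular tangles\<close>

text \<open>
  Pictures: a disc of colour \<open>(n, e)\<close> is a box with the marked interval on the left, points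
  \<open>0, ..., n - 1\<close> on top (from left to right) and \<open>n, ..., 2 * n - 1\<close> at the bottom (from right to
  left).
\<close>

definition id_tangle :: "color \<Rightarrow> tangle" where
  "id_tangle c = \<lparr>discs = [c, c], partner = (\<lambda>(i, j). (1 - i, j)), reg = snd, loops = {#}\<rparr>"

definition empty_tangle :: "bool \<Rightarrow> tangle" where
  "empty_tangle e = \<lparr>discs = [(0, e)], partner = id, reg = (\<lambda>_. 0), loops = {#}\<rparr>"

text \<open>A single loop in a disc whose boundary touches an unshaded region.\<close>

definition loop_tangle :: tangle where
  "loop_tangle = \<lparr>discs = [(0, True)], partner = id, reg = (\<lambda>_. 0), loops = {#(0, 1)#}\<rparr>"

text \<open>The unit: \<open>n\<close> vertical strings.\<close>

definition unit_tangle :: "color \<Rightarrow> tangle" where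
  "unit_tangle c = (let n = fst c in
     \<lparr>discs = [c], partner = (\<lambda>(i, j). (i, 2 * n - 1 - j)),
      reg = (\<lambda>(i, j). min j (2 * n - j)), loops = {#}\<rparr>)"

text \<open>Input 1 is stacked on top of input 2.\<close>

definition mult_tangle :: "color \<Rightarrow> tangle" where
  "mult_tangle c = (let n = fst c in
     \<lparr>discs = [c, c, c],
      partner = (\<lambda>(i, j).
        if i = 0 then (if j < n then (1, j) else (2, j))
        else if i = 1 then (if j < n then (0, j) else (2, 2 * n - 1 - j))
        else (if j < n then (1, 2 * n - 1 - j) else (0, j))),
      reg = (\<lambda>(i, j).
        if i = 0 then j
        else if i = 1 then (if j \<le> n then j else j + n)
        else (if j = 0 \<or> n \<le> j then j else 3 * n - j)),
      loops = {#}\<rparr>)"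

text \<open>The strings on top are joined to those at the bottom by arcs passing to the right.\<close>

definition trace_tangle :: "color \<Rightarrow> tangle" where
  "trace_tangle c = (let n = fst c in
     \<lparr>discs = [(0, snd c), c], partner = (\<lambda>(i, j). (i, 2 * n - 1 - j)),
      reg = (\<lambda>(i, j). if i = 0 then 0 else min j (2 * n - j)), loops = {#}\<rparr>)"

text \<open>The same for one string, with the arc passing to the left.\<close>

definition left_trace_tangle :: "bool \<Rightarrow> tangle" where
  "left_trace_tangle e =
     \<lparr>discs = [(0, \<not> e), (1, e)], partner = (\<lambda>(i, j). (i, 1 - j)),
      reg = (\<lambda>(i, j). if i = 0 then 1 else j), loops = {#}\<rparr>"

text \<open>
  The clockwise rotation of a 2-box by one click: point \<open>j\<close> of the input disc is moved to the
  position of point \<open>j + 1\<close> of the output disc.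
\<close>

definition fourier_tangle :: "bool \<Rightarrow> tangle" where
  "fourier_tangle e =
     \<lparr>discs = [(2, \<not> e), (2, e)],
      partner = (\<lambda>(i, j). if i = 0 then (1, (j + 3) mod 4) else (0, (j + 1) mod 4)),
      reg = (\<lambda>(i, j). if i = 0 then (j + 3) mod 4 else j), loops = {#}\<rparr>"


section \<open>Planar algebras\<close>

text \<open>
  The spaces $P_{n,\pm}$ are subspaces \<open>pbox A (n, e)\<close> of one ambient complex vector space
  (for instance their direct sum); no relation between different subspaces is assumed.
\<close>

record 'a palg =
  cscale :: "complex \<Rightarrow> 'a \<Rightarrow> 'a"
  pbox :: "color \<Rightarrow> 'a set"
  act :: "tangle \<Rightarrow> 'a list \<Rightarrow> 'a"
  star :: "color \<Rightarrow> 'a \<Rightarrow> 'a"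

definition inputs :: "'a palg \<Rightarrow> tangle \<Rightarrow> 'a list set" where
  "inputs A T = {xs. list_all2 (\<lambda>x c. x \<in> pbox A c) xs (tl (discs T))}"

locale planar_algebra =
  fixes A :: "'a::ab_group_add palg"
  assumes vector_space: "vector_space (cscale A)"
    and subspace: "module.subspace (cscale A) (pbox A c)"
    and act_closed: "planar_tangle T \<Longrightarrow> xs \<in> inputs A T \<Longrightarrow> act A T xs \<in> pbox A (discs T ! 0)"
    and act_multilinear: "planar_tangle T \<Longrightarrow> xs @ [x] @ ys \<in> inputs A T \<Longrightarrow>
          xs @ [y] @ ys \<in> inputs A T \<Longrightarrow>
          act A T (xs @ [cscale A a x + y] @ ys) =
          cscale A a (act A T (xs @ [x] @ ys)) + act A T (xs @ [y] @ ys)"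
    and act_isotopic: "planar_tangle T \<Longrightarrow> planar_tangle T' \<Longrightarrow> isotopic \<sigma> T T' \<Longrightarrow>
          xs \<in> inputs A T \<Longrightarrow> xs' \<in> inputs A T' \<Longrightarrow>
          (\<And>i. i < length xs \<Longrightarrow> xs' ! (\<sigma> (Suc i) - 1) = xs ! i) \<Longrightarrow>
          act A T' xs' = act A T xs"
    and act_id: "x \<in> pbox A c \<Longrightarrow> act A (id_tangle c) [x] = x"
    and act_glued: "planar_tangle T \<Longrightarrow> planar_tangle S \<Longrightarrow> glued T i S U \<Longrightarrow>
          ys \<in> inputs A S \<Longrightarrow> xs @ [act A S ys] @ zs \<in> inputs A T \<Longrightarrow> Suc (length xs) = i \<Longrightarrow>
          act A U (xs @ ys @ zs) = act A T (xs @ [act A S ys] @ zs)"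

text \<open>
  The identification of $P_{0,\pm}$ with the complex numbers (used when $P_{0,\pm}$ is
  one-dimensional): the empty tangle corresponds to 1.
\<close>

definition scalar :: "'a palg \<Rightarrow> bool \<Rightarrow> 'a \<Rightarrow> complex" where
  "scalar A e v = (THE a. v = cscale A a (act A (empty_tangle e) []))"

definition pmult :: "'a palg \<Rightarrow> color \<Rightarrow> 'a \<Rightarrow> 'a \<Rightarrow> 'a" where
  "pmult A c x y = act A (mult_tangle c) [x, y]"

definition punit :: "'a palg \<Rightarrow> color \<Rightarrow> 'a" where
  "punit A c = act A (unit_tangle c) []"

text \<open>The unnormalized Markov trace, and its left-handed version on $P_{1,\pm}$.\<close>

definition tr :: "'a palg \<Rightarrow> color \<Rightarrow> 'a \<Rightarrow> complex" where
  "tr A c x = scalar A (snd c) (act A (trace_tangle c) [x])"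

definition left_tr :: "'a palg \<Rightarrow> bool \<Rightarrow> 'a \<Rightarrow> complex" where
  "left_tr A e x = scalar A (\<not> e) (act A (left_trace_tangle e) [x])"

definition delta :: "'a palg \<Rightarrow> real" where
  "delta A = Re (scalar A True (act A loop_tangle []))"

locale subfactor_planar_algebra = planar_algebra +
  assumes finite_dim: "\<exists>B. finite B \<and> module.span (cscale A) B = pbox A c"
    and dim_0: "vector_space.dim (cscale A) (pbox A (0, e)) = 1"
    and star_closed: "x \<in> pbox A c \<Longrightarrow> star A c x \<in> pbox A c"
    and star_star: "x \<in> pbox A c \<Longrightarrow> star A c (star A c x) = x"
    and star_conj_linear: "x \<in> pbox A c \<Longrightarrow> y \<in> pbox A c \<Longrightarrow>
          star A c (cscale A a x + y) = cscale A (cnj a) (star A c x) + star A c y"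
    and star_act: "planar_tangle T \<Longrightarrow> xs \<in> inputs A T \<Longrightarrow>
          star A (discs T ! 0) (act A T xs) = act A (reflect T) (map2 (star A) (tl (discs T)) xs)"
    and spherical: "x \<in> pbox A (1, e) \<Longrightarrow> left_tr A e x = tr A (1, e) x"
    and positive: "x \<in> pbox A c \<Longrightarrow> x \<noteq> 0 \<Longrightarrow>
          tr A c (pmult A c (star A c x) x) \<in> \<real> \<and> 0 < Re (tr A c (pmult A c (star A c x) x))"

locale irreducible_subfactor_planar_algebra = subfactor_planar_algebra +
  assumes dim_1: "vector_space.dim (cscale A) (pbox A (1, e)) = 1"


section \<open>Functional calculus, norms and entropies\<close>

text \<open>
  The spectral decomposition of a self-adjoint element of the finite-dimensional
  C*-algebra \<open>pbox A c\<close>: \<open>a\<close> is the sum of \<open>t P t\<close> over \<open>t \<in> \<Lambda>\<close>, where \<open>\<Lambda>\<close> is the spectrum and \<open>P t\<close>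
  the spectral projection for the eigenvalue \<open>t\<close>.
\<close>

definition spectral_decomp ::
    "'a::ab_group_add palg \<Rightarrow> color \<Rightarrow> 'a \<Rightarrow> real set \<Rightarrow> (real \<Rightarrow> 'a) \<Rightarrow> bool" where
  "spectral_decomp A c a \<Lambda> P \<longleftrightarrow>
     finite \<Lambda> \<and>
     (\<forall>t \<in> \<Lambda>. P t \<in> pbox A c \<and> P t \<noteq> 0 \<and> star A c (P t) = P t \<and> pmult A c (P t) (P t) = P t) \<and>
     (\<forall>s \<in> \<Lambda>. \<forall>t \<in> \<Lambda>. s \<noteq> t \<longrightarrow> pmult A c (P s) (P t) = 0) \<and>
     (\<Sum>t \<in> \<Lambda>. P t) = punit A c \<and>
     a = (\<Sum>t \<in> \<Lambda>. cscale A (of_real t) (P t))"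

definition fcalc ::
    "'a::ab_group_add palg \<Rightarrow> color \<Rightarrow> (real \<Rightarrow> real) \<Rightarrow> 'a \<Rightarrow> 'a" where
  "fcalc A c f a = (THE b. \<exists>\<Lambda> P. spectral_decomp A c a \<Lambda> P \<and>
                       b = (\<Sum>t \<in> \<Lambda>. cscale A (of_real (f t)) (P t)))"

definition absval :: "'a::ab_group_add palg \<Rightarrow> color \<Rightarrow> 'a \<Rightarrow> 'a" where
  "absval A c x = fcalc A c sqrt (pmult A c (star A c x) x)"

definition pnorm :: "'a::ab_group_add palg \<Rightarrow> color \<Rightarrow> real \<Rightarrow> 'a \<Rightarrow> real" where
  "pnorm A c p x = Re (tr A c (fcalc A c (\<lambda>t. t powr p) (absval A c x))) powr (1 / p)"

text \<open>
  For \<open>r = 1\<close> this is the von Neumann entropy, meant for \<open>x \<ge> 0\<close> of trace 1; \<open>0 * ln 0 = 0\<close>.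
\<close>

definition renyi_entropy :: "'a::ab_group_add palg \<Rightarrow> color \<Rightarrow> real \<Rightarrow> 'a \<Rightarrow> real" where
  "renyi_entropy A c r x =
     (if r = 1 then - Re (tr A c (fcalc A c (\<lambda>t. t * ln t) x))
      else r / (1 - r) * ln (pnorm A c r x))"

text \<open>The string Fourier transform from \<open>pbox A (2, e)\<close> to \<open>pbox A (2, \<not> e)\<close>.\<close>

definition fourier :: "'a palg \<Rightarrow> bool \<Rightarrow> 'a \<Rightarrow> 'a" where
  "fourier A e x = act A (fourier_tangle e) [x]"

definition R_F :: "(real \<times> real) set" where
  "R_F = {(s, t). 0 \<le> s \<and> 0 \<le> t \<and> s + t \<le> 1 \<and> t \<le> 1 / 2}"

definition R_T :: "(real \<times> real) set" where
  "R_T = {(s, t). 0 \<le> s \<and> 0 \<le> t \<and> 1 \<le> s + t \<and> 1 / 2 \<le> s}"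

definition R_TF :: "(real \<times> real) set" where
  "R_TF = {(s, t). 0 \<le> s \<and> 0 \<le> t \<and> s \<le> 1 / 2 \<and> 1 / 2 \<le> t}"

text \<open>The three regions cover the quadrant, and the formulas agree on overlaps.\<close>

definition K :: "real \<Rightarrow> real \<Rightarrow> real \<Rightarrow> real" where
  "K d s t =
     (if (s, t) \<in> R_F then d powr (1 - 2 * s)
      else if (s, t) \<in> R_T then d powr (2 * t - 1)
      else d powr (2 * t - 2 * s))"

end

theory Submission
  imports Defs "HOL-Complex_Analysis.Complex_Analysis"
    "HOL-Computational_Algebra.Fundamental_Theorem_Algebra"
begin

text \<open>
  Let $x^*x = \sum_t t P_t$ be the spectral decomposition, so that
  $\|x\|_p^p = \sum_t t^{p/2}\, tr_2(P_t)$.  The coefficients of the two entropies are such that the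
  left-hand side is $\log \|x\|_p - \log \|\mathfrak{F}_s(x)\|_q$; at $p = 2$ or $q = 2$ the respective term is
  zero, and so is the logarithm, since $\|x\|_2 = \|\mathfrak{F}_s(x)\|_2 = 1$.  What has to be shown is therefore
  that the Fourier transform has norm at most $K(1/p, 1/q)$ from $L^p$ to $L^q$, and this follows from
  three properties of a 2-box space, all of them obtained by evaluating closed networks:

  \<^item> \<open>tr_unit\<close>: $tr_2(1) = \delta^2$;
  \<^item> \<open>plancherel\<close>: $\|\mathfrak{F}_s(x)\|_2 = \|x\|_2$, since up to moving the outer region of the
    network, which sphericality permits, both are the same network;
  \<^item> \<open>key_inequality\<close>:
    $|tr_2(c\, d\, \mathfrak{F}_s(a b))| \le \delta^{-1} \|a\|_2 \|b\|_2 \|c\|_2 \|d\|_2$.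

  The last one is a sharp form of $\|\mathfrak{F}_s(x)\|_\infty \le \delta^{-1} \|x\|_1$.  The network on
  its left joins $a$ to $b$ and $c$ to $d$ by two strings, and each of $a$, $b$ to each of $c$, $d$ by
  one.  Cutting it into a half with $a$, $c$ and a half with $b$, $d$ severs six strings, so it is the
  inner product of two elements of the 3-box space.  The Cauchy--Schwarz inequality leaves the squared
  norms of the halves.  In each of these a 2-box and its adjoint meet in three strings; this subnetwork
  has two boundary points, and irreducibility makes it a multiple of a single string.  What remains is a
  product of two squared 2-norms, divided by $\delta$.

  The passage to $L^p$ uses the polar decompositions $x = \sum_t \sqrt t\, u_t$ and
  $\mathfrak{F}_s(x) = \sum_t \sqrt t\, v_t$ into orthogonal partial isometries.  In terms of them the
  Fourier transform is the matrix $tr_2(v_s^*\, \mathfrak{F}_s(u_t))$ acting between weighted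
  finite $\ell^p$ spaces, whose weights are traces of spectral projections.  The properties above say that
  it is a contraction on $\ell^2$ and bounded by $\delta^{-1}$ from $\ell^1$ to $\ell^\infty$.  Hence
  \<open>weighted_riesz_thorin\<close> gives the Hausdorff--Young inequality, with the constant
  $K(1/p, 1 - 1/p)$ for $1 < p \le 2$.  As the total weight is $\delta^2$, comparison of power means extends it to all of $R_F$ and to the part
  $p > 1$ of $R_T$; in $R_{TF}$ comparison with the exponent 2 on both sides and
  Plancherel are enough.  The part $p \le 1$ of $R_T$ rests on $\|x\|_1 \le \|x\|_p$, that is, on every nonzero projection having trace at least 1
  (\<open>projection_trace_ge_1\<close>), which is itself a consequence of \<open>plancherel\<close> and \<open>key_inequality\<close>.

  The equalities between networks are equalities between composites of explicit tangles.  Being planar,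
  being a composite and being isotopic are decidable for these; the decision procedures are proved
  sound, and then evaluated by rewriting.
\<close>

section \<open>Riesz--Thorin interpolation for finite weighted spaces\<close>

text \<open>
  Hadamard's three lines theorem.  Dividing by $M_0^{1-z} M_1^z$ makes both boundary values at most 1, and
  the factor $e^{\varepsilon (z^2 - 1)}$, which decays along the strip and tends to 1 as $\varepsilon \to 0$, allows
  the maximum principle to be applied on a long rectangle.
\<close>

lemma three_lines:
  fixes f :: "complex \<Rightarrow> complex"
  assumes hol: "f holomorphic_on UNIV"
    and bd: "\<And>z. 0 \<le> Re z \<Longrightarrow> Re z \<le> 1 \<Longrightarrow> norm (f z) \<le> C"
    and l: "\<And>z. Re z = 0 \<Longrightarrow> norm (f z) \<le> M0" and r: "\<And>z. Re z = 1 \<Longrightarrow> norm (f z) \<le> M1"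
    and pos: "0 < M0" "0 < M1" and th: "0 \<le> \<theta>" "\<theta> \<le> 1"
  shows "norm (f (of_real \<theta>)) \<le> M0 powr (1 - \<theta>) * M1 powr \<theta>"
proof -
  define u where "u x = exp (- (1 - x) * ln M0 - x * ln M1)" for x :: real
  define g where "g e z = f z * exp (- (1 - z) * of_real (ln M0) - z * of_real (ln M1)) *
      exp (of_real e * (z\<^sup>2 - 1))" for e :: real and z
  have ng: "norm (g e z) = norm (f z) * u (Re z) * exp (e * ((Re z)\<^sup>2 - (Im z)\<^sup>2 - 1))" for e z
    by (simp add: g_def u_def norm_mult power2_eq_square)
  have u0: "u x \<ge> 0" for x by (simp add: u_def)
  have u_end: "u 0 = 1 / M0" "u 1 = 1 / M1" using pos by (simp_all add: u_def exp_minus divide_inverse)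
  obtain U where U: "\<And>x. 0 \<le> x \<Longrightarrow> x \<le> 1 \<Longrightarrow> u x \<le> U"
  proof -
    have "compact (u ` {0..1})" unfolding u_def
      by (intro compact_continuous_image continuous_intros) auto
    then have "bdd_above (u ` {0..1})" by (intro bounded_imp_bdd_above compact_imp_bounded)
    then obtain U where "\<forall>y \<in> u ` {0..1}. y \<le> U" unfolding bdd_above_def by blast
    then show ?thesis using that[of U] by auto
  qed
  have C0: "0 \<le> C" using bd[of 0] by (metis norm_ge_zero order_trans zero_complex.sel(1) zero_le_one order_refl)
  have U0: "0 \<le> U" using U[of 0] u0[of 0] by simp
  have sq: "x\<^sup>2 \<le> 1" if "0 \<le> x" "x \<le> 1" for x :: real using that by (simp add: power_le_one)
  have main: "norm (g e (of_real \<theta>)) \<le> 1" if e: "e > 0" for e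
  proof -
    \<comment> \<open>beyond this height the decay $e^{-\varepsilon R^2}$ beats the bound on the strip\<close>
    define R where "R = sqrt (C * U / e)"
    have R: "0 \<le> R" "C * U \<le> e * R\<^sup>2"
      using e C0 U0 by (auto simp: R_def)
    define S where "S = cbox (Complex 0 (- R)) (Complex 1 R)"
    have "norm (g e (of_real \<theta>)) \<le> 1"
    proof (rule maximum_modulus_frontier[of "g e" S])
      have h: "g e holomorphic_on UNIV"
        unfolding g_def using hol by (intro holomorphic_intros) auto
      then show "g e holomorphic_on interior S" by (rule holomorphic_on_subset) auto
      show "continuous_on (closure S) (g e)"
        using holomorphic_on_imp_continuous_on[OF h] by (rule continuous_on_subset) auto
      show "bounded S" by (simp add: S_def)
      show "of_real \<theta> \<in> S" using th R by (simp add: S_def in_cbox_complex_iff)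
      fix z assume z: "z \<in> frontier S"
      have "z \<in> S" "z \<notin> box (Complex 0 (- R)) (Complex 1 R)"
        using z unfolding S_def frontier_cbox by auto
      then have zz: "0 \<le> Re z" "Re z \<le> 1" "Re z = 0 \<or> Re z = 1 \<or> \<bar>Im z\<bar> = R"
        unfolding S_def in_cbox_complex_iff in_box_complex_iff by auto
      have x1: "(Re z)\<^sup>2 \<le> 1" using sq zz by blast
      consider "Re z = 0" | "Re z = 1" | "\<bar>Im z\<bar> = R" using zz by blast
      then show "norm (g e z) \<le> 1"
      proof cases
        case 1
        have "norm (f z) * u (Re z) \<le> 1" using l[OF 1] pos unfolding 1 u_end by simp
        moreover have "exp (e * ((Re z)\<^sup>2 - (Im z)\<^sup>2 - 1)) \<le> 1"
        proof -
          have "(Re z)\<^sup>2 - (Im z)\<^sup>2 - 1 \<le> 0" using x1 zero_le_power2[of "Im z"] by linarith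
          then show ?thesis using e by (simp add: mult_nonneg_nonpos)
        qed
        ultimately show ?thesis unfolding ng by - (rule mult_le_one, auto)
      next
        case 2
        have "norm (f z) * u (Re z) \<le> 1" using r[OF 2] pos unfolding 2 u_end by simp
        moreover have "exp (e * ((Re z)\<^sup>2 - (Im z)\<^sup>2 - 1)) \<le> 1"
        proof -
          have "(Re z)\<^sup>2 - (Im z)\<^sup>2 - 1 \<le> 0" using x1 zero_le_power2[of "Im z"] by linarith
          then show ?thesis using e by (simp add: mult_nonneg_nonpos)
        qed
        ultimately show ?thesis unfolding ng by - (rule mult_le_one, auto)
      next
        case 3
        have i2: "(Im z)\<^sup>2 = R\<^sup>2" using 3 by (metis power2_abs)
        have "norm (f z) * u (Re z) \<le> C * U"
          using bd U zz u0 C0 by (intro mult_mono) auto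
        also have "\<dots> \<le> exp (e * R\<^sup>2)" using R(2) exp_ge_add_one_self[of "e * R\<^sup>2"] by linarith
        finally have "norm (g e z) \<le> exp (e * R\<^sup>2) * exp (e * ((Re z)\<^sup>2 - (Im z)\<^sup>2 - 1))"
          unfolding ng by (intro mult_right_mono) auto
        also have "\<dots> = exp (e * ((Re z)\<^sup>2 - 1))" by (simp add: i2 exp_add[symmetric] algebra_simps)
        also have "\<dots> \<le> 1" using e x1 by (simp add: mult_le_0_iff)
        finally show ?thesis .
      qed
    qed
    then show ?thesis .
  qed
  have "((\<lambda>e. norm (g e (of_real \<theta>))) \<longlongrightarrow> norm (f (of_real \<theta>)) * u \<theta> * exp (0 * (\<theta>\<^sup>2 - 0\<^sup>2 - 1))) (at_right 0)"
    unfolding ng Re_complex_of_real Im_complex_of_real by (intro tendsto_intros)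
  then have "norm (f (of_real \<theta>)) * u \<theta> * exp (0 * (\<theta>\<^sup>2 - 0\<^sup>2 - 1)) \<le> 1"
    by (rule tendsto_upperbound) (auto simp: eventually_at_right_less intro!: main eventually_mono[OF eventually_at_right_less])
  then have "norm (f (of_real \<theta>)) * u \<theta> \<le> 1" by simp
  moreover have "M0 powr (1 - \<theta>) * M1 powr \<theta> = exp ((1 - \<theta>) * ln M0 + \<theta> * ln M1)"
    using pos by (simp add: powr_def exp_add)
  moreover have "u \<theta> = inverse (exp ((1 - \<theta>) * ln M0 + \<theta> * ln M1))"
    unfolding exp_minus[symmetric] by (simp add: u_def algebra_simps)
  ultimately show ?thesis by (simp add: divide_inverse[symmetric] divide_le_eq)
qed

lemma weighted_sum_pos:
  fixes a l :: "'i \<Rightarrow> real"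
  assumes "finite I" "I \<noteq> {}" "\<And>i. i \<in> I \<Longrightarrow> 0 < a i" "\<And>i. i \<in> I \<Longrightarrow> 0 < l i"
  shows "0 < (\<Sum>i\<in>I. a i * l i powr p)"
proof (rule sum_pos[OF assms(1,2)])
  fix i assume "i \<in> I"
  then show "0 < a i * l i powr p" using assms(3,4)[of i] by simp
qed

text \<open>
  Interpolation between $\ell^1 \to \ell^\infty$ and $\ell^2 \to \ell^2$, tested on the single pair of
  vectors \<open>l\<close> and \<open>m\<close>, where \<open>m\<close> is the image of \<open>l\<close>.  Raising the entries of \<open>l\<close> and \<open>m\<close> to exponents that
  are affine in \<open>z\<close> gives a function that both hypotheses bound on the edges of the strip and that is
  $\sum_j b_j m_j^{1/t}$ at $z = 2t$.
\<close>

lemma weighted_riesz_thorin: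
  fixes M :: "'j \<Rightarrow> 'i \<Rightarrow> complex" and a l :: "'i \<Rightarrow> real" and b m :: "'j \<Rightarrow> real"
  assumes fin: "finite I" "finite J" "I \<noteq> {}" "J \<noteq> {}"
    and a: "\<And>i. i \<in> I \<Longrightarrow> 0 < a i" and b: "\<And>j. j \<in> J \<Longrightarrow> 0 < b j"
    and l: "\<And>i. i \<in> I \<Longrightarrow> 0 < l i" and m: "\<And>j. j \<in> J \<Longrightarrow> 0 < m j"
    and k: "0 < k" and M1: "\<And>i j. i \<in> I \<Longrightarrow> j \<in> J \<Longrightarrow> norm (M j i) \<le> k * a i * b j"
    and M2: "\<And>c d. (norm (\<Sum>j\<in>J. \<Sum>i\<in>I. d j * M j i * c i))\<^sup>2 \<le>
          (\<Sum>j\<in>J. b j * (norm (d j))\<^sup>2) * (\<Sum>i\<in>I. a i * (norm (c i))\<^sup>2)"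
    and M3: "\<And>j. j \<in> J \<Longrightarrow> (\<Sum>i\<in>I. M j i * of_real (l i)) = of_real (m j * b j)"
    and t: "0 < t" "t \<le> 1 / 2"
  shows "(\<Sum>j\<in>J. b j * m j powr (1 / t)) powr t \<le>
      k powr (1 - 2 * t) * (\<Sum>i\<in>I. a i * l i powr (1 / (1 - t))) powr (1 - t)"
proof -
  define p q where "p = 1 / (1 - t)" and "q = 1 / t"
  have pq: "0 < p" "0 < q" "p * (1 - t) = 1" "q * t = 1" using t by (auto simp: p_def q_def)
  define S T where "S = (\<Sum>i\<in>I. a i * l i powr p)" and "T = (\<Sum>j\<in>J. b j * m j powr q)"
  have S: "0 < S" unfolding S_def by (rule weighted_sum_pos[OF fin(1,3) a l])
  have T: "0 < T" unfolding T_def by (rule weighted_sum_pos[OF fin(2,4) b m])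
  \<comment> \<open>at $z = 2t$ the exponents are 1 and $q - 1$; on the two edges they have real parts $p$, $q$ and $p/2$, $q/2$\<close>
  define c where "c z i = exp (of_real p * (1 - z / 2) * of_real (ln (l i)))" for z :: complex and i
  define d where "d z j = exp (of_real q * (1 - z / 2) * of_real (ln (m j)))" for z :: complex and j
  define f where "f z = (\<Sum>j\<in>J. \<Sum>i\<in>I. d z j * M j i * c z i)" for z
  have nc: "norm (c z i) = l i powr (p * (1 - Re z / 2))" if "i \<in> I" for z i
    using l[OF that] by (simp add: c_def powr_def)
  have nd: "norm (d z j) = m j powr (q * (1 - Re z / 2))" if "j \<in> J" for z j
    using m[OF that] by (simp add: d_def powr_def)
  have tri: "norm (f z) \<le> (\<Sum>j\<in>J. \<Sum>i\<in>I. norm (d z j) * norm (M j i) * norm (c z i))" for z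
    unfolding f_def by (intro order_trans[OF norm_sum] sum_mono) (simp add: norm_mult)
  have "norm (f (of_real (2 * t))) \<le> (k * S * T) powr (1 - 2 * t) * (sqrt (T * S)) powr (2 * t)"
  proof (rule three_lines)
    show "f holomorphic_on UNIV"
      unfolding f_def c_def d_def by (intro holomorphic_intros) auto
  next
    fix z :: complex assume z: "0 \<le> Re z" "Re z \<le> 1"
    have e: "x powr (r * (1 - Re z / 2)) \<le> exp (r * \<bar>ln x\<bar>)" if "0 < x" "0 < r" for x r :: real
    proof -
      have "(1 - Re z / 2) * ln x \<le> (1 - Re z / 2) * \<bar>ln x\<bar>"
        using z by (intro mult_left_mono) auto
      also have "\<dots> \<le> 1 * \<bar>ln x\<bar>" using z by (intro mult_right_mono) auto
      finally have "(1 - Re z / 2) * ln x \<le> 1 * \<bar>ln x\<bar>" .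
      then have "r * ((1 - Re z / 2) * ln x) \<le> r * (1 * \<bar>ln x\<bar>)" using that by (intro mult_left_mono) auto
      then show ?thesis using that by (simp add: powr_def mult.assoc)
    qed
    show "norm (f z) \<le> (\<Sum>j\<in>J. \<Sum>i\<in>I. exp (q * \<bar>ln (m j)\<bar>) * norm (M j i) * exp (p * \<bar>ln (l i)\<bar>))"
      by (intro order_trans[OF tri] sum_mono mult_mono)
        (use e l m pq in \<open>auto simp: nc nd\<close>)
  next
    fix z :: complex assume z: "Re z = 0"
    have "norm (f z) \<le> (\<Sum>j\<in>J. \<Sum>i\<in>I. m j powr q * (k * a i * b j) * l i powr p)"
      by (intro order_trans[OF tri] sum_mono mult_mono)
        (use M1 k a b z in \<open>auto simp: nc nd less_imp_le intro!: mult_nonneg_nonneg\<close>)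
    also have "\<dots> = k * S * T"
      unfolding S_def T_def by (simp add: sum_product sum_distrib_left sum_distrib_right mult_ac, subst sum.swap, simp add: mult_ac)
    finally show "norm (f z) \<le> k * S * T" .
  next
    fix z :: complex assume z: "Re z = 1"
    have "(norm (f z))\<^sup>2 \<le> (\<Sum>j\<in>J. b j * (norm (d z j))\<^sup>2) * (\<Sum>i\<in>I. a i * (norm (c z i))\<^sup>2)"
      unfolding f_def by (rule M2)
    also have "\<dots> = T * S"
      unfolding T_def S_def by (intro arg_cong2[where f = "(*)"] sum.cong refl)
        (simp_all add: nc nd z power2_eq_square powr_add[symmetric])
    finally show "norm (f z) \<le> sqrt (T * S)" by (rule real_le_rsqrt)
  qed (use S T k t in auto)
  also have "(sqrt (T * S)) powr (2 * t) = (T * S) powr t"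
    using S T by (simp add: powr_half_sqrt[symmetric] powr_powr)
  also have "f (of_real (2 * t)) = of_real T"
  proof -
    have c1: "c (of_real (2 * t)) i = of_real (l i)" if "i \<in> I" for i
    proof -
      have "c (of_real (2 * t)) i = exp (of_real (p * (1 - t) * ln (l i)))" by (simp add: c_def)
      then show ?thesis using l[OF that] by (simp add: pq(3) exp_of_real)
    qed
    have d1: "d (of_real (2 * t)) j * of_real (m j * b j) = of_real (b j * m j powr q)" if "j \<in> J" for j
    proof -
      have "d (of_real (2 * t)) j = exp (of_real (q * (1 - t) * ln (m j)))" by (simp add: d_def)
      also have "q * (1 - t) * ln (m j) = q * ln (m j) - ln (m j)" using pq(4) by (simp add: algebra_simps)
      also have "exp (complex_of_real (q * ln (m j) - ln (m j))) = of_real (m j powr q / m j)"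
        unfolding exp_of_real using m[OF that] by (simp add: exp_diff powr_def)
      finally show ?thesis using m[OF that] by simp
    qed
    have "f (of_real (2 * t)) = (\<Sum>j\<in>J. d (of_real (2 * t)) j * (\<Sum>i\<in>I. M j i * c (of_real (2 * t)) i))"
      unfolding f_def by (simp add: sum_distrib_left mult.assoc)
    also have "\<dots> = (\<Sum>j\<in>J. of_real (b j * m j powr q))"
      by (intro sum.cong refl) (metis (no_types, lifting) M3 c1 d1 sum.cong)
    finally show ?thesis by (simp add: T_def)
  qed
  also have "norm (complex_of_real T) = T" using T by simp
  finally have "T \<le> (k * S * T) powr (1 - 2 * t) * (T * S) powr t" .
  also have "\<dots> = k powr (1 - 2 * t) * S powr (1 - t) * T powr (1 - t)"
  proof -
    have "(k * S * T) powr (1 - 2 * t) * (T * S) powr t =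
        k powr (1 - 2 * t) * (S powr (1 - 2 * t) * S powr t) * (T powr (1 - 2 * t) * T powr t)"
      using S T k by (simp add: powr_mult mult_ac)
    then show ?thesis by (simp add: powr_add[symmetric])
  qed
  finally have "T powr t * T powr (1 - t) \<le> k powr (1 - 2 * t) * S powr (1 - t) * T powr (1 - t)"
    using T by (simp add: powr_add[symmetric])
  then have "T powr t \<le> k powr (1 - 2 * t) * S powr (1 - t)"
    using T by (simp add: mult_le_cancel_right)
  then show ?thesis by (simp add: S_def T_def p_def q_def)
qed

text \<open>
  Bernoulli's inequality for the ratios of $l_i^p$ to their mean; since only an upper bound of the
  total weight enters, the factor $1/p - 1/q \ge 0$ in front of its logarithm matters.
\<close>

lemma power_mean:
  fixes w l :: "'i \<Rightarrow> real"
  assumes fin: "finite I" "I \<noteq> {}" and w: "\<And>i. i \<in> I \<Longrightarrow> 0 < w i" and l: "\<And>i. i \<in> I \<Longrightarrow> 0 < l i"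
    and W: "sum w I \<le> W" and p: "0 < p" "p \<le> q"
  shows "ln (\<Sum>i\<in>I. w i * l i powr p) / p \<le> (1 / p - 1 / q) * ln W + ln (\<Sum>i\<in>I. w i * l i powr q) / q"
proof -
  define r where "r = q / p"
  have r: "r \<ge> 1" "q = p * r" "0 < q" using p by (auto simp: r_def)
  define w0 where "w0 = sum w I"
  have w0: "0 < w0" unfolding w0_def using fin w by (intro sum_pos) auto
  define S where "S = (\<Sum>i\<in>I. w i * l i powr p)"
  have S: "0 < S" unfolding S_def by (rule weighted_sum_pos[OF fin w l])
  define y where "y i = l i powr p / (S / w0)" for i
  have y: "0 < y i" if "i \<in> I" for i using l[OF that] S w0 by (simp add: y_def)
  have bern: "1 + r * (x - 1) \<le> x powr r" if "0 < x" for x :: real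
  proof -
    have "(x powr r) powr (1 / r) * 1 powr (1 - 1 / r) \<le> 1 / r * x powr r + (1 - 1 / r) * 1"
      by (rule Youngs_inequality_0) (use r that in auto)
    then have "x \<le> x powr r / r + (1 - 1 / r)" using that r by (simp add: powr_powr)
    then have "r * x \<le> r * (x powr r / r + (1 - 1 / r))" using r by (intro mult_left_mono) auto
    then show ?thesis using r by (simp add: algebra_simps)
  qed
  have "w0 = (\<Sum>i\<in>I. w i * (1 + r * (y i - 1)))"
  proof -
    have "(\<Sum>i\<in>I. w i * (l i powr p * c)) = S * c" for c
      by (simp add: S_def sum_distrib_right mult.assoc)
    from this[of "w0 / S"] have "(\<Sum>i\<in>I. w i * y i) = w0"
      using S by (simp add: y_def)
    then have "(\<Sum>i\<in>I. w i * (1 + r * (y i - 1))) = w0 + r * (w0 - w0)"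
      by (simp add: w0_def sum.distrib sum_subtractf sum_distrib_left[symmetric] algebra_simps)
    then show ?thesis by simp
  qed
  also have "\<dots> \<le> (\<Sum>i\<in>I. w i * y i powr r)"
    using bern y w by (intro sum_mono mult_left_mono) (auto simp: less_imp_le)
  also have "\<dots> = (\<Sum>i\<in>I. w i * l i powr q) / (S / w0) powr r"
    unfolding sum_divide_distrib
  proof (intro sum.cong refl)
    fix i assume "i \<in> I"
    have "y i powr r = l i powr q / (S / w0) powr r"
      unfolding y_def using S w0 by (subst powr_divide) (auto simp: powr_powr r(2))
    then show "w i * y i powr r = w i * l i powr q / (S / w0) powr r" by simp
  qed
  finally have "w0 * (S / w0) powr r \<le> (\<Sum>i\<in>I. w i * l i powr q)"
    using S w0 by (simp add: pos_le_divide_eq)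
  then have "ln (w0 * (S / w0) powr r) \<le> ln (\<Sum>i\<in>I. w i * l i powr q)"
    using S w0 by (intro ln_mono) auto
  then have "ln w0 + r * (ln S - ln w0) \<le> ln (\<Sum>i\<in>I. w i * l i powr q)"
    using S w0 by (simp add: ln_mult ln_powr ln_div)
  then have "(ln w0 + r * (ln S - ln w0)) / q \<le> ln (\<Sum>i\<in>I. w i * l i powr q) / q"
    using r by (intro divide_right_mono) auto
  moreover have "(ln w0 + r * (ln S - ln w0)) / q = ln S / p - (1 / p - 1 / q) * ln w0"
    using p by (simp add: r_def field_simps)
  moreover have "(1 / p - 1 / q) * ln w0 \<le> (1 / p - 1 / q) * ln W"
    using p w0 W unfolding w0_def by (intro mult_left_mono ln_mono) (auto simp: frac_le)
  ultimately show ?thesis unfolding S_def by linarith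
qed

text \<open>
  Weights that are at least 1 make the $\ell^p$ norms decrease in \<open>p\<close>, so for $p \le 1$ the bound from
  $\ell^1$ to $\ell^\infty$ suffices.
\<close>

lemma atomic_bound:
  fixes M :: "'j \<Rightarrow> 'i \<Rightarrow> complex" and a l :: "'i \<Rightarrow> real" and b m :: "'j \<Rightarrow> real"
  assumes fin: "finite I" "finite J" "I \<noteq> {}" "J \<noteq> {}"
    and a: "\<And>i. i \<in> I \<Longrightarrow> 1 \<le> a i" and b: "\<And>j. j \<in> J \<Longrightarrow> 0 < b j"
    and l: "\<And>i. i \<in> I \<Longrightarrow> 0 < l i" and m: "\<And>j. j \<in> J \<Longrightarrow> 0 < m j"
    and D: "0 < D" and W: "sum b J \<le> D\<^sup>2"
    and M1: "\<And>i j. i \<in> I \<Longrightarrow> j \<in> J \<Longrightarrow> norm (M j i) \<le> 1 / D * a i * b j"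
    and M3: "\<And>j. j \<in> J \<Longrightarrow> (\<Sum>i\<in>I. M j i * of_real (l i)) = of_real (m j * b j)"
    and p: "0 < p" "p \<le> 1" and q: "0 < q"
  shows "ln (\<Sum>j\<in>J. b j * m j powr q) / q \<le> (2 / q - 1) * ln D + ln (\<Sum>i\<in>I. a i * l i powr p) / p"
proof -
  define N where "N = (\<Sum>i\<in>I. a i * l i powr p)"
  have a0: "\<And>i. i \<in> I \<Longrightarrow> 0 < a i" using a by force
  have N: "0 < N" unfolding N_def by (rule weighted_sum_pos[OF fin(1,3) a0 l])
  have lN: "l i powr p \<le> N" if "i \<in> I" for i
  proof -
    have "l i powr p \<le> a i * l i powr p" using a[OF that] by (simp add: mult_le_cancel_right1)
    also have "\<dots> \<le> N" unfolding N_def using fin that a0 by (intro member_le_sum) (auto simp: less_imp_le)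
    finally show ?thesis .
  qed
  have l1: "l i \<le> l i powr p * N powr (1 / p - 1)" if i: "i \<in> I" for i
  proof -
    have "l i = l i powr p * (l i powr p) powr (1 / p - 1)"
      using l[OF i] p by (simp add: powr_powr powr_add[symmetric] algebra_simps)
    also have "\<dots> \<le> l i powr p * N powr (1 / p - 1)"
      using lN[OF i] p by (intro mult_left_mono powr_mono2) auto
    finally show ?thesis .
  qed
  have sl: "(\<Sum>i\<in>I. a i * l i) \<le> N powr (1 / p)"
  proof -
    have "(\<Sum>i\<in>I. a i * l i) \<le> (\<Sum>i\<in>I. a i * (l i powr p * N powr (1 / p - 1)))"
      using l1 a0 by (intro sum_mono mult_left_mono) (auto simp: less_imp_le)
    also have "\<dots> = N * N powr (1 / p - 1)" by (simp add: N_def sum_distrib_right mult.assoc)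
    also have "\<dots> = N powr (1 / p)" using N by (simp add: powr_mult_base)
    finally show ?thesis .
  qed
  have mj: "m j \<le> N powr (1 / p) / D" if j: "j \<in> J" for j
  proof -
    have "m j * b j = norm (\<Sum>i\<in>I. M j i * of_real (l i))" using M3[OF j] m[OF j] b[OF j] by (simp add: norm_mult)
    also have "\<dots> \<le> (\<Sum>i\<in>I. (1 / D * a i * b j) * l i)"
    proof (intro order_trans[OF norm_sum] sum_mono)
      fix i assume i: "i \<in> I"
      have "norm (M j i) * l i \<le> (1 / D * a i * b j) * l i"
        using M1[OF i j] l[OF i] by (intro mult_right_mono) auto
      then show "norm (M j i * of_real (l i)) \<le> (1 / D * a i * b j) * l i"
        using l[OF i] by (simp add: norm_mult)
    qed
    also have "\<dots> = b j / D * (\<Sum>i\<in>I. a i * l i)" by (simp add: sum_distrib_left mult_ac)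
    also have "\<dots> \<le> b j / D * N powr (1 / p)" using sl b[OF j] D by (intro mult_left_mono) auto
    finally show ?thesis using b[OF j] D by (simp add: field_simps)
  qed
  have "(\<Sum>j\<in>J. b j * m j powr q) \<le> (\<Sum>j\<in>J. b j * (N powr (1 / p) / D) powr q)"
    using mj m b q by (intro sum_mono mult_left_mono powr_mono2) (auto simp: less_imp_le)
  also have "\<dots> = sum b J * (N powr (1 / p) / D) powr q" by (simp add: sum_distrib_right)
  also have "\<dots> \<le> D\<^sup>2 * (N powr (1 / p) / D) powr q" using W by (intro mult_right_mono) auto
  finally have *: "(\<Sum>j\<in>J. b j * m j powr q) \<le> D\<^sup>2 * (N powr (1 / p) / D) powr q" .
  have "0 < (\<Sum>j\<in>J. b j * m j powr q)"
    by (rule weighted_sum_pos[OF fin(2,4) b m])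
  then have "ln (\<Sum>j\<in>J. b j * m j powr q) \<le> ln (D\<^sup>2 * (N powr (1 / p) / D) powr q)"
    using * by (intro ln_mono) auto
  also have "\<dots> = 2 * ln D + q * (ln N / p - ln D)"
    using D N by (simp add: ln_mult ln_powr ln_div ln_realpow)
  finally have "ln (\<Sum>j\<in>J. b j * m j powr q) / q \<le> (2 * ln D + q * (ln N / p - ln D)) / q"
    using q by (intro divide_right_mono) auto
  also have "\<dots> = (2 / q - 1) * ln D + ln N / p" using q by (simp add: field_simps)
  finally show ?thesis by (simp add: N_def)
qed

text \<open>
  With $s = 1/p$ and $t = 1/q$, the map $s \mapsto \log\|l\|_{1/s} - 2 s \log D$ is decreasing, and the same holds
  for \<open>m\<close>.  So the three formulas for \<open>K\<close> propagate from the segment $s + t = 1$, $t \le 1/2$ (interpolation),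
  from the point $s = t = 1/2$ (both norms are 1), and from the half-line $s \ge 1$ (weights at least 1).
\<close>

theorem matrix_norm_bound:
  fixes M :: "'j \<Rightarrow> 'i \<Rightarrow> complex" and a l :: "'i \<Rightarrow> real" and b m :: "'j \<Rightarrow> real"
  assumes fin: "finite I" "finite J" "I \<noteq> {}" "J \<noteq> {}"
    and a: "\<And>i. i \<in> I \<Longrightarrow> 1 \<le> a i" and b: "\<And>j. j \<in> J \<Longrightarrow> 0 < b j"
    and l: "\<And>i. i \<in> I \<Longrightarrow> 0 < l i" and m: "\<And>j. j \<in> J \<Longrightarrow> 0 < m j"
    and D: "0 < D" and W: "sum a I \<le> D\<^sup>2" "sum b J \<le> D\<^sup>2"
    and M1: "\<And>i j. i \<in> I \<Longrightarrow> j \<in> J \<Longrightarrow> norm (M j i) \<le> 1 / D * a i * b j"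
    and M2: "\<And>c d. (norm (\<Sum>j\<in>J. \<Sum>i\<in>I. d j * M j i * c i))\<^sup>2 \<le>
          (\<Sum>j\<in>J. b j * (norm (d j))\<^sup>2) * (\<Sum>i\<in>I. a i * (norm (c i))\<^sup>2)"
    and M3: "\<And>j. j \<in> J \<Longrightarrow> (\<Sum>i\<in>I. M j i * of_real (l i)) = of_real (m j * b j)"
    and two: "(\<Sum>i\<in>I. a i * (l i)\<^sup>2) = 1" "(\<Sum>j\<in>J. b j * (m j)\<^sup>2) = 1"
    and p: "0 < p" and q: "0 < q"
  shows "ln (\<Sum>i\<in>I. a i * l i powr p) / p - ln (\<Sum>j\<in>J. b j * m j powr q) / q \<ge> - ln (K D (1 / p) (1 / q))"
proof -
  define L where "L p = ln (\<Sum>i\<in>I. a i * l i powr p) / p" for p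
  define N where "N q = ln (\<Sum>j\<in>J. b j * m j powr q) / q" for q
  define s t where "s = 1 / p" and "t = 1 / q"
  have st: "0 < s" "0 < t" "p = 1 / s" "q = 1 / t" using p q by (auto simp: s_def t_def)
  have a0: "\<And>i. i \<in> I \<Longrightarrow> 0 < a i" using a by force
  have D2: "ln (D\<^sup>2) = 2 * ln D" using D by (simp add: ln_realpow)
  have PL: "L (1 / u) \<le> (u - v) * (2 * ln D) + L (1 / v)" if "0 < v" "v \<le> u" for u v
    using power_mean[OF fin(1,3) a0 l W(1), where p = "1 / u" and q = "1 / v"] that D2 by (simp add: L_def frac_le)
  have PN: "N (1 / u) \<le> (u - v) * (2 * ln D) + N (1 / v)" if "0 < v" "v \<le> u" for u v
    using power_mean[OF fin(2,4) b m W(2), where p = "1 / u" and q = "1 / v"] that D2 by (simp add: N_def frac_le)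
  have "(\<Sum>i\<in>I. a i * l i powr 2) = 1"
    unfolding two(1)[symmetric] using l by (intro sum.cong refl) (simp add: less_imp_le)
  moreover have "(\<Sum>j\<in>J. b j * m j powr 2) = 1"
    unfolding two(2)[symmetric] using m by (intro sum.cong refl) (simp add: less_imp_le)
  ultimately have L2: "L 2 = 0" "N 2 = 0" by (simp_all add: L_def N_def)
  have HY: "N (1 / u) \<le> - (1 - 2 * u) * ln D + L (1 / (1 - u))" if u: "0 < u" "u \<le> 1 / 2" for u
  proof -
    have "(\<Sum>j\<in>J. b j * m j powr (1 / u)) powr u \<le>
      (1 / D) powr (1 - 2 * u) * (\<Sum>i\<in>I. a i * l i powr (1 / (1 - u))) powr (1 - u)"
      by (rule weighted_riesz_thorin[OF fin a0 b l m _ M1 M2 M3 u]) (use D in auto)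
    moreover have "0 < (\<Sum>j\<in>J. b j * m j powr (1 / u))"
      by (rule weighted_sum_pos[OF fin(2,4) b m])
    moreover have "0 < (\<Sum>i\<in>I. a i * l i powr (1 / (1 - u)))"
      by (rule weighted_sum_pos[OF fin(1,3) a0 l])
    ultimately have "ln ((\<Sum>j\<in>J. b j * m j powr (1 / u)) powr u) \<le>
      ln ((1 / D) powr (1 - 2 * u) * (\<Sum>i\<in>I. a i * l i powr (1 / (1 - u))) powr (1 - u))"
      using D by (intro ln_mono) auto
    then show ?thesis
      using \<open>0 < sum _ J\<close> \<open>0 < sum _ I\<close> D by (simp add: L_def N_def ln_mult ln_powr ln_div algebra_simps)
  qed
  have "N q \<le> ln (K D s t) + L p"
  proof (cases "(s, t) \<in> R_F")
    case True
    then have T: "t \<le> 1 / 2" "s \<le> 1 - t" by (auto simp: R_F_def)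
    have "ln (K D s t) = (1 - 2 * s) * ln D" using True D by (simp add: K_def ln_powr)
    then show ?thesis using HY[of t] PL[of s "1 - t"] T st by (simp add: algebra_simps)
  next
    case nF: False
    show ?thesis
    proof (cases "(s, t) \<in> R_T")
      case True
      then have T: "1 / 2 \<le> s" "1 \<le> s + t" by (auto simp: R_T_def)
      have K: "ln (K D s t) = (2 * t - 1) * ln D" using nF True D by (simp add: K_def ln_powr)
      show ?thesis
      proof (cases "s < 1")
        case True
        then show ?thesis using HY[of "1 - s"] PN[of "1 - s" t] T st K by (simp add: algebra_simps)
      next
        case False
        then have "p \<le> 1" using st by simp
        then have "N q \<le> (2 / q - 1) * ln D + L p"
          unfolding N_def L_def by (intro atomic_bound[OF fin a b l m D W(2) M1 M3 p]) (use q in auto)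
        then show ?thesis using K st by simp
      qed
    next
      case nT: False
      have T: "s \<le> 1 / 2" "1 / 2 \<le> t" using nF nT st by (auto simp: R_F_def R_T_def)
      have "ln (K D s t) = (2 * t - 2 * s) * ln D" using nF nT D by (simp add: K_def ln_powr)
      then show ?thesis using PN[of "1 / 2" t] PL[of s "1 / 2"] L2 T st by (simp add: algebra_simps)
    qed
  qed
  then show ?thesis by (simp add: L_def N_def s_def t_def)
qed

section \<open>Positive sesquilinear forms\<close>

lemma (in vector_space) dim_1_multiple:
  assumes "dim W = 1" "b \<in> W" "b \<noteq> 0" "x \<in> W"
  obtains a where "x = scale a b"
proof -
  obtain B where B: "W \<subseteq> span B" "card B = dim W" using basis_exists[of W] by metis
  then obtain c where c: "B = {c}" using assms(1) by (auto simp: card_1_singleton_iff)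
  then have "b \<in> range (\<lambda>k. scale k c)" "x \<in> range (\<lambda>k. scale k c)"
    using assms(2,4) B(1) by (auto simp: span_singleton)
  then obtain k k' where k: "b = scale k c" "x = scale k' c" by blast
  then have "k \<noteq> 0" using assms(3) by auto
  then have "x = scale (k' / k) b" by (simp add: k)
  then show thesis by (rule that)
qed

text \<open>
  The trace inner products of the 2-box and of the 3-box spaces.  Hermitian symmetry need not be
  assumed: it follows by polarization from the form being real on the diagonal, so that no further
  identity between 3-box networks has to be established.
\<close>

locale positive_form = vector_space scale
  for scale :: "complex \<Rightarrow> 'a::ab_group_add \<Rightarrow> 'a" +
  fixes W :: "'a set" and form :: "'a \<Rightarrow> 'a \<Rightarrow> complex"
  assumes W: "subspace W"
    and lin: "x \<in> W \<Longrightarrow> y \<in> W \<Longrightarrow> z \<in> W \<Longrightarrow> form z (scale a x + y) = a * form z x + form z y"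
    and conj_lin: "x \<in> W \<Longrightarrow> y \<in> W \<Longrightarrow> z \<in> W \<Longrightarrow> form (scale a x + y) z = cnj a * form x z + form y z"
    and pos: "x \<in> W \<Longrightarrow> x \<noteq> 0 \<Longrightarrow> form x x \<in> \<real> \<and> 0 < Re (form x x)"
begin

lemma form_0: "x \<in> W \<Longrightarrow> form x 0 = 0" "x \<in> W \<Longrightarrow> form 0 x = 0"
  using lin[of 0 0 x 1] conj_lin[of 0 0 x 1] W by (auto simp: subspace_0)

lemma form_real: "x \<in> W \<Longrightarrow> Im (form x x) = 0"
  using pos[of x] form_0[of x] by (cases "x = 0") (auto simp: complex_is_Real_iff)

lemma form_nonneg: "x \<in> W \<Longrightarrow> 0 \<le> Re (form x x)"
  using pos[of x] form_0[of x] by (cases "x = 0") auto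

lemma form_expand:
  assumes "x \<in> W" "y \<in> W"
  shows "form (scale a x + y) (scale a x + y) =
    cnj a * a * form x x + cnj a * form x y + a * form y x + form y y"
  using assms W by (simp add: lin conj_lin subspace_add subspace_scale) (simp add: algebra_simps)

lemma hermitian:
  assumes x: "x \<in> W" and y: "y \<in> W"
  shows "form y x = cnj (form x y)"
proof -
  have i: "Im (cnj a * form x y + a * form y x) = 0" for a
  proof -
    have "scale a x + y \<in> W" using x y W by (simp add: subspace_add subspace_scale)
    from form_real[OF this] show ?thesis
      unfolding form_expand[OF x y] using form_real[OF x] form_real[OF y] by (simp add: algebra_simps)
  qed
  from i[of 1] i[of \<i>] show ?thesis by (simp add: complex_eq_iff)
qed

lemma cauchy_schwarz:
  assumes x: "x \<in> W" and y: "y \<in> W"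
  shows "(norm (form x y))\<^sup>2 \<le> Re (form x x) * Re (form y y)"
proof (cases "x = 0")
  case True
  then show ?thesis using form_0(2)[OF y] form_0(1)[OF subspace_0[OF W]] by simp
next
  case False
  then have p: "0 < Re (form x x)" using pos x by blast
  define r where "r = Re (form x x)"
  have r: "form x x = of_real r" "0 < r" using p form_real[OF x] by (auto simp: r_def complex_eq_iff)
  have "scale (- (form x y / of_real r)) x + y \<in> W" (is "scale ?a x + y \<in> W")
    using x y W by (simp add: subspace_diff subspace_scale)
  from form_nonneg[OF this] have "0 \<le> Re (cnj ?a * ?a * form x x + cnj ?a * form x y + ?a * form y x + form y y)"
    unfolding form_expand[OF x y] .
  also have "cnj ?a * ?a * form x x + cnj ?a * form x y + ?a * form y x + form y y =
      form y y - form x y * cnj (form x y) / of_real r"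
    using r by (simp add: hermitian[OF x y] divide_simps)
  also have "form x y * cnj (form x y) = of_real ((norm (form x y))\<^sup>2)"
    by (rule complex_norm_square[symmetric])
  also have "Re (form y y - of_real ((norm (form x y))\<^sup>2) / of_real r) = Re (form y y) - (norm (form x y))\<^sup>2 / r"
    by (simp flip: of_real_divide)
  finally have "(norm (form x y))\<^sup>2 / r \<le> Re (form y y)" by simp
  then have "(norm (form x y))\<^sup>2 \<le> Re (form y y) * r" using r(2) by (simp add: divide_le_eq)
  then show ?thesis by (simp add: r_def mult.commute)
qed

end

section \<open>Finite-dimensional star algebras with a faithful trace\<close>

text \<open>
  A relativized finite-dimensional star algebra with a faithful positive trace, that is, a
  finite-dimensional C*-algebra, described by the properties of the 2-box spaces that are used.
\<close>

locale tracial_star_algebra = vector_space scale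
  for scale :: "complex \<Rightarrow> 'a::ab_group_add \<Rightarrow> 'a" +
  fixes V :: "'a set" and mul :: "'a \<Rightarrow> 'a \<Rightarrow> 'a" (infixl "\<odot>" 70) and one :: 'a
    and star :: "'a \<Rightarrow> 'a" and tr :: "'a \<Rightarrow> complex"
  assumes V: "subspace V"
    and fin: "\<exists>B. finite B \<and> span B = V"
    and mul_closed: "x \<in> V \<Longrightarrow> y \<in> V \<Longrightarrow> x \<odot> y \<in> V"
    and one_closed: "one \<in> V"
    and star_closed: "x \<in> V \<Longrightarrow> star x \<in> V"
    and mul_left: "x \<in> V \<Longrightarrow> y \<in> V \<Longrightarrow> z \<in> V \<Longrightarrow> (scale a x + y) \<odot> z = scale a (x \<odot> z) + y \<odot> z"
    and mul_right: "x \<in> V \<Longrightarrow> y \<in> V \<Longrightarrow> z \<in> V \<Longrightarrow> z \<odot> (scale a x + y) = scale a (z \<odot> x) + z \<odot> y"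
    and mul_assoc: "x \<in> V \<Longrightarrow> y \<in> V \<Longrightarrow> z \<in> V \<Longrightarrow> (x \<odot> y) \<odot> z = x \<odot> (y \<odot> z)"
    and one_left: "x \<in> V \<Longrightarrow> one \<odot> x = x"
    and one_right: "x \<in> V \<Longrightarrow> x \<odot> one = x"
    and star_star: "x \<in> V \<Longrightarrow> star (star x) = x"
    and star_lin: "x \<in> V \<Longrightarrow> y \<in> V \<Longrightarrow> star (scale a x + y) = scale (cnj a) (star x) + star y"
    and star_mul: "x \<in> V \<Longrightarrow> y \<in> V \<Longrightarrow> star (x \<odot> y) = star y \<odot> star x"
    and tr_lin: "x \<in> V \<Longrightarrow> y \<in> V \<Longrightarrow> tr (scale a x + y) = a * tr x + tr y"
    and tr_comm: "x \<in> V \<Longrightarrow> y \<in> V \<Longrightarrow> tr (x \<odot> y) = tr (y \<odot> x)"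
    and tr_pos: "x \<in> V \<Longrightarrow> x \<noteq> 0 \<Longrightarrow> tr (star x \<odot> x) \<in> \<real> \<and> 0 < Re (tr (star x \<odot> x))"
begin

lemma zero_closed [simp]: "0 \<in> V" and add_closed: "x \<in> V \<Longrightarrow> y \<in> V \<Longrightarrow> x + y \<in> V"
  and scale_closed: "x \<in> V \<Longrightarrow> scale a x \<in> V" and diff_closed: "x \<in> V \<Longrightarrow> y \<in> V \<Longrightarrow> x - y \<in> V"
  and sum_closed: "(\<And>i. i \<in> I \<Longrightarrow> f i \<in> V) \<Longrightarrow> sum f I \<in> V"
  using V by (auto simp: subspace_0 subspace_add subspace_scale subspace_diff subspace_sum)

lemmas closed = mul_closed one_closed star_closed zero_closed add_closed scale_closed diff_closed

lemma mul_add_left: "x \<in> V \<Longrightarrow> y \<in> V \<Longrightarrow> z \<in> V \<Longrightarrow> (x + y) \<odot> z = x \<odot> z + y \<odot> z"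
  using mul_left[of x y z 1] by simp

lemma mul_add_right: "x \<in> V \<Longrightarrow> y \<in> V \<Longrightarrow> z \<in> V \<Longrightarrow> z \<odot> (x + y) = z \<odot> x + z \<odot> y"
  using mul_right[of x y z 1] by simp

lemma mul_0_left [simp]: "z \<in> V \<Longrightarrow> 0 \<odot> z = 0"
  using mul_add_left[of 0 0 z] by simp

lemma mul_0_right [simp]: "z \<in> V \<Longrightarrow> z \<odot> 0 = 0"
  using mul_add_right[of 0 0 z] by simp

lemma mul_scale_left: "x \<in> V \<Longrightarrow> z \<in> V \<Longrightarrow> scale a x \<odot> z = scale a (x \<odot> z)"
  using mul_left[of x 0 z a] by simp

lemma mul_scale_right: "x \<in> V \<Longrightarrow> z \<in> V \<Longrightarrow> z \<odot> scale a x = scale a (z \<odot> x)"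
  using mul_right[of x 0 z a] by simp

lemma mul_diff_left: "x \<in> V \<Longrightarrow> y \<in> V \<Longrightarrow> z \<in> V \<Longrightarrow> (x - y) \<odot> z = x \<odot> z - y \<odot> z"
  using mul_left[of y x z "-1"] by simp

lemma mul_diff_right: "x \<in> V \<Longrightarrow> y \<in> V \<Longrightarrow> z \<in> V \<Longrightarrow> z \<odot> (x - y) = z \<odot> x - z \<odot> y"
  using mul_right[of y x z "-1"] by simp

lemma mul_sum_left: "(\<And>i. i \<in> I \<Longrightarrow> f i \<in> V) \<Longrightarrow> z \<in> V \<Longrightarrow> sum f I \<odot> z = (\<Sum>i\<in>I. f i \<odot> z)"
  by (induction I rule: infinite_finite_induct) (auto simp: mul_add_left sum_closed)

lemma mul_sum_right: "(\<And>i. i \<in> I \<Longrightarrow> f i \<in> V) \<Longrightarrow> z \<in> V \<Longrightarrow> z \<odot> sum f I = (\<Sum>i\<in>I. z \<odot> f i)"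
  by (induction I rule: infinite_finite_induct) (auto simp: mul_add_right sum_closed)

lemma star_0 [simp]: "star 0 = 0"
  using star_lin[of 0 0 1] by simp

lemma star_add: "x \<in> V \<Longrightarrow> y \<in> V \<Longrightarrow> star (x + y) = star x + star y"
  using star_lin[of x y 1] by simp

lemma star_scale: "x \<in> V \<Longrightarrow> star (scale a x) = scale (cnj a) (star x)"
  using star_lin[of x 0 a] by simp

lemma star_sum: "(\<And>i. i \<in> I \<Longrightarrow> f i \<in> V) \<Longrightarrow> star (sum f I) = (\<Sum>i\<in>I. star (f i))"
  by (induction I rule: infinite_finite_induct) (auto simp: star_add sum_closed)

lemma tr_0 [simp]: "tr 0 = 0"
  using tr_lin[of 0 0 1] by simp

lemma tr_add: "x \<in> V \<Longrightarrow> y \<in> V \<Longrightarrow> tr (x + y) = tr x + tr y"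
  using tr_lin[of x y 1] by simp

lemma tr_scale: "x \<in> V \<Longrightarrow> tr (scale a x) = a * tr x"
  using tr_lin[of x 0 a] by simp

lemma tr_sum: "(\<And>i. i \<in> I \<Longrightarrow> f i \<in> V) \<Longrightarrow> tr (sum f I) = (\<Sum>i\<in>I. tr (f i))"
  by (induction I rule: infinite_finite_induct) (auto simp: tr_add sum_closed)

lemma tr_nonneg: "x \<in> V \<Longrightarrow> tr (star x \<odot> x) = of_real (Re (tr (star x \<odot> x))) \<and> 0 \<le> Re (tr (star x \<odot> x))"
  using tr_pos[of x] by (cases "x = 0") (auto simp: of_real_Re)

lemma star_mul_eq_0: "x \<in> V \<Longrightarrow> star x \<odot> x = 0 \<Longrightarrow> x = 0"
  using tr_pos[of x] by auto

text \<open>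
  Spectral theory is developed from left multiplication by a self-adjoint \<open>a\<close>.  As the trace is positive,
  eigenvalues are real and generalized eigenvectors are eigenvectors, so the unit is a sum of eigenvectors
  of \<open>a\<close>; these turn out to be the spectral projections themselves.
\<close>

lemma eigenvalue_real:
  assumes a: "a \<in> V" "star a = a" and b: "b \<in> V" "b \<noteq> 0" and ab: "a \<odot> b = scale z b"
  shows "z \<in> \<real>"
proof -
  have "scale z (star b \<odot> b) = star b \<odot> (a \<odot> b)" by (simp add: ab mul_scale_right star_closed b)
  also have "\<dots> = star (a \<odot> b) \<odot> b" by (simp add: star_mul a b mul_assoc star_closed)
  also have "\<dots> = scale (cnj z) (star b \<odot> b)"
    by (simp add: ab star_scale mul_scale_left star_closed b)
  finally have "scale (z - cnj z) (star b \<odot> b) = 0" by (simp add: scale_left_diff_distrib)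
  then have "z = cnj z" using star_mul_eq_0[OF b(1)] b(2) by auto
  then show ?thesis by (metis Reals_cnj_iff)
qed

lemma generalized_eigenvector:
  assumes a: "a \<in> V" "star a = a" and b: "b \<in> V" and r: "r \<in> \<real>"
    and c: "c = a \<odot> b - scale r b" and "a \<odot> c = scale r c"
  shows "c = 0"
proof (rule star_mul_eq_0)
  show cV: "c \<in> V" using a b by (simp add: c closed)
  have "star c = star b \<odot> a - scale r (star b)"
    using star_lin[of b "a \<odot> b" "-r"] r a b by (simp add: c star_mul closed Reals_cnj_iff)
  then show "star c \<odot> c = 0"
    using assms(6) cV by (simp add: mul_diff_left closed a b mul_assoc mul_scale_left mul_scale_right)
qed

definition eigenvector_sum :: "'a \<Rightarrow> 'a \<Rightarrow> bool" where
  "eigenvector_sum a b \<longleftrightarrow> (\<exists>\<Lambda> B. finite \<Lambda> \<and>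
     (\<forall>t \<in> \<Lambda>. B t \<in> V \<and> a \<odot> B t = scale (complex_of_real t) (B t)) \<and> b = sum B \<Lambda>)"

text \<open>
  This removes one linear factor of a polynomial that annihilates \<open>b\<close>.  If $(a - w) b = \sum_t c_t$ with
  $a c_t = t c_t$, then subtracting $c_t / (t - w)$ from \<open>b\<close> for all $t \ne w$ leaves a generalized eigenvector
  for \<open>w\<close>, which is zero or an eigenvector.
\<close>

lemma eigenvector_sum_step:
  assumes a: "a \<in> V" "star a = a" and b: "b \<in> V" and e: "eigenvector_sum a (a \<odot> b - scale w b)"
  shows "eigenvector_sum a b"
proof -
  obtain \<Lambda> C where L: "finite \<Lambda>" and C: "\<And>t. t \<in> \<Lambda> \<Longrightarrow> C t \<in> V"
      "\<And>t. t \<in> \<Lambda> \<Longrightarrow> a \<odot> C t = scale (complex_of_real t) (C t)"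
    and s: "a \<odot> b - scale w b = sum C \<Lambda>"
    using e unfolding eigenvector_sum_def by blast
  define M where "M = {t \<in> \<Lambda>. complex_of_real t \<noteq> w}"
  define D where "D t = scale (1 / (complex_of_real t - w)) (C t)" for t
  have D: "D t \<in> V" "a \<odot> D t = scale (complex_of_real t) (D t)" if "t \<in> M" for t
    using that C a by (auto simp: D_def M_def closed mul_scale_right mult.commute)
  define c where "c = b - sum D M"
  have cV: "c \<in> V" using b D by (simp add: c_def closed sum_closed)
  have "a \<odot> c - scale w c = (a \<odot> b - scale w b) - (\<Sum>t\<in>M. a \<odot> D t - scale w (D t))"
    using D a b by (simp add: c_def mul_diff_right sum_closed mul_sum_right scale_right_diff_distrib
        scale_sum_right sum_subtractf)
  also have "(\<Sum>t\<in>M. a \<odot> D t - scale w (D t)) = sum C M"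
  proof (rule sum.cong[OF refl])
    fix t assume t: "t \<in> M"
    then have "a \<odot> D t - scale w (D t) = scale (complex_of_real t - w) (D t)"
      by (simp add: D scale_left_diff_distrib)
    also have "\<dots> = C t" using t by (simp add: D_def M_def)
    finally show "a \<odot> D t - scale w (D t) = C t" .
  qed
  also have "a \<odot> b - scale w b - sum C M = sum C (\<Lambda> - M)"
    unfolding s using L by (subst sum_diff[of \<Lambda> M]) (auto simp: M_def)
  finally have d: "a \<odot> c - scale w c = sum C (\<Lambda> - M)" .
  have CV: "\<And>t. t \<in> \<Lambda> - M \<Longrightarrow> C t \<in> V" using C by auto
  have ad: "a \<odot> sum C (\<Lambda> - M) = scale w (sum C (\<Lambda> - M))"
    using C a unfolding scale_sum_right by (subst mul_sum_right) (auto simp: M_def intro!: sum.cong)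
  have wc: "a \<odot> c = scale w c"
  proof (cases "w \<in> \<real>")
    case True
    then show ?thesis using generalized_eigenvector[OF a cV True refl] ad d by simp
  next
    case False
    then have "sum C (\<Lambda> - M) = 0" using eigenvalue_real[OF a _ _ ad] CV sum_closed by blast
    then show ?thesis using d by simp
  qed
  have bc: "b = c + sum D M" by (simp add: c_def)
  show ?thesis
  proof (cases "w \<in> \<real>")
    case True
    then obtain r where r: "w = complex_of_real r" by (auto elim: Reals_cases)
    then have rM: "r \<notin> M" "finite M" using L by (auto simp: M_def)
    show ?thesis
      unfolding eigenvector_sum_def
      by (rule exI[of _ "insert r M"], rule exI[of _ "\<lambda>t. if t = r then c else D t"])
        (use rM D cV wc r bc in \<open>auto intro!: sum.cong\<close>)
  next
    case False
    then have "c = 0" using eigenvalue_real[OF a cV _ wc] by blast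
    then show ?thesis
      unfolding eigenvector_sum_def
      by (intro exI[of _ M] exI[of _ D]) (use D bc L in \<open>auto simp: M_def\<close>)
  qed
qed

text \<open>
  Horner's scheme for $p(a) b$.
\<close>

definition poly_act :: "'a \<Rightarrow> complex poly \<Rightarrow> 'a \<Rightarrow> 'a" where
  "poly_act a p b = foldr (\<lambda>c y. scale c b + a \<odot> y) (coeffs p) 0"

lemma poly_act_0 [simp]: "poly_act a 0 b = 0"
  by (simp add: poly_act_def)

lemma poly_act_pCons: "a \<in> V \<Longrightarrow> poly_act a (pCons c p) b = scale c b + a \<odot> poly_act a p b"
  by (auto simp: poly_act_def cCons_def)

lemma poly_act_closed: "a \<in> V \<Longrightarrow> b \<in> V \<Longrightarrow> poly_act a p b \<in> V"
  by (induction p) (auto simp: poly_act_pCons closed)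

lemma poly_act_add: "a \<in> V \<Longrightarrow> b \<in> V \<Longrightarrow> poly_act a (p + q) b = poly_act a p b + poly_act a q b"
  by (induction p q rule: poly_induct2)
    (auto simp: poly_act_pCons poly_act_closed mul_add_right scale_left_distrib algebra_simps)

lemma poly_act_smult: "a \<in> V \<Longrightarrow> b \<in> V \<Longrightarrow> poly_act a (smult r p) b = scale r (poly_act a p b)"
  by (induction p) (auto simp: poly_act_pCons poly_act_closed closed mul_scale_right scale_right_distrib)

lemma poly_act_sum: "a \<in> V \<Longrightarrow> b \<in> V \<Longrightarrow> poly_act a (sum f I) b = (\<Sum>i\<in>I. poly_act a (f i) b)"
  by (induction I rule: infinite_finite_induct) (auto simp: poly_act_add)

lemma poly_act_monom: "a \<in> V \<Longrightarrow> b \<in> V \<Longrightarrow> poly_act a (monom c i) b = scale c (((\<odot>) a ^^ i) b)"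
proof (induction i)
  case (Suc i)
  have "((\<odot>) a ^^ i) b \<in> V" using Suc.prems by (induction i) (auto simp: closed)
  then show ?case using Suc by (simp add: monom_Suc poly_act_pCons mul_scale_right)
qed (simp add: monom_0 poly_act_pCons)

lemma poly_act_linear_factor:
  assumes a: "a \<in> V" and b: "b \<in> V"
  shows "poly_act a ([:- w, 1:] * q) b = poly_act a q (a \<odot> b - scale w b)"
proof -
  have c: "poly_act a q (a \<odot> b - scale w b) = a \<odot> poly_act a q b - scale w (poly_act a q b)" for q
    by (induction q)
      (use a b in \<open>auto simp: poly_act_pCons poly_act_closed closed mul_add_right mul_diff_right mul_scale_right
         scale_right_distrib scale_right_diff_distrib mult.commute\<close>)
  have "poly_act a ([:- w, 1:] * q) b = poly_act a (smult (- w) q + pCons 0 q) b"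
    by (simp add: mult_pCons_left)
  also have "\<dots> = a \<odot> poly_act a q b - scale w (poly_act a q b)"
    using a b by (simp add: poly_act_add poly_act_pCons poly_act_smult del: smult_minus_left)
  finally show ?thesis using c by simp
qed

lemma poly_act_eigenvector_sum:
  assumes a: "a \<in> V" "star a = a"
  shows "b \<in> V \<Longrightarrow> p \<noteq> 0 \<Longrightarrow> poly_act a p b = 0 \<Longrightarrow> eigenvector_sum a b"
proof (induction "degree p" arbitrary: p b)
  case 0
  then obtain c where c: "p = [:c:]" "c \<noteq> 0" by (metis degree_0_id pCons_0_0 of_nat_0 degree_eq_zeroE)
  then have "b = 0" using 0 a by (simp add: poly_act_pCons)
  then show ?case unfolding eigenvector_sum_def by (intro exI[of _ "{}"]) auto
next
  case (Suc n)
  have "\<not> constant (poly p)" using Suc.hyps(2) by (simp add: constant_degree)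
  then obtain w where "poly p w = 0" using fundamental_theorem_of_algebra by blast
  then obtain q where q: "p = [:- w, 1:] * q" by (auto simp: poly_eq_0_iff_dvd dvd_def)
  then have "q \<noteq> 0" using Suc.prems by auto
  moreover have "degree q = n" using Suc.hyps(2) \<open>q \<noteq> 0\<close> unfolding q by (subst (asm) degree_mult_eq) auto
  ultimately have "eigenvector_sum a (a \<odot> b - scale w b)"
    using Suc.hyps(1)[of q "a \<odot> b - scale w b"] Suc.prems a poly_act_linear_factor[of a b w q]
    by (simp add: q closed)
  then show ?case by (rule eigenvector_sum_step[OF a Suc.prems(1)])
qed

lemma annihilating_poly:
  assumes a: "a \<in> V" and b: "b \<in> V"
  shows "\<exists>p. p \<noteq> 0 \<and> poly_act a p b = 0"
proof -
  obtain B where B: "finite B" "span B = V" using fin by blast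
  let ?f = "\<lambda>i. ((\<odot>) a ^^ i) b"
  have fV: "?f i \<in> V" for i by (induction i) (auto simp: closed a b)
  let ?n = "card B"
  show ?thesis
  proof (cases "inj_on ?f {..?n}")
    case False
    then obtain i' j' where "i' \<noteq> j'" "?f i' = ?f j'" unfolding inj_on_def by blast
    then obtain i j where ij: "i < j" "?f i = ?f j"
      by (cases "i' < j'") (metis, metis linorder_neqE_nat)
    have "coeff (monom 1 i - monom (1::complex) j) i = 1" using ij by simp
    then have "monom 1 i - monom (1::complex) j \<noteq> 0" by (metis coeff_0 zero_neq_one)
    moreover have "poly_act a (monom 1 i - monom 1 j) b = 0"
      using poly_act_add[OF a b, of "monom 1 i" "smult (-1) (monom 1 j)"] poly_act_smult[OF a b, of "-1" "monom 1 j"] ij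
      by (simp add: poly_act_monom a b)
    ultimately show ?thesis by blast
  next
    case True
    have "\<not> independent (?f ` {..?n})"
      using independent_span_bound[OF B(1), of "?f ` {..?n}"] fV B(2) True
      by (auto simp: card_image)
    then obtain u v where u: "(\<Sum>v\<in>?f ` {..?n}. scale (u v) v) = 0" "v \<in> ?f ` {..?n}" "u v \<noteq> 0"
      using dependent_finite[of "?f ` {..?n}"] by auto
    then obtain k where k: "k \<le> ?n" "u (?f k) \<noteq> 0" by auto
    let ?p = "\<Sum>i\<le>?n. monom (u (?f i)) i"
    have "coeff ?p k = u (?f k)" using k by (simp add: coeff_sum)
    then have "?p \<noteq> 0" using k by (metis coeff_0)
    moreover have "poly_act a ?p b = 0"
      using u(1) by (simp add: poly_act_sum poly_act_monom a b sum.reindex[OF True])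
    ultimately show ?thesis by blast
  qed
qed

text \<open>
  The counterpart of \<open>spectral_decomp\<close> in a tracial star algebra.
\<close>

definition spectral :: "'a \<Rightarrow> real set \<Rightarrow> (real \<Rightarrow> 'a) \<Rightarrow> bool" where
  "spectral a \<Lambda> P \<longleftrightarrow>
     finite \<Lambda> \<and>
     (\<forall>t \<in> \<Lambda>. P t \<in> V \<and> P t \<noteq> 0 \<and> star (P t) = P t \<and> P t \<odot> P t = P t) \<and>
     (\<forall>s \<in> \<Lambda>. \<forall>t \<in> \<Lambda>. s \<noteq> t \<longrightarrow> P s \<odot> P t = 0) \<and>
     (\<Sum>t \<in> \<Lambda>. P t) = one \<and>
     a = (\<Sum>t \<in> \<Lambda>. scale (of_real t) (P t))"

text \<open>
  If $1 = \sum_t P_t$ with $a P_t = t P_t$, then $P_s^* P_t = 0$ for $s \ne t$ because \<open>a\<close> is self-adjoint.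
  Multiplying $1$ by $P_t^*$ gives $P_t^* = P_t^* P_t$, so each $P_t$ is a self-adjoint idempotent.
\<close>

theorem spectral_exists:
  assumes a: "a \<in> V" "star a = a"
  obtains \<Lambda> P where "spectral a \<Lambda> P"
proof -
  obtain p where "p \<noteq> 0" "poly_act a p one = 0" using annihilating_poly[OF a(1) one_closed] by blast
  then have "eigenvector_sum a one" using poly_act_eigenvector_sum[OF a one_closed] by blast
  then obtain \<Lambda>' P where L': "finite \<Lambda>'" and P': "\<And>t. t \<in> \<Lambda>' \<Longrightarrow> P t \<in> V"
      "\<And>t. t \<in> \<Lambda>' \<Longrightarrow> a \<odot> P t = scale (complex_of_real t) (P t)" and one': "one = sum P \<Lambda>'"
    unfolding eigenvector_sum_def by blast
  define \<Lambda> where "\<Lambda> = {t \<in> \<Lambda>'. P t \<noteq> 0}"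
  have one: "one = sum P \<Lambda>" unfolding one' \<Lambda>_def using L' by (intro sum.mono_neutral_right) auto
  have L: "finite \<Lambda>" using L' by (simp add: \<Lambda>_def)
  have P: "P t \<in> V" "a \<odot> P t = scale (complex_of_real t) (P t)" if "t \<in> \<Lambda>" for t
    using that P' by (auto simp: \<Lambda>_def)
  have orth: "star (P s) \<odot> P t = 0" if st: "s \<in> \<Lambda>" "t \<in> \<Lambda>" "s \<noteq> t" for s t
  proof -
    have "scale (complex_of_real t) (star (P s) \<odot> P t) = star (P s) \<odot> (a \<odot> P t)"
      using st P by (simp add: mul_scale_right closed)
    also have "\<dots> = (star (P s) \<odot> star a) \<odot> P t"
      unfolding a(2) by (rule mul_assoc[symmetric]) (use st P a in \<open>auto intro: closed\<close>)
    also have "\<dots> = star (a \<odot> P s) \<odot> P t"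
      by (subst star_mul) (use st P a in auto)
    also have "\<dots> = scale (complex_of_real s) (star (P s) \<odot> P t)"
      using st P by (simp add: star_scale mul_scale_left closed)
    finally have "scale (complex_of_real t - complex_of_real s) (star (P s) \<odot> P t) = 0"
      by (simp add: scale_left_diff_distrib)
    then show ?thesis using st by simp
  qed
  have sq: "star (P t) = star (P t) \<odot> P t" if t: "t \<in> \<Lambda>" for t
  proof -
    have "star (P t) = star (P t) \<odot> sum P \<Lambda>" using t P one by (metis one_right star_closed)
    also have "\<dots> = (\<Sum>s\<in>\<Lambda>. star (P t) \<odot> P s)" using t P by (simp add: mul_sum_right closed)
    also have "\<dots> = star (P t) \<odot> P t + (\<Sum>s\<in>\<Lambda> - {t}. star (P t) \<odot> P s)" using t L by (simp add: sum.remove)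
    also have "(\<Sum>s\<in>\<Lambda> - {t}. star (P t) \<odot> P s) = 0" using orth t by (intro sum.neutral) auto
    finally show ?thesis by simp
  qed
  have sa: "star (P t) = P t" if t: "t \<in> \<Lambda>" for t
  proof -
    have "star (star (P t) \<odot> P t) = star (P t) \<odot> star (star (P t))"
      by (rule star_mul) (use P[OF t] in \<open>auto intro: closed\<close>)
    then have "star (star (P t)) = star (P t)"
      unfolding sq[OF t, symmetric] using sq[OF t] P[OF t] by (simp add: star_star)
    then show ?thesis using P[OF t] by (simp add: star_star)
  qed
  have "a = a \<odot> sum P \<Lambda>" using a one by (metis one_right)
  also have "\<dots> = (\<Sum>t\<in>\<Lambda>. scale (of_real t) (P t))" using P a by (simp add: mul_sum_right)
  finally have a_sum: "a = (\<Sum>t\<in>\<Lambda>. scale (of_real t) (P t))" .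
  have "P t \<odot> P t = P t" if "t \<in> \<Lambda>" for t using sq[OF that] sa[OF that] by simp
  moreover have "P s \<odot> P t = 0" if "s \<in> \<Lambda>" "t \<in> \<Lambda>" "s \<noteq> t" for s t
    using orth[OF that] sa[OF that(1)] by simp
  moreover have "P t \<noteq> 0" if "t \<in> \<Lambda>" for t using that by (simp add: \<Lambda>_def)
  ultimately have "spectral a \<Lambda> P"
    unfolding spectral_def using L P(1) one[symmetric] sa a_sum by blast
  then show thesis by (rule that)
qed

lemma spectral_mul:
  assumes "spectral a \<Lambda> P" "s \<in> \<Lambda>"
  shows "P s \<odot> a = scale (of_real s) (P s)" "a \<odot> P s = scale (of_real s) (P s)"
proof -
  have L: "finite \<Lambda>" and P: "\<And>t. t \<in> \<Lambda> \<Longrightarrow> P t \<in> V" "\<And>t. t \<in> \<Lambda> \<Longrightarrow> P t \<odot> P t = P t"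
    and o: "\<And>s t. s \<in> \<Lambda> \<Longrightarrow> t \<in> \<Lambda> \<Longrightarrow> s \<noteq> t \<Longrightarrow> P s \<odot> P t = 0"
    and a: "a = (\<Sum>t\<in>\<Lambda>. scale (of_real t) (P t))" using assms unfolding spectral_def by blast+
  have "P s \<odot> a = (\<Sum>t\<in>\<Lambda>. if t = s then scale (of_real s) (P s) else 0)"
    unfolding a using assms(2) P o
    by (subst mul_sum_right) (auto simp: closed mul_scale_right intro!: sum.cong)
  then show "P s \<odot> a = scale (of_real s) (P s)" using L assms by simp
  have "a \<odot> P s = (\<Sum>t\<in>\<Lambda>. if t = s then scale (of_real s) (P s) else 0)"
    unfolding a using assms(2) P o
    by (subst mul_sum_left) (auto simp: closed mul_scale_left intro!: sum.cong)
  then show "a \<odot> P s = scale (of_real s) (P s)" using L assms by simp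
qed

text \<open>
  This makes \<open>fcalc\<close> well defined.  If $P_s$ and $Q_t$ come from two decompositions of \<open>a\<close>, then
  $s P_s Q_t = P_s a Q_t = t P_s Q_t$, hence $P_s Q_t = 0$ unless $s = t$.
\<close>

lemma spectral_unique:
  assumes S: "spectral a \<Lambda> P" and T: "spectral a M Q"
  shows "(\<Sum>t\<in>\<Lambda>. scale (of_real (f t)) (P t)) = (\<Sum>t\<in>M. scale (of_real (f t)) (Q t))"
proof -
  have L: "finite \<Lambda>" "finite M" and P: "\<And>t. t \<in> \<Lambda> \<Longrightarrow> P t \<in> V" and Q: "\<And>t. t \<in> M \<Longrightarrow> Q t \<in> V"
    and one: "sum P \<Lambda> = one" "sum Q M = one"
    and aV: "a = (\<Sum>t\<in>\<Lambda>. scale (of_real t) (P t))"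
    using S T unfolding spectral_def by blast+
  have aV: "a \<in> V" unfolding aV using P by (simp add: sum_closed closed)
  have 0: "scale (of_real (f s)) (P s \<odot> Q t) = scale (of_real (f t)) (P s \<odot> Q t)" if "s \<in> \<Lambda>" "t \<in> M" for s t
  proof (cases "s = t")
    case False
    have "scale (of_real s) (P s \<odot> Q t) = (P s \<odot> a) \<odot> Q t"
      using that P Q by (simp add: spectral_mul(1)[OF S] mul_scale_left)
    also have "\<dots> = P s \<odot> (a \<odot> Q t)" using that P Q aV by (simp add: mul_assoc)
    also have "\<dots> = scale (of_real t) (P s \<odot> Q t)"
      using that P Q by (simp add: spectral_mul(2)[OF T] mul_scale_right)
    finally have "scale (of_real s - of_real t) (P s \<odot> Q t) = 0" by (simp add: scale_left_diff_distrib)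
    then show ?thesis using False by simp
  qed simp
  have "(\<Sum>s\<in>\<Lambda>. scale (of_real (f s)) (P s)) = (\<Sum>s\<in>\<Lambda>. scale (of_real (f s)) (P s \<odot> sum Q M))"
    using P by (simp add: one one_right)
  also have "\<dots> = (\<Sum>s\<in>\<Lambda>. \<Sum>t\<in>M. scale (of_real (f t)) (P s \<odot> Q t))"
  proof (rule sum.cong[OF refl])
    fix s assume s: "s \<in> \<Lambda>"
    have "scale (of_real (f s)) (P s \<odot> sum Q M) = (\<Sum>t\<in>M. scale (of_real (f s)) (P s \<odot> Q t))"
      using s P Q by (simp add: mul_sum_right scale_sum_right)
    also have "\<dots> = (\<Sum>t\<in>M. scale (of_real (f t)) (P s \<odot> Q t))"
      by (rule sum.cong[OF refl]) (rule 0[OF s])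
    finally show "scale (of_real (f s)) (P s \<odot> sum Q M) = (\<Sum>t\<in>M. scale (of_real (f t)) (P s \<odot> Q t))" .
  qed
  also have "\<dots> = (\<Sum>t\<in>M. scale (of_real (f t)) (sum P \<Lambda> \<odot> Q t))"
    using P Q by (subst sum.swap) (simp add: mul_sum_left scale_sum_right)
  also have "\<dots> = (\<Sum>t\<in>M. scale (of_real (f t)) (Q t))" using Q by (simp add: one one_left)
  finally show ?thesis .
qed

lemma tr_projection:
  assumes "p \<in> V" "p \<noteq> 0" "star p = p" "p \<odot> p = p"
  shows "tr p = of_real (Re (tr p))" "0 < Re (tr p)"
  using tr_pos[OF assms(1,2)] assms(3,4) by (auto simp: of_real_Re)

lemma spectral_nonneg:
  assumes x: "x \<in> V" and S: "spectral (star x \<odot> x) \<Lambda> P" and t: "t \<in> \<Lambda>"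
  shows "0 \<le> t"
proof -
  have P: "P t \<in> V" "P t \<noteq> 0" "star (P t) = P t" "P t \<odot> P t = P t" using S t unfolding spectral_def by blast+
  have "star (x \<odot> P t) \<odot> (x \<odot> P t) = P t \<odot> ((star x \<odot> x) \<odot> P t)"
    using P x by (simp add: star_mul mul_assoc closed)
  also have "\<dots> = scale (of_real t) (P t)"
    using P by (simp add: spectral_mul(2)[OF S t] mul_scale_right)
  finally have "0 \<le> Re (of_real t * tr (P t))"
    using tr_nonneg[of "x \<odot> P t"] x P by (simp add: closed tr_scale)
  then show ?thesis using tr_projection[OF P] by (simp add: zero_le_mult_iff)
qed

lemma spectral_mul_sums:
  assumes S: "spectral a \<Lambda> P"
  shows "(\<Sum>t\<in>\<Lambda>. scale (f t) (P t)) \<odot> (\<Sum>t\<in>\<Lambda>. scale (g t) (P t)) = (\<Sum>t\<in>\<Lambda>. scale (f t * g t) (P t))"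
proof -
  have L: "finite \<Lambda>" and P: "\<And>t. t \<in> \<Lambda> \<Longrightarrow> P t \<in> V" "\<And>t. t \<in> \<Lambda> \<Longrightarrow> P t \<odot> P t = P t"
    and o: "\<And>s t. s \<in> \<Lambda> \<Longrightarrow> t \<in> \<Lambda> \<Longrightarrow> s \<noteq> t \<Longrightarrow> P s \<odot> P t = 0"
    using S unfolding spectral_def by blast+
  have "scale (f s) (P s) \<odot> (\<Sum>t\<in>\<Lambda>. scale (g t) (P t)) = scale (f s * g s) (P s)" if s: "s \<in> \<Lambda>" for s
  proof -
    have "scale (f s) (P s) \<odot> (\<Sum>t\<in>\<Lambda>. scale (g t) (P t)) =
        (\<Sum>t\<in>\<Lambda>. if t = s then scale (f s * g s) (P s) else 0)"
      using s P o by (subst mul_sum_right)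
        (auto simp: closed mul_scale_left mul_scale_right mult.commute intro!: sum.cong)
    then show ?thesis using s L by simp
  qed
  then show ?thesis using P by (subst mul_sum_left) (auto simp: closed sum_closed)
qed

lemma spectral_star_sum:
  assumes S: "spectral a \<Lambda> P"
  shows "star (\<Sum>t\<in>\<Lambda>. scale (of_real (f t)) (P t)) = (\<Sum>t\<in>\<Lambda>. scale (of_real (f t)) (P t))"
  using S unfolding spectral_def by (subst star_sum) (auto simp: closed star_scale)

lemma spectral_image:
  assumes S: "spectral a \<Lambda> P" and g: "inj_on g \<Lambda>"
  shows "spectral (\<Sum>t\<in>\<Lambda>. scale (of_real (g t)) (P t)) (g ` \<Lambda>) (P \<circ> inv_into \<Lambda> g)"
  using S g unfolding spectral_def by (auto simp: sum.reindex)

lemma tr_mul_sums: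
  assumes "\<And>j. j \<in> J \<Longrightarrow> g j \<in> V" "\<And>i. i \<in> I \<Longrightarrow> f i \<in> V"
  shows "tr ((\<Sum>j\<in>J. scale (d j) (g j)) \<odot> (\<Sum>i\<in>I. scale (c i) (f i))) = (\<Sum>j\<in>J. \<Sum>i\<in>I. d j * tr (g j \<odot> f i) * c i)"
proof -
  have "(\<Sum>j\<in>J. scale (d j) (g j)) \<odot> (\<Sum>i\<in>I. scale (c i) (f i)) =
      (\<Sum>j\<in>J. scale (d j) (g j) \<odot> (\<Sum>i\<in>I. scale (c i) (f i)))"
    using assms by (intro mul_sum_left) (auto simp: closed intro!: sum_closed)
  also have "\<dots> = (\<Sum>j\<in>J. \<Sum>i\<in>I. scale (d j) (g j) \<odot> scale (c i) (f i))"
    using assms by (intro sum.cong refl mul_sum_right) (auto simp: closed)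
  also have "tr \<dots> = (\<Sum>j\<in>J. \<Sum>i\<in>I. tr (scale (d j) (g j) \<odot> scale (c i) (f i)))"
    using assms by (subst tr_sum; (intro sum_closed)?) (auto simp: closed tr_sum intro!: sum.cong)
  also have "\<dots> = (\<Sum>j\<in>J. \<Sum>i\<in>I. d j * tr (g j \<odot> f i) * c i)"
    using assms by (intro sum.cong refl) (simp add: closed mul_scale_left mul_scale_right tr_scale)
  finally show ?thesis .
qed

lemma tr_orthogonal:
  assumes "finite I" and f: "\<And>i. i \<in> I \<Longrightarrow> f i \<in> V"
    and o: "\<And>i j. i \<in> I \<Longrightarrow> j \<in> I \<Longrightarrow> star (f i) \<odot> f j = (if i = j then P j else 0)"
    and P: "\<And>i. i \<in> I \<Longrightarrow> tr (P i) = of_real (a i)"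
  shows "tr (star (\<Sum>i\<in>I. scale (c i) (f i)) \<odot> (\<Sum>i\<in>I. scale (c i) (f i))) = of_real (\<Sum>i\<in>I. a i * (norm (c i))\<^sup>2)"
proof -
  have "star (\<Sum>i\<in>I. scale (c i) (f i)) = (\<Sum>i\<in>I. scale (cnj (c i)) (star (f i)))"
    using f by (subst star_sum) (auto simp: closed star_scale)
  then have "tr (star (\<Sum>i\<in>I. scale (c i) (f i)) \<odot> (\<Sum>i\<in>I. scale (c i) (f i))) =
      (\<Sum>i\<in>I. \<Sum>j\<in>I. cnj (c i) * tr (star (f i) \<odot> f j) * c j)"
    using f by (simp add: tr_mul_sums closed)
  also have "\<dots> = (\<Sum>i\<in>I. \<Sum>j\<in>I. if j = i then of_real (a i * (norm (c i))\<^sup>2) else 0)"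
    by (intro sum.cong refl) (auto simp: o P complex_norm_square simp del: of_real_power)
  also have "\<dots> = of_real (\<Sum>i\<in>I. a i * (norm (c i))\<^sup>2)" using assms(1) by simp
  finally show ?thesis .
qed

text \<open>
  The polar decomposition of \<open>x\<close>, cut along the spectral projections of $x^* x$: the elements $u_t = t^{-1/2} x P_t$
  are partial isometries with initial projections $P_t$, and they are mutually orthogonal because
  $(x P_s)^* (x P_t) = t P_s P_t$.
\<close>

lemma polar:
  assumes x: "x \<in> V" and S: "spectral (star x \<odot> x) \<Lambda> P"
  defines "u \<equiv> \<lambda>t. scale (of_real (1 / sqrt t)) (x \<odot> P t)" and "I \<equiv> {t \<in> \<Lambda>. 0 < t}"
  shows "t \<in> I \<Longrightarrow> u t \<in> V"
    and "t \<in> I \<Longrightarrow> u t \<odot> P t = u t"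
    and "s \<in> I \<Longrightarrow> t \<in> I \<Longrightarrow> star (u s) \<odot> u t = (if s = t then P t else 0)"
    and "x = (\<Sum>t\<in>I. scale (of_real (sqrt t)) (u t))"
    and "s \<in> I \<Longrightarrow> star (u s) \<odot> x = scale (of_real (sqrt s)) (P s)"
proof -
  have L: "finite \<Lambda>" and P: "\<And>t. t \<in> \<Lambda> \<Longrightarrow> P t \<in> V" "\<And>t. t \<in> \<Lambda> \<Longrightarrow> P t \<odot> P t = P t" "\<And>t. t \<in> \<Lambda> \<Longrightarrow> star (P t) = P t"
    and o: "\<And>s t. s \<in> \<Lambda> \<Longrightarrow> t \<in> \<Lambda> \<Longrightarrow> s \<noteq> t \<Longrightarrow> P s \<odot> P t = 0" and one: "sum P \<Lambda> = one"
    using S unfolding spectral_def by blast+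
  show uV: "u t \<in> V" if "t \<in> I" for t using that P x by (simp add: u_def I_def closed)
  show "u t \<odot> P t = u t" if "t \<in> I" for t
    using that P x by (simp add: u_def I_def closed mul_scale_left mul_assoc)
  have xx: "star (x \<odot> P s) \<odot> (x \<odot> P t) = scale (of_real t) (P s \<odot> P t)" if "s \<in> \<Lambda>" "t \<in> \<Lambda>" for s t
  proof -
    have "star (x \<odot> P s) \<odot> (x \<odot> P t) = P s \<odot> ((star x \<odot> x) \<odot> P t)"
      using that P x by (simp add: star_mul mul_assoc closed)
    also have "\<dots> = scale (of_real t) (P s \<odot> P t)"
      using that P by (simp add: spectral_mul(2)[OF S] mul_scale_right)
    finally show ?thesis .
  qed
  show uu: "star (u s) \<odot> u t = (if s = t then P t else 0)" if "s \<in> I" "t \<in> I" for s t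
  proof -
    have st: "s \<in> \<Lambda>" "t \<in> \<Lambda>" "0 < s" "0 < t" using that by (auto simp: I_def)
    have "star (u s) \<odot> u t = scale (of_real (1 / sqrt s) * of_real (1 / sqrt t)) (star (x \<odot> P s) \<odot> (x \<odot> P t))"
      using st P x by (simp add: u_def star_scale closed mul_scale_left mul_scale_right mult.commute)
    also have "\<dots> = scale (of_real (1 / sqrt s * (1 / sqrt t) * t)) (P s \<odot> P t)"
      using st by (simp add: xx)
    also have "\<dots> = (if s = t then P t else 0)"
    proof (cases "s = t")
      case True
      have "1 / sqrt t * (1 / sqrt t) * t = 1" using st by simp
      then show ?thesis using True st P by (simp only: of_real_1 scale_one if_True simp_thms)
    qed (use st o in auto)
    finally show ?thesis .
  qed
  have "x = x \<odot> sum P \<Lambda>" using x by (simp add: one one_right)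
  also have "\<dots> = (\<Sum>t\<in>\<Lambda>. x \<odot> P t)" using x P by (simp add: mul_sum_right)
  also have "\<dots> = (\<Sum>t\<in>I. x \<odot> P t)"
  proof (rule sum.mono_neutral_right)
    show "\<forall>t\<in>\<Lambda> - I. x \<odot> P t = 0"
    proof
      fix t assume t: "t \<in> \<Lambda> - I"
      then have "t = 0" using spectral_nonneg[OF x S, of t] by (auto simp: I_def)
      then have "star (x \<odot> P t) \<odot> (x \<odot> P t) = 0" using xx[of t t] t by simp
      then show "x \<odot> P t = 0" using star_mul_eq_0 x P t by (simp add: closed)
    qed
  qed (use L in \<open>auto simp: I_def\<close>)
  also have "\<dots> = (\<Sum>t\<in>I. scale (of_real (sqrt t)) (u t))"
    by (rule sum.cong) (auto simp: u_def I_def simp flip: of_real_mult)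
  finally show x_sum: "x = (\<Sum>t\<in>I. scale (of_real (sqrt t)) (u t))" .
  show "star (u s) \<odot> x = scale (of_real (sqrt s)) (P s)" if s: "s \<in> I" for s
  proof -
    have "star (u s) \<odot> x = (\<Sum>t\<in>I. scale (of_real (sqrt t)) (star (u s) \<odot> u t))"
      using uV s by (subst x_sum, subst mul_sum_right) (auto simp: closed mul_scale_right)
    also have "\<dots> = (\<Sum>t\<in>I. if t = s then scale (of_real (sqrt s)) (P s) else 0)"
      by (rule sum.cong[OF refl]) (use uu s in auto)
    finally show ?thesis using s L by (simp add: I_def)
  qed
qed

end

section \<open>Deciding planarity, gluing and isotopy\<close>

text \<open>
  The equivalence relations \<open>eqcl\<close> in the definitions of planar tangles and of gluing are generated by finite
  sets of pairs.  Their classes are computed by starting from singletons and merging the two classes of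
  each pair in turn.
\<close>

definition join :: "'b \<times> 'b \<Rightarrow> 'b list list \<Rightarrow> 'b list list" where
  "join r cs = (let (a, b) = r; m = filter (\<lambda>c. a \<in> set c \<or> b \<in> set c) cs in
     concat m # filter (\<lambda>c. \<not> (a \<in> set c \<or> b \<in> set c)) cs)"

definition comps :: "'b list \<Rightarrow> ('b \<times> 'b) list \<Rightarrow> 'b list list" where
  "comps D rs = fold join rs (map (\<lambda>x. [x]) D)"

lemma eqcl_refl: "(x, x) \<in> eqcl r"
  by (simp add: eqcl_def)

lemma eqcl_sym: "(x, y) \<in> eqcl r \<Longrightarrow> (y, x) \<in> eqcl r"
  unfolding eqcl_def by (metis (no_types, lifting) converse_Un converse_converse rtrancl_converseD converseI sup_commute)

lemma eqcl_trans: "(x, y) \<in> eqcl r \<Longrightarrow> (y, z) \<in> eqcl r \<Longrightarrow> (x, z) \<in> eqcl r"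
  unfolding eqcl_def by (rule rtrancl_trans)

lemma eqcl_base: "(x, y) \<in> r \<Longrightarrow> (x, y) \<in> eqcl r"
  unfolding eqcl_def by blast

lemma join_inv:
  assumes "distinct (concat cs)" "a \<in> set (concat cs)" "b \<in> set (concat cs)" "[] \<notin> set cs"
    and "\<forall>c \<in> set cs. \<forall>x \<in> set c. \<forall>y \<in> set c. (x, y) \<in> eqcl r" "(a, b) \<in> r"
  shows "mset (concat (join (a, b) cs)) = mset (concat cs)"
    and "[] \<notin> set (join (a, b) cs)"
    and "\<forall>c \<in> set (join (a, b) cs). \<forall>x \<in> set c. \<forall>y \<in> set c. (x, y) \<in> eqcl r"
    and "\<exists>c \<in> set (join (a, b) cs). a \<in> set c \<and> b \<in> set c"
    and "c \<in> set cs \<Longrightarrow> \<exists>c' \<in> set (join (a, b) cs). set c \<subseteq> set c'"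
proof -
  let ?P = "\<lambda>c. a \<in> set c \<or> b \<in> set c"
  have "mset (concat (filter ?P xs)) + mset (concat (filter (\<lambda>c. \<not> ?P c) xs)) = mset (concat xs)" for xs
    by (induction xs) (auto simp: ac_simps)
  then show "mset (concat (join (a, b) cs)) = mset (concat cs)"
    by (simp add: join_def)
  show "[] \<notin> set (join (a, b) cs)"
    using assms(2,4) by (auto simp: join_def)
  have ab: "(a, b) \<in> eqcl r" using assms(6) by (rule eqcl_base)
  have "(x, a) \<in> eqcl r" if "c \<in> set cs" "?P c" "x \<in> set c" for c x
    using that assms(5) ab by (metis eqcl_sym eqcl_trans)
  then have "(x, y) \<in> eqcl r" if "c \<in> set cs" "?P c" "x \<in> set c" "c' \<in> set cs" "?P c'" "y \<in> set c'" for c x c' y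
    using that by (metis eqcl_sym eqcl_trans)
  then show "\<forall>c \<in> set (join (a, b) cs). \<forall>x \<in> set c. \<forall>y \<in> set c. (x, y) \<in> eqcl r"
    using assms(5) unfolding join_def Let_def by auto
  show "\<exists>c \<in> set (join (a, b) cs). a \<in> set c \<and> b \<in> set c"
    using assms(2,3) unfolding join_def Let_def by auto
  show "\<exists>c' \<in> set (join (a, b) cs). set c \<subseteq> set c'" if "c \<in> set cs"
    using that unfolding join_def Let_def by (cases "?P c") auto
qed

lemma comps_inv:
  assumes "distinct D" "set rs \<subseteq> set D \<times> set D"
  shows "mset (concat (comps D rs)) = mset D \<and> [] \<notin> set (comps D rs) \<and>
    (\<forall>c \<in> set (comps D rs). \<forall>x \<in> set c. \<forall>y \<in> set c. (x, y) \<in> eqcl (set rs)) \<and>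
    (\<forall>(a, b) \<in> set rs. \<exists>c \<in> set (comps D rs). a \<in> set c \<and> b \<in> set c)"
  using assms(2)
proof (induction rs rule: rev_induct)
  case Nil
  have "concat (map (\<lambda>x. [x]) D) = D" by (induction D) auto
  then show ?case by (auto simp: comps_def eqcl_refl)
next
  case (snoc r rs)
  obtain a b where r: "r = (a, b)" by force
  let ?cs = "comps D rs" and ?R = "set (rs @ [r])"
  have IH: "mset (concat ?cs) = mset D" "[] \<notin> set ?cs"
    "\<forall>c \<in> set ?cs. \<forall>x \<in> set c. \<forall>y \<in> set c. (x, y) \<in> eqcl (set rs)"
    "\<forall>(a, b) \<in> set rs. \<exists>c \<in> set ?cs. a \<in> set c \<and> b \<in> set c"
    using snoc by auto
  have mono: "eqcl (set rs) \<subseteq> eqcl ?R"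
    unfolding eqcl_def by (rule rtrancl_mono) auto
  have D: "distinct (concat ?cs)" "set (concat ?cs) = set D"
    using IH(1) assms(1) by (metis mset_eq_imp_distinct_iff, metis mset_eq_setD)
  have step: "comps D (rs @ [r]) = join (a, b) ?cs"
    by (simp add: comps_def r)
  have 5: "\<forall>c \<in> set ?cs. \<forall>x \<in> set c. \<forall>y \<in> set c. (x, y) \<in> eqcl ?R" using IH(3) mono by blast
  have ab: "a \<in> set (concat ?cs)" "b \<in> set (concat ?cs)" "(a, b) \<in> ?R"
    using snoc.prems D(2) by (auto simp: r)
  note J = join_inv[OF D(1) ab(1,2) IH(2) 5 ab(3)]
  have "\<exists>c \<in> set (join (a, b) ?cs). x \<in> set c \<and> y \<in> set c" if xy: "(x, y) \<in> ?R" for x y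
  proof (cases "(x, y) \<in> set rs")
    case True
    then obtain c where c: "c \<in> set ?cs" "x \<in> set c" "y \<in> set c" using IH(4) by blast
    then show ?thesis using J(5)[OF c(1)] by blast
  next
    case False
    then show ?thesis using xy J(4) by (auto simp: r)
  qed
  then show ?case
    unfolding step using J(1-3) IH(1) by auto
qed

text \<open>
  The lists computed by \<open>comps\<close> are the equivalence classes, each represented once.
\<close>

lemma comps:
  assumes "distinct D" "set rs \<subseteq> set D \<times> set D"
  defines "cs \<equiv> comps D rs"
  shows "set (concat cs) = set D" "[] \<notin> set cs" "distinct (concat cs)"
    and comps_class: "c \<in> set cs \<Longrightarrow> x \<in> set c \<Longrightarrow> eqcl (set rs) `` {x} = set c"
    and comps_quotient: "set D // eqcl (set rs) = set ` set cs"
    and comps_inj: "inj_on set (set cs)" "distinct cs"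
proof -
  note I = comps_inv[OF assms(1,2), folded cs_def]
  show s: "set (concat cs) = set D" and n: "[] \<notin> set cs" and d: "distinct (concat cs)"
    using I assms(1) by (metis mset_eq_setD, simp, metis mset_eq_imp_distinct_iff)
  have dis: "c = c'" if "c \<in> set cs" "c' \<in> set cs" "x \<in> set c" "x \<in> set c'" for c c' x
    using d that unfolding distinct_concat_iff by blast
  show cl: "eqcl (set rs) `` {x} = set c" if c: "c \<in> set cs" "x \<in> set c" for c x
  proof
    show "set c \<subseteq> eqcl (set rs) `` {x}" using I c by blast
    have "y \<in> set c" if "(x, y) \<in> eqcl (set rs)" for y
      using that unfolding eqcl_def
    proof (induction rule: rtrancl_induct)
      case base then show ?case using c by simp
    next
      case (step y z)
      then have "\<exists>c' \<in> set cs. y \<in> set c' \<and> z \<in> set c'" using I by blast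
      then show ?case using dis step.IH c by blast
    qed
    then show "eqcl (set rs) `` {x} \<subseteq> set c" by blast
  qed
  show "set D // eqcl (set rs) = set ` set cs"
  proof (intro equalityI subsetI)
    fix k assume "k \<in> set D // eqcl (set rs)"
    then obtain x where "x \<in> set D" "k = eqcl (set rs) `` {x}" by (auto elim: quotientE)
    then show "k \<in> set ` set cs" using cl s by force
  next
    fix k assume "k \<in> set ` set cs"
    then obtain c where c: "c \<in> set cs" "k = set c" by auto
    with n obtain x where "x \<in> set c" by (metis list.set_intros(1) neq_Nil_conv)
    then show "k \<in> set D // eqcl (set rs)"
      using cl c s by (metis (no_types, lifting) UN_I quotientI set_concat)
  qed
  show "inj_on set (set cs)"
  proof (rule inj_onI)
    fix c c' assume cc: "c \<in> set cs" "c' \<in> set cs" "set c = set c'"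
    with n obtain x where "x \<in> set c" by (metis list.set_intros(1) neq_Nil_conv)
    with cc dis show "c = c'" by blast
  qed
  show "distinct cs" using d n by (simp add: distinct_concat_iff filter_id_conv removeAll_id)
qed

definition pts :: "tangle \<Rightarrow> (nat \<times> nat) list" where
  "pts T = concat (map (\<lambda>i. map (Pair i) [0..<npts T i]) [0..<length (discs T)])"

definition ivs :: "tangle \<Rightarrow> (nat \<times> nat) list" where
  "ivs T = concat (map (\<lambda>i. map (Pair i) [0..<max 1 (npts T i)]) [0..<length (discs T)])"

definition regs :: "tangle \<Rightarrow> nat list" where
  "regs T = remdups (map (reg T) (ivs T))"

lemma distinct_pair_list: "distinct (concat (map (\<lambda>i. map (Pair i) (f i)) [0..<n]))"
  if "\<And>i. distinct (f i)" for f :: "nat \<Rightarrow> 'b list"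
  using that by (induction n) (auto simp: distinct_map inj_on_def)

lemma set_pts [simp]: "set (pts T) = points T" and distinct_pts: "distinct (pts T)"
  and set_ivs [simp]: "set (ivs T) = intervals T" and distinct_ivs: "distinct (ivs T)"
  by (auto simp: pts_def points_def ivs_def intervals_def distinct_pair_list)

lemma set_regs: "loops T = {#} \<Longrightarrow> set (regs T) = regions T"
  by (auto simp: regs_def regions_def)

text \<open>
  An executable sufficient condition for planarity of a tangle without loops.  The region colouring, which
  has to be found in general, is forced on a region by any interval that touches it, so that consistency
  of the intervals is enough.
\<close>

definition planar_ok :: "tangle \<Rightarrow> bool" where
  "planar_ok T \<longleftrightarrow> discs T \<noteq> [] \<and> size (loops T) = 0 \<and>
     (\<forall>p \<in> set (pts T). partner T p \<in> set (pts T) \<and> partner T p \<noteq> p \<and> partner T (partner T p) = p \<and>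
        reg T (lft T p) = reg T (rgt T (partner T p))) \<and>
     (\<forall>a \<in> set (ivs T). \<forall>b \<in> set (ivs T). reg T a = reg T b \<longrightarrow> unshaded T a = unshaded T b) \<and>
     length (comps (regs T)
       (concat (map (\<lambda>a. map (\<lambda>b. (reg T a, reg T b)) (filter (\<lambda>b. fst a = fst b) (ivs T))) (ivs T)))) \<le> 1 \<and>
     length (discs T) + 2 * length (regs T) = 2 + (\<Sum>c\<leftarrow>discs T. fst c) +
       length (comps (ivs T) (map (\<lambda>p. (lft T p, rgt T (partner T p))) (pts T)))"

lemma lft_rgt_intervals: "p \<in> points T \<Longrightarrow> lft T p \<in> intervals T \<and> rgt T p \<in> intervals T"
  by (cases p) (auto simp: points_def intervals_def lft_def rgt_def less_max_iff_disj split: if_splits)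

lemma planar_okD:
  assumes "planar_ok T"
  shows "planar_tangle T"
proof -
  have l: "loops T = {#}" and ne: "discs T \<noteq> []" and
    p: "\<And>p. p \<in> points T \<Longrightarrow> partner T p \<in> points T \<and> partner T p \<noteq> p \<and> partner T (partner T p) = p \<and>
        reg T (lft T p) = reg T (rgt T (partner T p))" and
    sh: "\<And>a b. a \<in> intervals T \<Longrightarrow> b \<in> intervals T \<Longrightarrow> reg T a = reg T b \<Longrightarrow> unshaded T a = unshaded T b"
    using assms unfolding planar_ok_def set_pts set_ivs size_eq_0_iff_empty by blast+
  define rp where "rp = concat (map (\<lambda>a. map (\<lambda>b. (reg T a, reg T b)) (filter (\<lambda>b. fst a = fst b) (ivs T))) (ivs T))"
  define cp where "cp = map (\<lambda>p. (lft T p, rgt T (partner T p))) (pts T)"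
  have len: "length (comps (regs T) rp) \<le> 1"
    and eu: "length (discs T) + 2 * length (regs T) = 2 + (\<Sum>c\<leftarrow>discs T. fst c) + length (comps (ivs T) cp)"
    using assms unfolding planar_ok_def rp_def[symmetric] cp_def[symmetric] by blast+
  have srp: "set rp = {(reg T a, reg T b) | a b. a \<in> intervals T \<and> b \<in> intervals T \<and> fst a = fst b}"
    unfolding rp_def by (simp add: set_eq_iff image_iff del: split_paired_Ex) blast
  have scp: "set cp = {(lft T p, rgt T (partner T p)) | p. p \<in> points T}"
    unfolding cp_def by auto
  have D1: "distinct (regs T)" "set rp \<subseteq> set (regs T) \<times> set (regs T)"
    unfolding srp by (auto simp: regs_def)
  have D2: "distinct (ivs T)" "set cp \<subseteq> set (ivs T) \<times> set (ivs T)"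
  proof -
    have "lft T p \<in> intervals T \<and> rgt T (partner T p) \<in> intervals T" if "p \<in> points T" for p
      using that p lft_rgt_intervals by blast
    then show "set cp \<subseteq> set (ivs T) \<times> set (ivs T)" unfolding scp by auto
  qed (rule distinct_ivs)
  note C1 = comps[OF D1] and C2 = comps[OF D2]
  have "(u, v) \<in> eqcl (set rp)" if uv: "u \<in> regions T" "v \<in> regions T" for u v
  proof -
    have "u \<in> set (concat (comps (regs T) rp))" "v \<in> set (concat (comps (regs T) rp))"
      using uv unfolding C1(1) set_regs[OF l] .
    then obtain c c' where c: "c \<in> set (comps (regs T) rp)" "u \<in> set c" "c' \<in> set (comps (regs T) rp)" "v \<in> set c'"
      by auto
    then have "c = c'" using len by (cases "comps (regs T) rp") (auto simp: le_Suc_eq)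
    then show ?thesis using c C1(4) by blast
  qed
  moreover have "card (curves T) = length (comps (ivs T) cp)"
    unfolding curves_def scp[symmetric] set_ivs[symmetric] C2(5)
    using C2(6,7) by (simp add: card_image distinct_card)
  moreover have "card (regions T) = length (regs T)"
    using set_regs[OF l] D1(1) by (metis distinct_card)
  moreover have "\<exists>col. \<forall>a \<in> intervals T. col (reg T a) = unshaded T a"
    by (rule exI[of _ "\<lambda>r. \<exists>a \<in> intervals T. reg T a = r \<and> unshaded T a"]) (use sh in blast)
  ultimately show ?thesis
    unfolding planar_tangle_def using ne p eu l srp by auto
qed

definition is_kept :: "nat \<Rightarrow> nat \<times> nat + nat \<times> nat \<Rightarrow> bool" where
  "is_kept i a = (case a of Inl (d, j) \<Rightarrow> d \<noteq> i | Inr (d, j) \<Rightarrow> d \<noteq> 0)"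

definition strand_comps :: "tangle \<Rightarrow> nat \<Rightarrow> tangle \<Rightarrow> (nat \<times> nat + nat \<times> nat) list list" where
  "strand_comps T i S = comps (map Inl (pts T) @ map Inr (pts S))
     (map (\<lambda>p. (Inl p, Inl (partner T p))) (pts T) @ map (\<lambda>p. (Inr p, Inr (partner S p))) (pts S) @
      map (\<lambda>j. (Inl (i, j), Inr (0, j))) [0..<npts T i])"

definition region_comps :: "tangle \<Rightarrow> nat \<Rightarrow> tangle \<Rightarrow> (nat + nat) list list" where
  "region_comps T i S = comps (map Inl (regs T) @ map Inr (regs S))
     (map (\<lambda>j. (Inl (reg T (i, j)), Inr (reg S (0, j)))) [0..<max 1 (npts T i)])"

text \<open>
  An executable sufficient condition for \<open>glued\<close>.  The certificate consists of the map \<open>h\<close> on regions, given by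
  the lists \<open>hT\<close> and \<open>hS\<close> of its values on the region labels of the outer and of the inner tangle, and of the
  loops \<open>lU\<close> of the result, in the order in which the closed strands are found.
\<close>

definition glue_ok :: "tangle \<Rightarrow> nat \<Rightarrow> tangle \<Rightarrow> tangle \<Rightarrow> nat list \<Rightarrow> nat list \<Rightarrow> (nat \<times> nat) list \<Rightarrow> bool" where
  "glue_ok T i S U hT hS lU \<longleftrightarrow>
     1 \<le> i \<and> i < length (discs T) \<and> discs T ! i = discs S ! 0 \<and>
     discs U = take i (discs T) @ tl (discs S) @ drop (Suc i) (discs T) \<and>
     (\<forall>c \<in> set (strand_comps T i S). let k = filter (is_kept i) c in
        \<forall>a \<in> set k. \<forall>b \<in> set k. a \<noteq> b \<longrightarrow> partner U (emb i S a) = emb i S b) \<and>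
     (let h = case_sum ((!) hT) ((!) hS); rc = region_comps T i S in
        (\<forall>c \<in> set rc. \<forall>u \<in> set c. h u = h (hd c)) \<and> distinct (map (\<lambda>c. h (hd c)) rc)) \<and>
     (\<forall>a \<in> set (ivs T). fst a \<noteq> i \<longrightarrow> reg U (emb i S (Inl a)) = hT ! reg T a) \<and>
     (\<forall>a \<in> set (ivs S). fst a \<noteq> 0 \<longrightarrow> reg U (emb i S (Inr a)) = hS ! reg S a) \<and>
     list_all2 (\<lambda>c l. list_ex isl c \<and>
         (\<forall>a \<in> set c. case a of Inl p \<Rightarrow> map_prod ((!) hT) ((!) hT) (sides T p) = l | Inr _ \<Rightarrow> True))
       (filter (list_all (\<lambda>a. \<not> is_kept i a)) (strand_comps T i S)) lU"

lemma glue_okD: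
  assumes ok: "glue_ok T i S U hT hS lU" and pT: "planar_ok T" and pS: "planar_ok S"
    and lU: "loops U = mset lU"
  shows "glued T i S U"
proof -
  note T = planar_okD[OF pT] and S = planar_okD[OF pS]
  have l: "loops T = {#}" "loops S = {#}" using pT pS by (auto simp: planar_ok_def)
  have i: "1 \<le> i" "i < length (discs T)" "discs T ! i = discs S ! 0"
    and dU: "discs U = take i (discs T) @ tl (discs S) @ drop (Suc i) (discs T)"
    using ok by (auto simp: glue_ok_def)
  have S0: "0 < length (discs S)" using S by (auto simp: planar_tangle_def)
  have np: "npts T i = npts S 0" using i by (simp add: npts_def)
  let ?D = "map Inl (pts T) @ map Inr (pts S)"
  let ?R = "map (\<lambda>p. (Inl p, Inl (partner T p))) (pts T) @ map (\<lambda>p. (Inr p, Inr (partner S p))) (pts S) @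
      map (\<lambda>j. (Inl (i, j), Inr (0, j))) [0..<npts T i]"
  let ?cs = "strand_comps T i S"
  have D: "distinct ?D" "set ?D = points T <+> points S"
    by (auto simp: distinct_map distinct_pts inj_on_def Plus_def)
  have R: "set ?R \<subseteq> set ?D \<times> set ?D"
  proof -
    have "partner T p \<in> points T" if "p \<in> points T" for p using T that by (auto simp: planar_tangle_def)
    moreover have "partner S p \<in> points S" if "p \<in> points S" for p using S that by (auto simp: planar_tangle_def)
    moreover have "(i, j) \<in> points T \<and> (0, j) \<in> points S" if "j < npts T i" for j
      using that i S0 np by (auto simp: points_def)
    ultimately show ?thesis by (auto simp: Plus_def)
  qed
  have st: "strands T i S = eqcl (set ?R)"
    unfolding strands_def by (rule arg_cong[where f = eqcl]) (use i in \<open>auto simp: points_def\<close>)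
  note C = comps[OF D(1) R, folded strand_comps_def, unfolded D(2), folded st]
  have kept: "a \<in> kept i X Y \<longleftrightarrow> is_kept i a \<and> a \<in> X <+> Y" for a X Y
    by (auto simp: kept_def is_kept_def Plus_def image_iff split: sum.splits)
  have part: "partner U (emb i S a) = emb i S b"
    if "a \<in> kept i (points T) (points S)" "b \<in> kept i (points T) (points S)" "a \<noteq> b" "(a, b) \<in> strands T i S" for a b
  proof -
    have "a \<in> set (concat ?cs)" using that(1) C(1) unfolding kept by metis
    then obtain c where c: "c \<in> set ?cs" "a \<in> set c" by auto
    then have "b \<in> set c" using C(4) that(4) by blast
    then show ?thesis using ok c that unfolding glue_ok_def kept Let_def by auto
  qed
  define h where "h = case_sum ((!) hT) ((!) hS)"
  let ?E = "map Inl (regs T) @ map Inr (regs S)"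
  let ?Q = "map (\<lambda>j. (Inl (reg T (i, j)), Inr (reg S (0, j)))) [0..<max 1 (npts T i)]"
  have E: "distinct ?E" "set ?E = regions T <+> regions S"
    using set_regs[OF l(1)] set_regs[OF l(2)] by (auto simp: distinct_map regs_def inj_on_def Plus_def)
  have iv: "(i, j) \<in> intervals T \<and> (0, j) \<in> intervals S" if "j < max 1 (npts T i)" for j
    using that i S0 np by (auto simp: intervals_def)
  have Q: "set ?Q \<subseteq> set ?E \<times> set ?E"
    unfolding E(2) using iv by (auto simp: regions_def Plus_def)
  have Qe: "set ?Q = {(Inl (reg T (i, j)), Inr (reg S (0, j))) | j. (i, j) \<in> intervals T}"
    using iv by (auto simp: intervals_def)
  note G = comps[OF E(1) Q, folded region_comps_def, unfolded E(2)]
  have hc: "\<And>c u. c \<in> set (region_comps T i S) \<Longrightarrow> u \<in> set c \<Longrightarrow> h u = h (hd c)"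
    and hd: "distinct (map (\<lambda>c. h (hd c)) (region_comps T i S))"
    using ok unfolding glue_ok_def h_def Let_def by auto
  have hh: "h u = h v \<longleftrightarrow> (u, v) \<in> eqcl (set ?Q)"
    if "u \<in> regions T <+> regions S" "v \<in> regions T <+> regions S" for u v
  proof -
    have "u \<in> set (concat (region_comps T i S))" "v \<in> set (concat (region_comps T i S))"
      using that G(1) by simp_all
    then obtain c c' where c: "c \<in> set (region_comps T i S)" "u \<in> set c"
      "c' \<in> set (region_comps T i S)" "v \<in> set c'" by auto
    have "h u = h v \<longleftrightarrow> c = c'"
      using hc[OF c(1,2)] hc[OF c(3,4)] hd c(1,3) by (auto simp: distinct_map dest: inj_onD)
    also have "\<dots> \<longleftrightarrow> (u, v) \<in> eqcl (set ?Q)"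
    proof
      assume "(u, v) \<in> eqcl (set ?Q)"
      then have "v \<in> set c" using G(4)[OF c(1,2)] by blast
      then show "c = c'" using G(3) c unfolding distinct_concat_iff by blast
    qed (use G(4)[OF c(1,2)] c in blast)
    finally show ?thesis .
  qed
  have rg: "reg U (emb i S a) = h (map_sum (reg T) (reg S) a)"
    if "a \<in> kept i (intervals T) (intervals S)" for a
    using that ok unfolding glue_ok_def h_def kept is_kept_def by (auto split: sum.splits)
  let ?cl = "filter (list_all (\<lambda>a. \<not> is_kept i a)) ?cs"
  let ?s = "\<lambda>c. map_prod (h \<circ> Inl) (h \<circ> Inl) (sides T (SOME p. Inl p \<in> c))"
  have cl: "closed_strands T i S = set ` set ?cl"
  proof -
    have sub: "set c \<subseteq> points T <+> points S" if "c \<in> set ?cs" for c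
      using that C(1) by auto
    have "closed_strands T i S = {k \<in> set ` set ?cs. k \<inter> kept i (points T) (points S) = {}}"
      unfolding closed_strands_def C(5) ..
    also have "\<dots> = set ` {c \<in> set ?cs. set c \<inter> kept i (points T) (points S) = {}}" by auto
    also have "{c \<in> set ?cs. set c \<inter> kept i (points T) (points S) = {}} = set ?cl"
      using sub kept[of _ "points T" "points S"] unfolding list_all_iff set_filter by blast
    finally show ?thesis .
  qed
  have inj: "inj_on set (set ?cl)" by (rule inj_on_subset[OF C(6)]) auto
  have "mset_set (closed_strands T i S) = image_mset set (mset ?cl)"
    unfolding cl image_mset_mset_set[OF inj, symmetric]
    using mset_set_set[OF distinct_filter[OF C(7)]] by simp
  then have "image_mset ?s (mset_set (closed_strands T i S)) = mset (map (\<lambda>c. ?s (set c)) ?cl)"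
    by (simp add: image_mset.compositionality comp_def del: mset_filter)
  also have "map (\<lambda>c. ?s (set c)) ?cl = lU"
  proof (rule nth_equalityI)
    have la: "list_all2 (\<lambda>c l. list_ex isl c \<and>
         (\<forall>a \<in> set c. case a of Inl p \<Rightarrow> map_prod ((!) hT) ((!) hT) (sides T p) = l | Inr _ \<Rightarrow> True)) ?cl lU"
      using ok unfolding glue_ok_def by blast
    show "length (map (\<lambda>c. ?s (set c)) ?cl) = length lU" using la by (simp add: list_all2_lengthD)
    fix n assume "n < length (map (\<lambda>c. ?s (set c)) ?cl)"
    then have n: "n < length ?cl" by simp
    let ?c = "?cl ! n"
    have c: "list_ex isl ?c" "\<And>p. Inl p \<in> set ?c \<Longrightarrow> map_prod ((!) hT) ((!) hT) (sides T p) = lU ! n"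
      using list_all2_nthD[OF la n] by (auto split: sum.splits)
    obtain p0 where "Inl p0 \<in> set ?c" using c(1) by (auto simp: list_ex_iff isl_def)
    then have "Inl (SOME p. Inl p \<in> set ?c) \<in> set ?c" by (rule someI)
    from c(2)[OF this] show "map (\<lambda>c. ?s (set c)) ?cl ! n = lU ! n"
      using n by (simp add: h_def comp_def)
  qed
  finally have lo: "loops U = image_mset ?s (mset_set (closed_strands T i S))" using lU by (simp add: comp_def)
  show ?thesis
    unfolding glued_def
    using i dU part hh[unfolded Qe] rg lo l by (intro conjI exI[of _ h] ballI impI) auto
qed

text \<open>
  An executable sufficient condition for isotopy of tangles without loops; the list \<open>f\<close> tabulates the map on
  regions.
\<close>

definition iso_ok :: "(nat \<Rightarrow> nat) \<Rightarrow> tangle \<Rightarrow> tangle \<Rightarrow> nat list \<Rightarrow> bool" where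
  "iso_ok \<sigma> T T' f \<longleftrightarrow>
     length (discs T) = length (discs T') \<and> \<sigma> 0 = 0 \<and>
     set (map \<sigma> [0..<length (discs T)]) = set [0..<length (discs T')] \<and>
     (\<forall>i \<in> set [0..<length (discs T)]. discs T' ! \<sigma> i = discs T ! i) \<and>
     (\<forall>p \<in> set (pts T). partner T' (map_prod \<sigma> id p) = map_prod \<sigma> id (partner T p)) \<and>
     distinct (map ((!) f) (regs T)) \<and> set (map ((!) f) (regs T)) = set (regs T') \<and>
     (\<forall>a \<in> set (ivs T). reg T' (map_prod \<sigma> id a) = f ! reg T a)"

lemma iso_okD:
  assumes ok: "iso_ok \<sigma> T T' f" and "planar_ok T" "planar_ok T'"
  shows "isotopic \<sigma> T T'"
proof -
  have l: "loops T = {#}" "loops T' = {#}" using assms by (auto simp: planar_ok_def)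
  have s: "\<sigma> ` {..<length (discs T)} = {..<length (discs T')}"
    using ok unfolding iso_ok_def set_map set_upt atLeast0LessThan by blast
  have "bij_betw \<sigma> {..<length (discs T)} {..<length (discs T')}"
    unfolding bij_betw_def
  proof (intro conjI eq_card_imp_inj_on s)
    show "card (\<sigma> ` {..<length (discs T)}) = card {..<length (discs T)}"
      unfolding s using ok by (simp add: iso_ok_def)
  qed simp
  moreover have "bij_betw ((!) f) (regions T) (regions T')"
    using ok unfolding bij_betw_def iso_ok_def set_regs[OF l(1), symmetric] set_regs[OF l(2), symmetric]
    by (auto simp: distinct_map)
  ultimately show ?thesis
    using ok l unfolding isotopic_def iso_ok_def by auto
qed

section \<open>The tangles\<close>

text \<open>
  A tangle given by the list of its strings and, for every disc, the list of the regions that its intervals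
  touch.  The tangles below come in pairs indexed by a shading \<open>e\<close>; the letters \<open>a\<close>, \<open>b\<close> stand for
  2-boxes of shading \<open>e\<close>, and \<open>c\<close>, \<open>d\<close> for 2-boxes of the opposite shading.
\<close>

definition tangle_of :: "color list \<Rightarrow> ((nat \<times> nat) \<times> (nat \<times> nat)) list \<Rightarrow> nat list list \<Rightarrow> tangle" where
  "tangle_of cs ss rs = \<lparr>discs = cs, partner = (\<lambda>p. the (map_of (ss @ map prod.swap ss) p)),
     reg = (\<lambda>(i, j). rs ! i ! j), loops = {#}\<rparr>"

text \<open>
  Partial traces of a 2-box: the right, respectively the left, pair of its strings is closed up.
\<close>

definition right_closure :: "bool \<Rightarrow> tangle" where
  "right_closure e = tangle_of [(1, e), (2, e)]
     [((0, 0), (1, 0)), ((0, 1), (1, 3)), ((1, 1), (1, 2))] [[0, 1], [0, 1, 2, 1]]"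

definition left_closure :: "bool \<Rightarrow> tangle" where
  "left_closure e = tangle_of [(1, \<not> e), (2, e)]
     [((0, 0), (1, 1)), ((0, 1), (1, 2)), ((1, 0), (1, 3))] [[0, 1], [2, 0, 1, 0]]"

text \<open>
  The left pair of strings of a 2-box is closed to the left, the right one to the right.  This is the trace
  network with the outer region moved across a string, and it is reached from both partial traces.
\<close>

definition side_trace :: "bool \<Rightarrow> tangle" where
  "side_trace e = tangle_of [(0, \<not> e), (2, e)]
     [((1, 0), (1, 3)), ((1, 1), (1, 2))] [[0], [1, 0, 2, 0]]"

definition trace_mult :: "bool \<Rightarrow> tangle" where
  "trace_mult e = tangle_of [(0, e), (2, e), (2, e)]
     [((1, 0), (2, 3)), ((1, 1), (2, 2)), ((1, 2), (2, 1)), ((1, 3), (2, 0))]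
     [[0], [0, 1, 2, 3], [0, 3, 2, 1]]"

definition mult3 :: "bool \<Rightarrow> tangle" where
  "mult3 e = tangle_of [(2, e), (2, e), (2, e), (2, e)]
     [((0, 0), (1, 0)), ((0, 1), (1, 1)), ((0, 2), (3, 2)), ((0, 3), (3, 3)),
      ((1, 2), (2, 1)), ((1, 3), (2, 0)), ((2, 2), (3, 1)), ((2, 3), (3, 0))]
     [[0, 1, 2, 3], [0, 1, 2, 4], [0, 4, 2, 5], [0, 5, 2, 3]]"

text \<open>
  The networks in the proof of Plancherel's identity.  In \<open>half_rotated\<close> the first disc is already turned back
  by one click, and turning the second one as well makes the clicks cancel except for their effect on the
  outer region.
\<close>

definition side_trace_mult :: "bool \<Rightarrow> tangle" where
  "side_trace_mult e = tangle_of [(0, \<not> e), (2, e), (2, e)]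
     [((1, 0), (2, 3)), ((1, 1), (2, 2)), ((1, 2), (2, 1)), ((1, 3), (2, 0))]
     [[0], [1, 0, 2, 3], [1, 3, 2, 0]]"

definition half_rotated :: "bool \<Rightarrow> tangle" where
  "half_rotated e = tangle_of [(0, \<not> e), (2, e), (2, \<not> e)]
     [((1, 0), (2, 0)), ((1, 1), (2, 3)), ((1, 2), (2, 2)), ((1, 3), (2, 1))]
     [[0], [1, 0, 2, 3], [0, 1, 3, 2]]"

text \<open>
  The two halves of the network in the key inequality.  In \<open>bridge\<close> one string joins \<open>c\<close> and \<open>a\<close>, and in \<open>cobridge\<close> one
  string joins \<open>b\<close> and \<open>d\<close>; the six other strings end on the boundary.  The boundary points are numbered so
  that the trace of the product of the two 3-boxes joins every end to its partner, and so that the outer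
  region of that trace is the one left of \<open>c d\<close>.
\<close>

definition bridge :: "bool \<Rightarrow> tangle" where
  "bridge e = tangle_of [(3, \<not> e), (2, \<not> e), (2, e)]
     [((0, 0), (1, 0)), ((0, 1), (2, 2)), ((0, 2), (2, 3)), ((0, 3), (2, 0)),
      ((0, 4), (1, 2)), ((0, 5), (1, 3)), ((1, 1), (2, 1))]
     [[0, 1, 2, 3, 4, 5], [0, 1, 4, 5], [3, 4, 1, 2]]"

definition bridge_star :: "bool \<Rightarrow> tangle" where
  "bridge_star e = tangle_of [(3, \<not> e), (2, e), (2, \<not> e)]
     [((0, 0), (2, 0)), ((0, 1), (2, 1)), ((0, 2), (1, 3)), ((0, 3), (1, 0)),
      ((0, 4), (1, 1)), ((0, 5), (2, 3)), ((1, 2), (2, 2))]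
     [[0, 1, 2, 3, 4, 5], [3, 4, 5, 2], [0, 1, 2, 5]]"

definition cobridge :: "bool \<Rightarrow> tangle" where
  "cobridge e = tangle_of [(3, \<not> e), (2, e), (2, \<not> e)]
     [((0, 0), (2, 0)), ((0, 1), (2, 1)), ((0, 2), (2, 2)), ((0, 3), (1, 0)),
      ((0, 4), (1, 1)), ((0, 5), (1, 2)), ((1, 3), (2, 3))]
     [[0, 1, 2, 3, 4, 5], [3, 4, 5, 0], [0, 1, 2, 3]]"

definition cobridge_star :: "bool \<Rightarrow> tangle" where
  "cobridge_star e = tangle_of [(3, \<not> e), (2, \<not> e), (2, e)]
     [((0, 0), (2, 1)), ((0, 1), (2, 2)), ((0, 2), (2, 3)), ((0, 3), (1, 1)),
      ((0, 4), (1, 2)), ((0, 5), (1, 3)), ((1, 0), (2, 0))]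
     [[0, 1, 2, 3, 4, 5], [0, 3, 4, 5], [3, 0, 1, 2]]"

text \<open>
  The trace of a product of 3-boxes, with none, one or both of the 3-boxes replaced by a half network.  Here
  \<open>bridge_cobridge\<close> is the inner product of the two halves, and \<open>bridge_bridge\<close> and \<open>cobridge_cobridge\<close> are their
  squared norms.
\<close>

definition trace_mult_3 :: "bool \<Rightarrow> tangle" where
  "trace_mult_3 e = tangle_of [(0, e), (3, e), (3, e)]
     [((1, 0), (2, 5)), ((1, 1), (2, 4)), ((1, 2), (2, 3)), ((1, 3), (2, 2)), ((1, 4), (2, 1)), ((1, 5), (2, 0))]
     [[0], [0, 1, 2, 3, 4, 5], [0, 5, 4, 3, 2, 1]]"

definition bridge_3 :: "bool \<Rightarrow> tangle" where
  "bridge_3 e = tangle_of [(0, \<not> e), (2, \<not> e), (2, e), (3, \<not> e)]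
     [((1, 0), (3, 5)), ((1, 1), (2, 1)), ((1, 2), (3, 1)), ((1, 3), (3, 0)),
      ((2, 0), (3, 2)), ((2, 2), (3, 4)), ((2, 3), (3, 3))]
     [[0], [0, 1, 2, 3], [4, 2, 1, 5], [0, 3, 2, 4, 5, 1]]"

definition three_cobridge :: "bool \<Rightarrow> tangle" where
  "three_cobridge e = tangle_of [(0, \<not> e), (3, \<not> e), (2, e), (2, \<not> e)]
     [((1, 0), (2, 2)), ((1, 1), (2, 1)), ((1, 2), (2, 0)), ((1, 3), (3, 2)),
      ((1, 4), (3, 1)), ((1, 5), (3, 0)), ((2, 3), (3, 3))]
     [[0], [0, 1, 2, 3, 4, 5], [3, 2, 1, 0], [0, 5, 4, 3]]"

definition bridge_cobridge :: "bool \<Rightarrow> tangle" where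
  "bridge_cobridge e = tangle_of [(0, \<not> e), (2, \<not> e), (2, e), (2, e), (2, \<not> e)]
     [((1, 0), (3, 2)), ((1, 1), (2, 1)), ((1, 2), (4, 1)), ((1, 3), (4, 0)),
      ((2, 0), (4, 2)), ((2, 2), (3, 1)), ((2, 3), (3, 0)), ((3, 3), (4, 3))]
     [[0], [0, 1, 2, 3], [4, 2, 1, 5], [4, 5, 1, 0], [0, 3, 2, 4]]"

definition bridge_bridge :: "bool \<Rightarrow> tangle" where
  "bridge_bridge e = tangle_of [(0, \<not> e), (2, \<not> e), (2, e), (2, e), (2, \<not> e)]
     [((1, 0), (4, 3)), ((1, 1), (2, 1)), ((1, 2), (4, 1)), ((1, 3), (4, 0)),
      ((2, 0), (3, 3)), ((2, 2), (3, 1)), ((2, 3), (3, 0)), ((3, 2), (4, 2))]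
     [[0], [0, 1, 2, 3], [4, 2, 1, 5], [4, 5, 1, 2], [0, 3, 2, 1]]"

definition cobridge_cobridge :: "bool \<Rightarrow> tangle" where
  "cobridge_cobridge e = tangle_of [(0, \<not> e), (2, \<not> e), (2, e), (2, e), (2, \<not> e)]
     [((1, 0), (2, 0)), ((1, 1), (4, 2)), ((1, 2), (4, 1)), ((1, 3), (4, 0)),
      ((2, 1), (3, 2)), ((2, 2), (3, 1)), ((2, 3), (3, 0)), ((3, 3), (4, 3))]
     [[0], [0, 1, 2, 3], [1, 0, 4, 5], [1, 5, 4, 0], [0, 3, 2, 1]]"

text \<open>
  The trace of $c\, d\, y$, and the same with $y = \mathfrak{F}_s(a b)$.
\<close>

definition trace_mult3 :: "bool \<Rightarrow> tangle" where
  "trace_mult3 e = tangle_of [(0, e), (2, e), (2, e), (2, e)]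
     [((1, 0), (3, 3)), ((1, 1), (3, 2)), ((1, 2), (2, 1)), ((1, 3), (2, 0)), ((2, 2), (3, 1)), ((2, 3), (3, 0))]
     [[0], [0, 1, 2, 3], [0, 3, 2, 4], [0, 4, 2, 1]]"

definition fourier_mult :: "bool \<Rightarrow> tangle" where
  "fourier_mult e = tangle_of [(2, \<not> e), (2, e), (2, e)]
     [((0, 0), (2, 3)), ((0, 1), (1, 0)), ((0, 2), (1, 1)), ((0, 3), (2, 2)), ((1, 2), (2, 1)), ((1, 3), (2, 0))]
     [[0, 1, 2, 3], [1, 2, 3, 4], [1, 4, 3, 0]]"

definition trace_mult_fourier_mult :: "bool \<Rightarrow> tangle" where
  "trace_mult_fourier_mult e = tangle_of [(0, \<not> e), (2, \<not> e), (2, \<not> e), (2, e), (2, e)]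
     [((1, 0), (4, 2)), ((1, 1), (3, 1)), ((1, 2), (2, 1)), ((1, 3), (2, 0)),
      ((2, 2), (3, 0)), ((2, 3), (4, 3)), ((3, 2), (4, 1)), ((3, 3), (4, 0))]
     [[0], [0, 1, 2, 3], [0, 3, 2, 4], [4, 2, 1, 5], [4, 5, 1, 0]]"

text \<open>
  The tangles that exhibit the partial trace of $a a^*$ inside the squared norm of the first half, and of $b^* b$
  inside that of the second one.  In \<open>left_insert\<close> and \<open>right_insert\<close> this partial trace is a 1-box on the fourth
  string between a 2-box and its adjoint.
\<close>

definition left_closure_mult :: "bool \<Rightarrow> tangle" where
  "left_closure_mult e = tangle_of [(1, \<not> e), (2, e), (2, e)]
     [((0, 0), (1, 1)), ((0, 1), (2, 2)), ((1, 0), (2, 3)), ((1, 2), (2, 1)), ((1, 3), (2, 0))]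
     [[0, 1], [2, 0, 1, 3], [2, 3, 1, 0]]"

definition right_closure_mult :: "bool \<Rightarrow> tangle" where
  "right_closure_mult e = tangle_of [(1, e), (2, e), (2, e)]
     [((0, 0), (1, 0)), ((0, 1), (2, 3)), ((1, 1), (2, 2)), ((1, 2), (2, 1)), ((1, 3), (2, 0))]
     [[0, 1], [0, 1, 2, 3], [0, 3, 2, 1]]"

definition left_insert :: "bool \<Rightarrow> tangle" where
  "left_insert e = tangle_of [(0, \<not> e), (2, \<not> e), (1, \<not> e), (2, \<not> e)]
     [((1, 0), (3, 3)), ((1, 1), (2, 0)), ((1, 2), (3, 1)), ((1, 3), (3, 0)), ((2, 1), (3, 2))]
     [[0], [0, 1, 2, 3], [2, 1], [0, 3, 2, 1]]"

definition right_insert :: "bool \<Rightarrow> tangle" where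
  "right_insert e = tangle_of [(0, \<not> e), (2, \<not> e), (1, e), (2, \<not> e)]
     [((1, 0), (2, 0)), ((1, 1), (3, 2)), ((1, 2), (3, 1)), ((1, 3), (3, 0)), ((2, 1), (3, 3))]
     [[0], [0, 1, 2, 3], [1, 0], [0, 3, 2, 1]]"

text \<open>
  A string with a disc, a closed 1-box or a loop to its right; these compute the partial trace of the
  2-box unit.
\<close>

definition string_disc :: "bool \<Rightarrow> tangle" where
  "string_disc e = tangle_of [(1, e), (0, \<not> e)] [((0, 0), (0, 1))] [[0, 1], [1]]"

definition string_trace :: "bool \<Rightarrow> tangle" where
  "string_trace e = tangle_of [(1, e), (1, \<not> e)] [((0, 0), (0, 1)), ((1, 0), (1, 1))] [[0, 1], [1, 2]]"

definition string_loop :: "bool \<Rightarrow> tangle" where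
  "string_loop e = (tangle_of [(1, e)] [((0, 0), (0, 1))] [[0, 1]])\<lparr>loops := {#if e then (2, 1) else (1, 2)#}\<rparr>"

lemma planar_ok_basic:
  "\<forall>e. planar_ok (mult_tangle (0, e))" "\<forall>e. planar_ok (mult_tangle (1, e))"
  "\<forall>e. planar_ok (mult_tangle (2, e))" "\<forall>e. planar_ok (mult_tangle (3, e))"
  "\<forall>e. planar_ok (trace_tangle (0, e))" "\<forall>e. planar_ok (trace_tangle (1, e))"
  "\<forall>e. planar_ok (trace_tangle (2, e))" "\<forall>e. planar_ok (trace_tangle (3, e))"
  "\<forall>e. planar_ok (left_trace_tangle e)" "\<forall>e. planar_ok (empty_tangle e)"
  "\<forall>e. planar_ok (unit_tangle (1, e))" "\<forall>e. planar_ok (unit_tangle (2, e))"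
  "\<forall>e. planar_ok (fourier_tangle e)" "\<forall>e. planar_ok (reflect (fourier_tangle e))"
  "\<forall>e. planar_ok (reflect (mult_tangle (2, e)))" "\<forall>e. planar_ok (reflect (unit_tangle (1, e)))"
  by code_simp+

lemma planar_ok_special:
  "\<forall>e. planar_ok (right_closure e)" "\<forall>e. planar_ok (left_closure e)"
  "\<forall>e. planar_ok (side_trace e)" "\<forall>e. planar_ok (trace_mult e)"
  "\<forall>e. planar_ok (half_rotated e)"
  "\<forall>e. planar_ok (bridge e)" "\<forall>e. planar_ok (bridge_star e)"
  "\<forall>e. planar_ok (cobridge e)" "\<forall>e. planar_ok (cobridge_star e)"
  "\<forall>e. planar_ok (reflect (bridge e))" "\<forall>e. planar_ok (reflect (cobridge e))"
  "\<forall>e. planar_ok (trace_mult_3 e)" "\<forall>e. planar_ok (bridge_3 e)" "\<forall>e. planar_ok (three_cobridge e)"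
  "\<forall>e. planar_ok (bridge_cobridge e)" "\<forall>e. planar_ok (trace_mult3 e)"
  "\<forall>e. planar_ok (fourier_mult e)" "\<forall>e. planar_ok (trace_mult_fourier_mult e)"
  "\<forall>e. planar_ok (left_closure_mult e)" "\<forall>e. planar_ok (right_closure_mult e)"
  "\<forall>e. planar_ok (left_insert e)" "\<forall>e. planar_ok (right_insert e)"
  "\<forall>e. planar_ok (string_disc e)" "\<forall>e. planar_ok (string_trace e)"
  by code_simp+

section \<open>Relations between the tangles\<close>

lemmas planar = planar_ok_basic[rule_format] planar_ok_special[rule_format]

text \<open>
  The two shadings are checked together.  In the tables below a label that does not occur as a region gets an
  arbitrary entry, which is never read.
\<close>

lemma glued_all:
  assumes "\<forall>e. glue_ok (T e) i (S e) (U e) hT hS (l e)" "\<And>e. planar_ok (T e)" "\<And>e. planar_ok (S e)"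
    and "\<And>e. loops (U e) = mset (l e)"
  shows "glued (T e) i (S e) (U e)"
  using assms by (intro glue_okD[where lU = "l e"]) auto

lemma loops_tangle_of [simp]: "loops (tangle_of cs ss rs) = {#}"
  by (simp add: tangle_of_def)

lemmas tangle_defs = right_closure_def left_closure_def side_trace_def trace_mult_def mult3_def
  side_trace_mult_def half_rotated_def bridge_def bridge_star_def cobridge_def cobridge_star_def
  trace_mult_3_def bridge_3_def three_cobridge_def bridge_cobridge_def bridge_bridge_def
  cobridge_cobridge_def trace_mult3_def fourier_mult_def trace_mult_fourier_mult_def
  left_closure_mult_def right_closure_mult_def left_insert_def right_insert_def string_disc_def
  string_trace_def

lemma loops_basic [simp]: "loops (mult_tangle c) = {#}" "loops (trace_tangle c) = {#}"
   "loops (unit_tangle c) = {#}" "loops (id_tangle c) = {#}"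
  by (simp_all add: mult_tangle_def trace_tangle_def unit_tangle_def id_tangle_def Let_def)

declare tangle_defs [THEN arg_cong [where f = loops], unfolded loops_tangle_of, simp]

lemma loops_string_loop [simp]: "loops (string_loop e) = {#if e then (2, 1) else (1, 2)#}"
  by (simp add: string_loop_def)

lemma glued_right_closure_trace: "glued (trace_tangle (1, e)) 1 (right_closure e) (trace_tangle (2, e))"
  by (rule glued_all[where T = "\<lambda>e. trace_tangle (1, e)" and S = "\<lambda>e. right_closure e" and U = "\<lambda>e. trace_tangle (2, e)" and l = "\<lambda>e. []"
        and hT = "[0, 1]" and hS = "[0, 1, 2]"], code_simp) (rule planar | simp)+

lemma glued_right_closure_side_trace: "glued (left_trace_tangle e) 1 (right_closure e) (side_trace e)"
  by (rule glued_all[where T = "\<lambda>e. left_trace_tangle e" and S = "\<lambda>e. right_closure e" and U = "\<lambda>e. side_trace e" and l = "\<lambda>e. []"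
        and hT = "[1, 0]" and hS = "[1, 0, 2]"], code_simp) (rule planar | simp)+

lemma glued_left_closure_trace: "glued (trace_tangle (1, \<not> e)) 1 (left_closure e) (side_trace e)"
  by (rule glued_all[where T = "\<lambda>e. trace_tangle (1, \<not> e)" and S = "\<lambda>e. left_closure e" and U = "\<lambda>e. side_trace e" and l = "\<lambda>e. []"
        and hT = "[0, 2]" and hS = "[0, 2, 1]"], code_simp) (rule planar | simp)+

lemma glued_trace_mult: "glued (trace_tangle (2, e)) 1 (mult_tangle (2, e)) (trace_mult e)"
  by (rule glued_all[where T = "\<lambda>e. trace_tangle (2, e)" and S = "\<lambda>e. mult_tangle (2, e)" and U = "\<lambda>e. trace_mult e" and l = "\<lambda>e. []"
        and hT = "[0, 1, 2]" and hS = "[0, 1, 2, 1, 9, 3]"], code_simp) (rule planar | simp)+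

lemma glued_mult_left: "glued (mult_tangle (2, e)) 1 (mult_tangle (2, e)) (mult3 e)"
  by (rule glued_all[where T = "\<lambda>e. mult_tangle (2, e)" and S = "\<lambda>e. mult_tangle (2, e)" and U = "\<lambda>e. mult3 e" and l = "\<lambda>e. []"
        and hT = "[0, 1, 2, 3, 9, 5]" and hS = "[0, 1, 2, 5, 9, 4]"], code_simp) (rule planar | simp)+

lemma glued_mult_right: "glued (mult_tangle (2, e)) 2 (mult_tangle (2, e)) (mult3 e)"
  by (rule glued_all[where T = "\<lambda>e. mult_tangle (2, e)" and S = "\<lambda>e. mult_tangle (2, e)" and U = "\<lambda>e. mult3 e" and l = "\<lambda>e. []"
        and hT = "[0, 1, 2, 3, 9, 4]" and hS = "[0, 4, 2, 3, 9, 5]"], code_simp) (rule planar | simp)+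

lemma glued_unit_left: "glued (mult_tangle (2, e)) 1 (unit_tangle (2, e)) (id_tangle (2, e))"
  by (rule glued_all[where T = "\<lambda>e. mult_tangle (2, e)" and S = "\<lambda>e. unit_tangle (2, e)" and U = "\<lambda>e. id_tangle (2, e)" and l = "\<lambda>e. []"
        and hT = "[0, 1, 2, 3, 9, 1]" and hS = "[0, 1, 2]"], code_simp) (rule planar | simp)+

lemma glued_unit_right: "glued (mult_tangle (2, e)) 2 (unit_tangle (2, e)) (id_tangle (2, e))"
  by (rule glued_all[where T = "\<lambda>e. mult_tangle (2, e)" and S = "\<lambda>e. unit_tangle (2, e)" and U = "\<lambda>e. id_tangle (2, e)" and l = "\<lambda>e. []"
        and hT = "[0, 1, 2, 3, 9, 3]" and hS = "[0, 3, 2]"], code_simp) (rule planar | simp)+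

lemma glued_unit_left_1: "glued (mult_tangle (1, e)) 1 (unit_tangle (1, e)) (id_tangle (1, e))"
  by (rule glued_all[where T = "\<lambda>e. mult_tangle (1, e)" and S = "\<lambda>e. unit_tangle (1, e)" and U = "\<lambda>e. id_tangle (1, e)" and l = "\<lambda>e. []"
        and hT = "[0, 1]" and hS = "[0, 1]"], code_simp) (rule planar | simp)+

lemma glued_unit_left_0: "glued (mult_tangle (0, e)) 1 (empty_tangle e) (id_tangle (0, e))"
  by (rule glued_all[where T = "\<lambda>e. mult_tangle (0, e)" and S = "\<lambda>e. empty_tangle e" and U = "\<lambda>e. id_tangle (0, e)" and l = "\<lambda>e. []"
        and hT = "[0]" and hS = "[0]"], code_simp) (rule planar | simp)+

lemma glued_side_trace_mult: "glued (side_trace e) 1 (mult_tangle (2, e)) (side_trace_mult e)"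
  by (rule glued_all[where T = "\<lambda>e. side_trace e" and S = "\<lambda>e. mult_tangle (2, e)" and U = "\<lambda>e. side_trace_mult e" and l = "\<lambda>e. []"
        and hT = "[0, 1, 2]" and hS = "[1, 0, 2, 0, 9, 3]"], code_simp) (rule planar | simp)+

lemma glued_half_rotated: "glued (trace_mult (\<not> e)) 1 (reflect (fourier_tangle e)) (half_rotated e)"
  by (rule glued_all[where T = "\<lambda>e. trace_mult (\<not> e)" and S = "\<lambda>e. reflect (fourier_tangle e)" and U = "\<lambda>e. half_rotated e" and l = "\<lambda>e. []"
        and hT = "[0, 2, 3, 1]" and hS = "[1, 3, 2, 0]"], code_simp) (rule planar | simp)+

lemma glued_rotated: "glued (half_rotated e) 2 (fourier_tangle e) (side_trace_mult e)"
  by (rule glued_all[where T = "\<lambda>e. half_rotated e" and S = "\<lambda>e. fourier_tangle e" and U = "\<lambda>e. side_trace_mult e" and l = "\<lambda>e. []"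
        and hT = "[0, 1, 2, 3]" and hS = "[1, 3, 2, 0]"], code_simp) (rule planar | simp)+

lemma glued_trace_mult_3: "glued (trace_tangle (3, e)) 1 (mult_tangle (3, e)) (trace_mult_3 e)"
  by (rule glued_all[where T = "\<lambda>e. trace_tangle (3, e)" and S = "\<lambda>e. mult_tangle (3, e)" and U = "\<lambda>e. trace_mult_3 e" and l = "\<lambda>e. []"
        and hT = "[0, 1, 2, 3]" and hS = "[0, 1, 2, 3, 2, 1, 9, 4, 5]"], code_simp) (rule planar | simp)+

lemma glued_bridge_3: "glued (trace_mult_3 (\<not> e)) 1 (bridge e) (bridge_3 e)"
  by (rule glued_all[where T = "\<lambda>e. trace_mult_3 (\<not> e)" and S = "\<lambda>e. bridge e" and U = "\<lambda>e. bridge_3 e" and l = "\<lambda>e. []"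
        and hT = "[0, 1, 5, 4, 2, 3]" and hS = "[0, 1, 5, 4, 2, 3]"], code_simp) (rule planar | simp)+

lemma glued_bridge_cobridge: "glued (bridge_3 e) 3 (cobridge e) (bridge_cobridge e)"
  by (rule glued_all[where T = "\<lambda>e. bridge_3 e" and S = "\<lambda>e. cobridge e" and U = "\<lambda>e. bridge_cobridge e" and l = "\<lambda>e. []"
        and hT = "[0, 1, 2, 3, 4, 5]" and hS = "[0, 3, 2, 4, 5, 1]"], code_simp) (rule planar | simp)+

lemma glued_bridge_bridge: "glued (bridge_3 e) 3 (bridge_star e) (bridge_bridge e)"
  by (rule glued_all[where T = "\<lambda>e. bridge_3 e" and S = "\<lambda>e. bridge_star e" and U = "\<lambda>e. bridge_bridge e" and l = "\<lambda>e. []"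
        and hT = "[0, 1, 2, 3, 4, 5]" and hS = "[0, 3, 2, 4, 5, 1]"], code_simp) (rule planar | simp)+

lemma glued_three_cobridge: "glued (trace_mult_3 (\<not> e)) 2 (cobridge e) (three_cobridge e)"
  by (rule glued_all[where T = "\<lambda>e. trace_mult_3 (\<not> e)" and S = "\<lambda>e. cobridge e" and U = "\<lambda>e. three_cobridge e" and l = "\<lambda>e. []"
        and hT = "[0, 1, 2, 3, 4, 5]" and hS = "[0, 5, 4, 3, 2, 1]"], code_simp) (rule planar | simp)+

lemma glued_cobridge_cobridge: "glued (three_cobridge e) 1 (cobridge_star e) (cobridge_cobridge e)"
  by (rule glued_all[where T = "\<lambda>e. three_cobridge e" and S = "\<lambda>e. cobridge_star e" and U = "\<lambda>e. cobridge_cobridge e" and l = "\<lambda>e. []"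
        and hT = "[0, 4, 5, 1, 2, 3]" and hS = "[0, 4, 5, 1, 2, 3]"], code_simp) (rule planar | simp)+

lemma glued_trace_mult3: "glued (trace_mult e) 1 (mult_tangle (2, e)) (trace_mult3 e)"
  by (rule glued_all[where T = "\<lambda>e. trace_mult e" and S = "\<lambda>e. mult_tangle (2, e)" and U = "\<lambda>e. trace_mult3 e" and l = "\<lambda>e. []"
        and hT = "[0, 1, 2, 4]" and hS = "[0, 1, 2, 4, 9, 3]"], code_simp) (rule planar | simp)+

lemma glued_fourier_mult: "glued (fourier_tangle e) 1 (mult_tangle (2, e)) (fourier_mult e)"
  by (rule glued_all[where T = "\<lambda>e. fourier_tangle e" and S = "\<lambda>e. mult_tangle (2, e)" and U = "\<lambda>e. fourier_mult e" and l = "\<lambda>e. []"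
        and hT = "[1, 2, 3, 0]" and hS = "[1, 2, 3, 0, 9, 4]"], code_simp) (rule planar | simp)+

lemma glued_trace_mult_fourier_mult: "glued (trace_mult3 (\<not> e)) 3 (fourier_mult e) (trace_mult_fourier_mult e)"
  by (rule glued_all[where T = "\<lambda>e. trace_mult3 (\<not> e)" and S = "\<lambda>e. fourier_mult e" and U = "\<lambda>e. trace_mult_fourier_mult e" and l = "\<lambda>e. []"
        and hT = "[0, 1, 2, 3, 4]" and hS = "[0, 4, 2, 1, 5]"], code_simp) (rule planar | simp)+

lemma glued_left_closure_mult: "glued (left_closure e) 1 (mult_tangle (2, e)) (left_closure_mult e)"
  by (rule glued_all[where T = "\<lambda>e. left_closure e" and S = "\<lambda>e. mult_tangle (2, e)" and U = "\<lambda>e. left_closure_mult e" and l = "\<lambda>e. []"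
        and hT = "[0, 1, 2]" and hS = "[2, 0, 1, 0, 9, 3]"], code_simp) (rule planar | simp)+

lemma glued_right_closure_mult: "glued (right_closure e) 1 (mult_tangle (2, e)) (right_closure_mult e)"
  by (rule glued_all[where T = "\<lambda>e. right_closure e" and S = "\<lambda>e. mult_tangle (2, e)" and U = "\<lambda>e. right_closure_mult e" and l = "\<lambda>e. []"
        and hT = "[0, 1, 2]" and hS = "[0, 1, 2, 1, 9, 3]"], code_simp) (rule planar | simp)+

lemma glued_left_insert: "glued (left_insert e) 2 (left_closure_mult e) (bridge_bridge e)"
  by (rule glued_all[where T = "\<lambda>e. left_insert e" and S = "\<lambda>e. left_closure_mult e" and U = "\<lambda>e. bridge_bridge e" and l = "\<lambda>e. []"
        and hT = "[0, 1, 2, 3]" and hS = "[2, 1, 4, 5]"], code_simp) (rule planar | simp)+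

lemma glued_left_insert_unit: "glued (left_insert e) 2 (unit_tangle (1, \<not> e)) (trace_mult (\<not> e))"
  by (rule glued_all[where T = "\<lambda>e. left_insert e" and S = "\<lambda>e. unit_tangle (1, \<not> e)" and U = "\<lambda>e. trace_mult (\<not> e)" and l = "\<lambda>e. []"
        and hT = "[0, 1, 2, 3]" and hS = "[2, 1]"], code_simp) (rule planar | simp)+

lemma glued_right_insert: "glued (right_insert e) 2 (right_closure_mult e) (cobridge_cobridge e)"
  by (rule glued_all[where T = "\<lambda>e. right_insert e" and S = "\<lambda>e. right_closure_mult e" and U = "\<lambda>e. cobridge_cobridge e" and l = "\<lambda>e. []"
        and hT = "[0, 1, 2, 3]" and hS = "[1, 0, 4, 5]"], code_simp) (rule planar | simp)+

lemma glued_right_insert_unit: "glued (right_insert e) 2 (unit_tangle (1, e)) (trace_mult (\<not> e))"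
  by (rule glued_all[where T = "\<lambda>e. right_insert e" and S = "\<lambda>e. unit_tangle (1, e)" and U = "\<lambda>e. trace_mult (\<not> e)" and l = "\<lambda>e. []"
        and hT = "[0, 1, 2, 3]" and hS = "[1, 0]"], code_simp) (rule planar | simp)+

lemma glued_string_trace: "glued (string_disc e) 1 (trace_tangle (1, \<not> e)) (string_trace e)"
  by (rule glued_all[where T = "\<lambda>e. string_disc e" and S = "\<lambda>e. trace_tangle (1, \<not> e)" and U = "\<lambda>e. string_trace e" and l = "\<lambda>e. []"
        and hT = "[0, 1]" and hS = "[1, 2]"], code_simp) (rule planar | simp)+

lemma glued_string_empty: "glued (string_disc e) 1 (empty_tangle (\<not> e)) (unit_tangle (1, e))"
  by (rule glued_all[where T = "\<lambda>e. string_disc e" and S = "\<lambda>e. empty_tangle (\<not> e)" and U = "\<lambda>e. unit_tangle (1, e)" and l = "\<lambda>e. []"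
        and hT = "[0, 1]" and hS = "[1]"], code_simp) (rule planar | simp)+

lemma glued_string_loop: "glued (string_trace e) 1 (unit_tangle (1, \<not> e)) (string_loop e)"
  by (rule glued_all[where T = "\<lambda>e. string_trace e" and S = "\<lambda>e. unit_tangle (1, \<not> e)" and U = "\<lambda>e. string_loop e" and l = "\<lambda>e. [if e then (2, 1) else (1, 2)]"
        and hT = "[0, 1, 2]" and hS = "[1, 2]"], code_simp) (rule planar | simp)+

lemma glued_right_closure_unit: "glued (right_closure e) 1 (unit_tangle (2, e)) (string_loop e)"
  by (rule glued_all[where T = "\<lambda>e. right_closure e" and S = "\<lambda>e. unit_tangle (2, e)" and U = "\<lambda>e. string_loop e" and l = "\<lambda>e. [if e then (2, 1) else (1, 2)]"
        and hT = "[0, 1, 2]" and hS = "[0, 1, 2]"], code_simp) (rule planar | simp)+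

lemma glued_loop: "glued (trace_tangle (1, True)) 1 (unit_tangle (1, True)) loop_tangle"
  by (rule glue_okD[where hT = "[0, 1]" and hS = "[0, 1]" and lU = "[(0, 1)]"], code_simp)
    (rule planar | simp add: loop_tangle_def)+

lemma glued_loop_left: "glued (left_trace_tangle False) 1 (unit_tangle (1, False)) loop_tangle"
  by (rule glue_okD[where hT = "[1, 0]" and hS = "[1, 0]" and lU = "[(0, 1)]"], code_simp)
    (rule planar | simp add: loop_tangle_def)+

text \<open>
  An isotopy renumbers the discs by a permutation that is written as the list of its values.
\<close>

lemma isotopic_all:
  assumes "\<forall>e. iso_ok ((!) s) (T e) (T' e) f" "\<And>e. planar_ok (T e)" "\<And>e. planar_ok (T' e)"
  shows "isotopic ((!) s) (T e) (T' e)"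
  using assms by (intro iso_okD[where f = f]) auto

lemma isotopic_trace_mult: "isotopic ((!) [0, 2, 1]) (trace_mult e) (trace_mult e)"
  by (rule isotopic_all[where T = "\<lambda>e. trace_mult e" and T' = "\<lambda>e. trace_mult e" and f = "[0, 3, 2, 1]"], code_simp)
    (rule planar)+

lemma isotopic_reflect_mult: "isotopic ((!) [0, 2, 1]) (reflect (mult_tangle (2, e))) (mult_tangle (2, e))"
  by (rule isotopic_all[where T = "\<lambda>e. reflect (mult_tangle (2, e))" and T' = "\<lambda>e. mult_tangle (2, e)"
      and f = "[0, 3, 2, 1, 9, 5]"], code_simp)
    (rule planar)+

lemma isotopic_reflect_unit_1: "isotopic ((!) [0]) (reflect (unit_tangle (1, e))) (unit_tangle (1, e))"
  by (rule isotopic_all[where T = "\<lambda>e. reflect (unit_tangle (1, e))" and T' = "\<lambda>e. unit_tangle (1, e)"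
      and f = "[0, 1]"], code_simp)
    (rule planar)+

lemma isotopic_reflect_bridge: "isotopic ((!) [0, 2, 1]) (reflect (bridge e)) (bridge_star e)"
  by (rule isotopic_all[where T = "\<lambda>e. reflect (bridge e)" and T' = "\<lambda>e. bridge_star e"
      and f = "[0, 5, 4, 3, 2, 1]"], code_simp)
    (rule planar)+

lemma isotopic_reflect_cobridge: "isotopic ((!) [0, 2, 1]) (reflect (cobridge e)) (cobridge_star e)"
  by (rule isotopic_all[where T = "\<lambda>e. reflect (cobridge e)" and T' = "\<lambda>e. cobridge_star e"
      and f = "[0, 5, 4, 3, 2, 1]"], code_simp)
    (rule planar)+

lemma isotopic_bridge_cobridge:
  "isotopic ((!) [0, 1, 3, 4, 2]) (bridge_cobridge e) (trace_mult_fourier_mult e)"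
  by (rule isotopic_all[where T = "\<lambda>e. bridge_cobridge e" and T' = "\<lambda>e. trace_mult_fourier_mult e"
      and f = "[0, 1, 2, 3, 4, 5]"], code_simp)
    (rule planar)+
lemma discs_tangle_of [simp]: "discs (tangle_of cs ss rs) = cs"
  by (simp add: tangle_of_def)

lemma discs_basic [simp]: "discs (mult_tangle c) = [c, c, c]" "discs (trace_tangle c) = [(0, snd c), c]"
   "discs (unit_tangle c) = [c]" "discs (id_tangle c) = [c, c]" "discs (empty_tangle e) = [(0, e)]"
   "discs (left_trace_tangle e) = [(0, \<not> e), (1, e)]" "discs (fourier_tangle e) = [(2, \<not> e), (2, e)]"
   "discs (reflect T) = discs T"
  by (simp_all add: mult_tangle_def trace_tangle_def unit_tangle_def id_tangle_def empty_tangle_def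
      left_trace_tangle_def fourier_tangle_def reflect_def Let_def)

declare tangle_defs [THEN arg_cong [where f = discs], unfolded discs_tangle_of, simp]

lemmas planar_tangles = planar [THEN planar_okD]

lemma planar_mult: "n \<le> 3 \<Longrightarrow> planar_tangle (mult_tangle (n, e))"
  and planar_trace: "n \<le> 3 \<Longrightarrow> planar_tangle (trace_tangle (n, e))"
proof -
  assume "n \<le> 3"
  then consider "n = 0" | "n = 1" | "n = 2" | "n = 3" by linarith
  then show "planar_tangle (mult_tangle (n, e))" "planar_tangle (trace_tangle (n, e))"
    by (cases; simp add: planar_tangles del: One_nat_def)+
qed

section \<open>Two-box algebras of a planar algebra\<close>

context planar_algebra
begin

sublocale vs: vector_space "cscale A"
  by (rule vector_space)

lemma zero_in [simp]: "0 \<in> pbox A c"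
  using subspace[of c] by (rule vs.subspace_0)

lemma inputs_iff: "xs \<in> inputs A T \<longleftrightarrow> list_all2 (\<lambda>x c. x \<in> pbox A c) xs (tl (discs T))"
  by (simp add: inputs_def)

lemma act_zero:
  assumes "planar_tangle T" "xs @ [0] @ ys \<in> inputs A T"
  shows "act A T (xs @ [0] @ ys) = 0"
  using act_multilinear[OF assms(1) assms(2) assms(2), of 1] by simp

lemma act_scale:
  assumes "planar_tangle T" "xs @ [x] @ ys \<in> inputs A T" "xs @ [0] @ ys \<in> inputs A T"
  shows "act A T (xs @ [cscale A a x] @ ys) = cscale A a (act A T (xs @ [x] @ ys))"
  using act_multilinear[OF assms, of a] act_zero[OF assms(1,3)] by simp

lemma act_lin_1:
  assumes "planar_tangle T" "tl (discs T) = [c]" "x \<in> pbox A c" "y \<in> pbox A c"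
  shows "act A T [cscale A a x + y] = cscale A a (act A T [x]) + act A T [y]"
  using act_multilinear[OF assms(1), of "[]" x "[]" y a] assms by (simp add: inputs_iff)

lemma act_in_1: "planar_tangle T \<Longrightarrow> discs T = [d, c] \<Longrightarrow> x \<in> pbox A c \<Longrightarrow> act A T [x] \<in> pbox A d"
  using act_closed[of T "[x]"] by (simp add: inputs_iff)

lemma act_in_2: "planar_tangle T \<Longrightarrow> discs T = [d, b, c] \<Longrightarrow> x \<in> pbox A b \<Longrightarrow> y \<in> pbox A c \<Longrightarrow>
    act A T [x, y] \<in> pbox A d"
  using act_closed[of T "[x, y]"] by (simp add: inputs_iff)

lemma pmult_closed: "n \<le> 3 \<Longrightarrow> x \<in> pbox A (n, e) \<Longrightarrow> y \<in> pbox A (n, e) \<Longrightarrow> pmult A (n, e) x y \<in> pbox A (n, e)"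
  unfolding pmult_def by (rule act_in_2[OF planar_mult]) auto

lemma pmult_left: "n \<le> 3 \<Longrightarrow> x \<in> pbox A (n, e) \<Longrightarrow> y \<in> pbox A (n, e) \<Longrightarrow> z \<in> pbox A (n, e) \<Longrightarrow>
    pmult A (n, e) (cscale A a x + y) z = cscale A a (pmult A (n, e) x z) + pmult A (n, e) y z"
  unfolding pmult_def using act_multilinear[of "mult_tangle (n, e)" "[]" x "[z]" y a] by (simp add: inputs_iff planar_mult)

lemma pmult_right: "n \<le> 3 \<Longrightarrow> x \<in> pbox A (n, e) \<Longrightarrow> y \<in> pbox A (n, e) \<Longrightarrow> z \<in> pbox A (n, e) \<Longrightarrow>
    pmult A (n, e) z (cscale A a x + y) = cscale A a (pmult A (n, e) z x) + pmult A (n, e) z y"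
  unfolding pmult_def using act_multilinear[of "mult_tangle (n, e)" "[z]" x "[]" y a] by (simp add: inputs_iff planar_mult)

lemmas act_simps = inputs_iff planar_tangles pmult_def punit_def fourier_def

lemma punit_closed: "punit A (1, e) \<in> pbox A (1, e)" "punit A (2, e) \<in> pbox A (2, e)"
  using act_closed[of "unit_tangle (1, e)" "[]"] act_closed[of "unit_tangle (2, e)" "[]"]
  by (simp_all add: act_simps del: One_nat_def)

lemma empty_closed: "act A (empty_tangle e) [] \<in> pbox A (0, e)"
  using act_closed[of "empty_tangle e" "[]"] by (simp add: act_simps)

lemma pmult_assoc:
  assumes "x \<in> pbox A (2, e)" "y \<in> pbox A (2, e)" "z \<in> pbox A (2, e)"
  shows "pmult A (2, e) (pmult A (2, e) x y) z = pmult A (2, e) x (pmult A (2, e) y z)"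
  using assms act_glued[OF _ _ glued_mult_left[of e], of "[x, y]" "[]" "[z]"]
    act_glued[OF _ _ glued_mult_right[of e], of "[y, z]" "[x]" "[]"] pmult_closed[of 2, unfolded pmult_def]
  by (simp add: act_simps)

lemma pmult_unit:
  assumes "x \<in> pbox A (2, e)"
  shows "pmult A (2, e) (punit A (2, e)) x = x" "pmult A (2, e) x (punit A (2, e)) = x"
  using assms act_glued[OF _ _ glued_unit_left[of e], of "[]" "[]" "[x]"]
    act_glued[OF _ _ glued_unit_right[of e], of "[]" "[x]" "[]"] act_id[OF assms] punit_closed(2)[of e]
  by (simp_all add: act_simps)

lemma pmult_unit_1: "x \<in> pbox A (1, e) \<Longrightarrow> pmult A (1, e) (punit A (1, e)) x = x"
  using act_glued[OF _ _ glued_unit_left_1[of e], of "[]" "[]" "[x]"] act_id[of x "(1, e)"] punit_closed(1)[of e]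
  by (simp add: act_simps del: One_nat_def)

lemma pmult_empty: "x \<in> pbox A (0, e) \<Longrightarrow> pmult A (0, e) (act A (empty_tangle e) []) x = x"
  using act_glued[OF _ _ glued_unit_left_0[of e], of "[]" "[]" "[x]"] act_id[of x "(0, e)"] empty_closed[of e]
  by (simp add: act_simps)

lemma pmult_zero: "n \<le> 3 \<Longrightarrow> x \<in> pbox A (n, e) \<Longrightarrow> pmult A (n, e) 0 x = 0"
  using act_zero[of "mult_tangle (n, e)" "[]" "[x]"] by (simp add: inputs_iff pmult_def planar_mult)

lemma fourier_closed: "x \<in> pbox A (2, e) \<Longrightarrow> fourier A e x \<in> pbox A (2, \<not> e)"
  unfolding fourier_def by (rule act_in_1[of _ _ "(2, e)"]) (auto simp: planar_tangles)

lemma fourier_lin: "x \<in> pbox A (2, e) \<Longrightarrow> y \<in> pbox A (2, e) \<Longrightarrow>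
    fourier A e (cscale A a x + y) = cscale A a (fourier A e x) + fourier A e y"
  unfolding fourier_def by (rule act_lin_1[where c = "(2, e)"]) (auto simp: planar_tangles)

end

context subfactor_planar_algebra
begin

abbreviation empty_box :: "bool \<Rightarrow> 'a" where "empty_box e \<equiv> act A (empty_tangle e) []"

text \<open>
  Gluing the empty tangle into the product of $P_{0,\pm}$ gives the identity, so if it were zero, the whole space would
  vanish.
\<close>

lemma empty_nonzero: "empty_box e \<noteq> 0"
proof
  assume "empty_box e = 0"
  then have "x = 0" if "x \<in> pbox A (0, e)" for x
    using pmult_empty[OF that] pmult_zero[OF _ that] by simp
  moreover obtain B where "B \<subseteq> pbox A (0, e)" "vs.independent B" "card B = 1"
    using vs.basis_exists[of "pbox A (0, e)"] dim_0[of e] by metis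
  ultimately have "B \<subseteq> {0}" "0 \<notin> B" "B \<noteq> {}" using vs.dependent_zero by auto
  then show False by auto
qed

lemma scalar_scale: "scalar A e (cscale A a (empty_box e)) = a"
  unfolding scalar_def using empty_nonzero[of e] by (auto intro!: the_equality)

lemma scalar_eq: "v \<in> pbox A (0, e) \<Longrightarrow> v = cscale A (scalar A e v) (empty_box e)"
  using vs.dim_1_multiple[OF dim_0 empty_closed empty_nonzero, of v] scalar_scale by metis

lemma scalar_lin: "v \<in> pbox A (0, e) \<Longrightarrow> w \<in> pbox A (0, e) \<Longrightarrow>
    scalar A e (cscale A a v + w) = a * scalar A e v + scalar A e w"
  by (metis (no_types, lifting) scalar_eq scalar_scale vs.scale_left_distrib vs.scale_scale)

lemma tr_lin: "n \<le> 3 \<Longrightarrow> x \<in> pbox A (n, e) \<Longrightarrow> y \<in> pbox A (n, e) \<Longrightarrow>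
    tr A (n, e) (cscale A a x + y) = a * tr A (n, e) x + tr A (n, e) y"
  unfolding tr_def using act_lin_1[of "trace_tangle (n, e)" "(n, e)" x y a]
    act_in_1[of "trace_tangle (n, e)" "(0, e)" "(n, e)"] by (simp add: scalar_lin planar_trace)

lemma positive_form: "n \<le> 3 \<Longrightarrow> positive_form (cscale A) (pbox A (n, e))
    (\<lambda>x y. tr A (n, e) (pmult A (n, e) (star A (n, e) x) y))"
  using positive[of _ "(n, e)"] subspace[of "(n, e)"]
  by unfold_locales (auto simp: tr_lin pmult_left pmult_right pmult_closed star_closed star_conj_linear)

lemma tr_comm:
  assumes "x \<in> pbox A (2, e)" "y \<in> pbox A (2, e)"
  shows "tr A (2, e) (pmult A (2, e) x y) = tr A (2, e) (pmult A (2, e) y x)"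
proof -
  have t: "act A (trace_tangle (2, e)) [pmult A (2, e) x y] = act A (trace_mult e) [x, y]"
    if "x \<in> pbox A (2, e)" "y \<in> pbox A (2, e)" for x y
    using that act_glued[OF _ _ glued_trace_mult[of e], of "[x, y]" "[]" "[]"] pmult_closed[of 2 x e y]
    by (simp add: act_simps)
  have "act A (trace_mult e) [y, x] = act A (trace_mult e) [x, y]"
    by (rule act_isotopic[OF _ _ isotopic_trace_mult])
      (use assms in \<open>auto simp: act_simps less_Suc_eq\<close>)
  then show ?thesis using assms by (simp add: tr_def t)
qed

lemma star_pmult:
  assumes "x \<in> pbox A (2, e)" "y \<in> pbox A (2, e)"
  shows "star A (2, e) (pmult A (2, e) x y) = pmult A (2, e) (star A (2, e) y) (star A (2, e) x)"
proof -
  have "star A (2, e) (pmult A (2, e) x y) =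
      act A (reflect (mult_tangle (2, e))) [star A (2, e) x, star A (2, e) y]"
    using star_act[of "mult_tangle (2, e)" "[x, y]"] assms by (simp add: act_simps)
  also have "\<dots> = pmult A (2, e) (star A (2, e) y) (star A (2, e) x)"
    unfolding pmult_def
    by (rule act_isotopic[OF _ _ isotopic_reflect_mult, symmetric])
      (use assms in \<open>auto simp: act_simps star_closed less_Suc_eq\<close>)
  finally show ?thesis .
qed

text \<open>
  Associativity, the unit laws, the trace property and the rule for the star of a product come from relations
  between tangles; the other clauses are axioms or multilinearity.
\<close>

lemma two_box: "tracial_star_algebra (cscale A) (pbox A (2, e)) (pmult A (2, e)) (punit A (2, e))
    (star A (2, e)) (tr A (2, e))"
  using positive[of _ "(2, e)"] subspace[of "(2, e)"] finite_dim[of "(2, e)"]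
  by unfold_locales
    (auto simp: tr_lin pmult_left pmult_right pmult_closed punit_closed pmult_assoc pmult_unit star_closed
      star_star star_conj_linear star_pmult tr_comm)

end

section \<open>The Plancherel identity and the key inequality\<close>

context irreducible_subfactor_planar_algebra
begin

abbreviation strand :: "bool \<Rightarrow> 'a" where "strand e \<equiv> punit A (1, e)"

lemma strand_nonzero: "strand e \<noteq> 0"
proof
  assume "strand e = 0"
  then have "x = 0" if "x \<in> pbox A (1, e)" for x
    using pmult_unit_1[OF that] pmult_zero[of 1, OF _ that] by simp
  moreover obtain B where "B \<subseteq> pbox A (1, e)" "vs.independent B" "card B = 1"
    using vs.basis_exists[of "pbox A (1, e)"] dim_1[of e] by metis
  ultimately have "B \<subseteq> {0}" "0 \<notin> B" "B \<noteq> {}" using vs.dependent_zero by auto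
  then show False by auto
qed

lemma star_strand: "star A (1, e) (strand e) = strand e"
proof -
  have "star A (1, e) (strand e) = act A (reflect (unit_tangle (1, e))) []"
    using star_act[of "unit_tangle (1, e)" "[]"] by (simp add: act_simps del: One_nat_def)
  also have "\<dots> = strand e"
    unfolding punit_def
    by (rule act_isotopic[OF _ _ isotopic_reflect_unit_1, symmetric])
      (auto simp: act_simps simp del: One_nat_def)
  finally show ?thesis .
qed

text \<open>
  The loop has the same value for both shadings: sphericality closes the string to the side on which the outer
  region is unshaded.
\<close>

lemma tr_strand: "tr A (1, e) (strand e) = scalar A True (act A loop_tangle [])"
proof (cases e)
  case True
  then show ?thesis
    using act_glued[OF _ _ glued_loop, of "[]" "[]" "[]"] punit_closed(1)[of True]
    by (simp add: act_simps tr_def del: One_nat_def)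
next
  case False
  have "tr A (1, False) (strand False) = left_tr A False (strand False)"
    by (rule spherical[OF punit_closed(1), symmetric])
  also have "\<dots> = scalar A True (act A loop_tangle [])"
    using act_glued[OF _ _ glued_loop_left, of "[]" "[]" "[]"] punit_closed(1)[of False]
    by (simp add: act_simps left_tr_def del: One_nat_def)
  finally show ?thesis using False by simp
qed

lemma tr_strand_delta: "tr A (1, e) (strand e) = of_real (delta A)" and delta_pos: "0 < delta A"
proof -
  have "tr A (1, e) (strand e) \<in> \<real> \<and> 0 < Re (tr A (1, e) (strand e))" for e
    using positive[OF punit_closed(1) strand_nonzero, of e] pmult_unit_1[OF punit_closed(1)]
    by (simp add: star_strand del: One_nat_def)
  then show "tr A (1, e) (strand e) = of_real (delta A)" "0 < delta A"
    unfolding tr_strand delta_def by (auto simp: of_real_Re)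
qed

text \<open>
  Irreducibility: a 1-box is a multiple of the string, and the trace finds the factor.
\<close>

lemma pbox_1: "x \<in> pbox A (1, e) \<Longrightarrow> x = cscale A (tr A (1, e) x / delta A) (strand e)"
proof -
  assume "x \<in> pbox A (1, e)"
  then obtain a where a: "x = cscale A a (strand e)"
    using vs.dim_1_multiple[OF dim_1 punit_closed(1) strand_nonzero] by metis
  have "tr A (1, e) (cscale A a (strand e) + 0) = a * of_real (delta A) + tr A (1, e) 0"
    using tr_lin[OF _ punit_closed(1)[of e] zero_in, of a] tr_strand_delta[of e] by simp
  moreover have "tr A (1, e) 0 = 0" using tr_lin[of 1 0 e 0 1] by simp
  ultimately show ?thesis using a delta_pos by simp
qed

lemma right_closure:
  assumes "x \<in> pbox A (2, e)"
  shows "act A (right_closure e) [x] = cscale A (tr A (2, e) x / delta A) (strand e)"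
proof -
  have c: "act A (right_closure e) [x] \<in> pbox A (1, e)"
    by (rule act_in_1[of _ _ "(2, e)"]) (use assms in \<open>auto simp: planar_tangles\<close>)
  have "tr A (1, e) (act A (right_closure e) [x]) = tr A (2, e) x"
    using act_glued[OF _ _ glued_right_closure_trace[of e], of "[x]" "[]" "[]"] c assms
    by (simp add: act_simps tr_def del: One_nat_def)
  then show ?thesis using pbox_1[OF c] by simp
qed

text \<open>
  Sphericality for 2-boxes, obtained from the axiom for 1-boxes applied to the right partial trace.
\<close>

lemma side_trace:
  assumes "x \<in> pbox A (2, e)"
  shows "scalar A (\<not> e) (act A (side_trace e) [x]) = tr A (2, e) x"
proof -
  have c: "act A (right_closure e) [x] \<in> pbox A (1, e)"
    by (rule act_in_1[of _ _ "(2, e)"]) (use assms in \<open>auto simp: planar_tangles\<close>)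
  have "tr A (2, e) x = tr A (1, e) (act A (right_closure e) [x])"
    using act_glued[OF _ _ glued_right_closure_trace[of e], of "[x]" "[]" "[]"] c assms
    by (simp add: act_simps tr_def del: One_nat_def)
  also have "\<dots> = left_tr A e (act A (right_closure e) [x])" by (rule spherical[OF c, symmetric])
  also have "\<dots> = scalar A (\<not> e) (act A (side_trace e) [x])"
    using act_glued[OF _ _ glued_right_closure_side_trace[of e], of "[x]" "[]" "[]"] c assms
    by (simp add: act_simps left_tr_def del: One_nat_def)
  finally show ?thesis by simp
qed

lemma left_closure:
  assumes "x \<in> pbox A (2, e)"
  shows "act A (left_closure e) [x] = cscale A (tr A (2, e) x / delta A) (strand (\<not> e))"
proof -
  have c: "act A (left_closure e) [x] \<in> pbox A (1, \<not> e)"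
    by (rule act_in_1[of _ _ "(2, e)"]) (use assms in \<open>auto simp: planar_tangles\<close>)
  have "tr A (1, \<not> e) (act A (left_closure e) [x]) = scalar A (\<not> e) (act A (side_trace e) [x])"
    using act_glued[OF _ _ glued_left_closure_trace[of e], of "[x]" "[]" "[]"] c assms
    by (simp add: act_simps tr_def del: One_nat_def)
  then show ?thesis using pbox_1[OF c] side_trace[OF assms] by simp
qed

text \<open>
  The right partial trace of the unit is a string with a loop next to it, and this loop is the trace of the
  string of the opposite shading.
\<close>

lemma tr_unit: "tr A (2, e) (punit A (2, e)) = of_real ((delta A)\<^sup>2)"
proof -
  have t: "act A (trace_tangle (1, \<not> e)) [strand (\<not> e)] = cscale A (delta A) (empty_box (\<not> e))"
    using scalar_eq[of "act A (trace_tangle (1, \<not> e)) [strand (\<not> e)]" "\<not> e"] tr_strand_delta[of "\<not> e"]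
      act_in_1[of "trace_tangle (1, \<not> e)" "(0, \<not> e)" "(1, \<not> e)" "strand (\<not> e)"] punit_closed(1)[of "\<not> e"]
    by (simp add: tr_def planar_tangles del: One_nat_def)
  have u: "act A (string_disc e) [empty_box (\<not> e)] = strand e"
    using act_glued[OF _ _ glued_string_empty[of e], of "[]" "[]" "[]"] empty_closed[of "\<not> e"]
    by (simp add: act_simps del: One_nat_def)
  have "act A (right_closure e) [punit A (2, e)] = act A (string_loop e) []"
    using act_glued[OF _ _ glued_right_closure_unit[of e], of "[]" "[]" "[]"] punit_closed(2)[of e]
    by (simp add: act_simps del: One_nat_def)
  also have "\<dots> = act A (string_trace e) [strand (\<not> e)]"
    using act_glued[OF _ _ glued_string_loop[of e], of "[]" "[]" "[]"] punit_closed(1)[of "\<not> e"]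
    by (simp add: act_simps del: One_nat_def)
  also have "\<dots> = act A (string_disc e) [act A (trace_tangle (1, \<not> e)) [strand (\<not> e)]]"
    using act_glued[OF _ _ glued_string_trace[of e], of "[strand (\<not> e)]" "[]" "[]"] punit_closed(1)[of "\<not> e"]
      act_in_1[of "trace_tangle (1, \<not> e)" "(0, \<not> e)" "(1, \<not> e)" "strand (\<not> e)"]
    by (simp add: act_simps del: One_nat_def)
  also have "\<dots> = cscale A (delta A) (strand e)"
    unfolding t using act_scale[of "string_disc e" "[]" "empty_box (\<not> e)" "[]"] empty_closed[of "\<not> e"] u
    by (simp add: act_simps del: One_nat_def)
  finally have "cscale A (tr A (2, e) (punit A (2, e)) / delta A) (strand e) = cscale A (delta A) (strand e)"
    using right_closure[OF punit_closed(2)] by simp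
  then have "tr A (2, e) (punit A (2, e)) / delta A = delta A" using strand_nonzero by simp
  then show ?thesis using delta_pos by (simp add: field_simps power2_eq_square)
qed

lemma act_trace_mult:
  "x \<in> pbox A (2, e) \<Longrightarrow> y \<in> pbox A (2, e) \<Longrightarrow>
    scalar A e (act A (trace_mult e) [x, y]) = tr A (2, e) (pmult A (2, e) x y)"
  using act_glued[OF _ _ glued_trace_mult[of e], of "[x, y]" "[]" "[]"] pmult_closed[of 2 x e y]
  by (simp add: act_simps tr_def)

text \<open>
  Since $\mathfrak{F}_s(x)^*$ is the opposite rotation of $x^*$, the rotations cancel in the trace of the product, except that
  the outer region becomes a neighbouring one; \<open>side_trace\<close> moves it back.
\<close>

lemma plancherel:
  assumes "x \<in> pbox A (2, e)" "y \<in> pbox A (2, e)"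
  shows "tr A (2, \<not> e) (pmult A (2, \<not> e) (star A (2, \<not> e) (fourier A e x)) (fourier A e y)) =
    tr A (2, e) (pmult A (2, e) (star A (2, e) x) y)"
proof -
  let ?x = "star A (2, e) x"
  have x: "?x \<in> pbox A (2, e)" using assms by (simp add: star_closed)
  have s: "star A (2, \<not> e) (fourier A e x) = act A (reflect (fourier_tangle e)) [?x]"
    using star_act[of "fourier_tangle e" "[x]"] assms by (simp add: act_simps)
  have c: "act A (reflect (fourier_tangle e)) [?x] \<in> pbox A (2, \<not> e)" "fourier A e y \<in> pbox A (2, \<not> e)"
    using s star_closed[OF fourier_closed[OF assms(1)]] fourier_closed[OF assms(2)] by auto
  have "tr A (2, \<not> e) (pmult A (2, \<not> e) (act A (reflect (fourier_tangle e)) [?x]) (fourier A e y)) =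
    scalar A (\<not> e) (act A (trace_mult (\<not> e)) [act A (reflect (fourier_tangle e)) [?x], fourier A e y])"
    using c by (simp add: act_trace_mult)
  also have "act A (trace_mult (\<not> e)) [act A (reflect (fourier_tangle e)) [?x], fourier A e y] =
      act A (half_rotated e) [?x, fourier A e y]"
    using act_glued[OF _ _ glued_half_rotated[of e], of "[?x]" "[]" "[fourier A e y]"] c x
    by (simp add: inputs_iff planar_tangles)
  also have "\<dots> = act A (side_trace_mult e) [?x, y]"
    using act_glued[OF _ _ glued_rotated[of e], of "[y]" "[?x]" "[]"] c x assms
    by (simp add: inputs_iff planar_tangles fourier_def)
  also have "\<dots> = act A (side_trace e) [pmult A (2, e) ?x y]"
    using act_glued[OF _ _ glued_side_trace_mult[of e], of "[?x, y]" "[]" "[]"] x assms pmult_closed[of 2 ?x e y]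
    by (simp add: act_simps)
  also have "scalar A (\<not> e) \<dots> = tr A (2, e) (pmult A (2, e) ?x y)"
    by (rule side_trace) (use pmult_closed x assms in auto)
  finally show ?thesis unfolding s .
qed

definition norm_sq :: "bool \<Rightarrow> 'a \<Rightarrow> real" where
  "norm_sq e x = Re (tr A (2, e) (pmult A (2, e) (star A (2, e) x) x))"

lemma norm_sq_eq: "x \<in> pbox A (2, e) \<Longrightarrow> tr A (2, e) (pmult A (2, e) (star A (2, e) x) x) = of_real (norm_sq e x)"
  unfolding norm_sq_def by (rule conjunct1[OF tracial_star_algebra.tr_nonneg[OF two_box]])

lemma norm_sq_eq': "x \<in> pbox A (2, e) \<Longrightarrow> tr A (2, e) (pmult A (2, e) x (star A (2, e) x)) = of_real (norm_sq e x)"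
  using norm_sq_eq[of x e] tr_comm[of x e "star A (2, e) x"] star_closed[of x "(2, e)"] by simp

lemma tr_3:
  assumes "\<xi> \<in> pbox A (3, e)" "\<eta> \<in> pbox A (3, e)"
  shows "tr A (3, e) (pmult A (3, e) \<xi> \<eta>) = scalar A e (act A (trace_mult_3 e) [\<xi>, \<eta>])"
  using assms act_glued[OF _ _ glued_trace_mult_3[of e], of "[\<xi>, \<eta>]" "[]" "[]"] pmult_closed[of 3 \<xi> e \<eta>]
  by (simp add: act_simps tr_def)

text \<open>
  The Cauchy--Schwarz inequality in the 3-box space for the halves \<open>\<xi>\<close> and \<open>\<eta>\<close> of the network.  In the norm of \<open>\<xi>\<close> the
  2-boxes \<open>a\<close> and $a^*$ form a left partial trace, in that of \<open>\<eta>\<close> the 2-boxes $b^*$ and \<open>b\<close> form a right one.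
  Once this partial trace has been replaced by a multiple of a string, the remaining two 2-boxes are connected as
  in the trace of a product.
\<close>

lemma key_inequality:
  assumes a: "a \<in> pbox A (2, e)" and b: "b \<in> pbox A (2, e)"
    and c: "c \<in> pbox A (2, \<not> e)" and d: "d \<in> pbox A (2, \<not> e)"
  shows "(norm (tr A (2, \<not> e) (pmult A (2, \<not> e) (pmult A (2, \<not> e) c d) (fourier A e (pmult A (2, e) a b)))))\<^sup>2
    \<le> (norm_sq e a * norm_sq (\<not> e) c / delta A) * (norm_sq e b * norm_sq (\<not> e) d / delta A)"
proof -
  define \<xi> where "\<xi> = act A (bridge e) [c, a]"
  define \<eta> where "\<eta> = act A (cobridge e) [b, d]"
  define \<xi>' where "\<xi>' = star A (3, \<not> e) \<xi>"
  define \<eta>' where "\<eta>' = star A (3, \<not> e) \<eta>"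
  let ?s = "star A (2, e)" and ?t = "star A (2, \<not> e)"
  have st: "?s a \<in> pbox A (2, e)" "?s b \<in> pbox A (2, e)" "?t c \<in> pbox A (2, \<not> e)" "?t d \<in> pbox A (2, \<not> e)"
    using a b c d by (auto simp: star_closed)
  have \<xi>: "\<xi> \<in> pbox A (3, \<not> e)" unfolding \<xi>_def
    by (rule act_in_2) (use a c in \<open>auto simp: planar_tangles\<close>)
  have \<eta>: "\<eta> \<in> pbox A (3, \<not> e)" unfolding \<eta>_def
    by (rule act_in_2) (use b d in \<open>auto simp: planar_tangles\<close>)
  have \<xi>': "\<xi>' \<in> pbox A (3, \<not> e)" and \<eta>': "\<eta>' \<in> pbox A (3, \<not> e)"
    using \<xi> \<eta> by (auto simp: \<xi>'_def \<eta>'_def star_closed)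
  have \<xi>'_eq: "\<xi>' = act A (bridge_star e) [?s a, ?t c]"
  proof -
    have "\<xi>' = act A (reflect (bridge e)) [?t c, ?s a]"
      using star_act[of "bridge e" "[c, a]"] a c by (simp add: \<xi>'_def \<xi>_def act_simps)
    also have "\<dots> = act A (bridge_star e) [?s a, ?t c]"
      by (rule act_isotopic[OF _ _ isotopic_reflect_bridge, symmetric])
        (use st in \<open>auto simp: act_simps less_Suc_eq\<close>)
    finally show ?thesis .
  qed
  have \<eta>'_eq: "\<eta>' = act A (cobridge_star e) [?t d, ?s b]"
  proof -
    have "\<eta>' = act A (reflect (cobridge e)) [?s b, ?t d]"
      using star_act[of "cobridge e" "[b, d]"] b d by (simp add: \<eta>'_def \<eta>_def act_simps)
    also have "\<dots> = act A (cobridge_star e) [?t d, ?s b]"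
      by (rule act_isotopic[OF _ _ isotopic_reflect_cobridge, symmetric])
        (use st in \<open>auto simp: act_simps less_Suc_eq\<close>)
    finally show ?thesis .
  qed
  have bridge_3: "act A (trace_mult_3 (\<not> e)) [\<xi>, z] = act A (bridge_3 e) [c, a, z]" if "z \<in> pbox A (3, \<not> e)" for z
    using act_glued[OF _ _ glued_bridge_3[of e], of "[c, a]" "[]" "[z]"] a c \<xi> that
    by (simp add: inputs_iff planar_tangles \<xi>_def)
  have F: "fourier A e (pmult A (2, e) a b) = act A (fourier_mult e) [a, b]"
    using act_glued[OF _ _ glued_fourier_mult[of e], of "[a, b]" "[]" "[]"] a b pmult_closed[of 2 a e b]
    by (simp add: act_simps)
  have "tr A (2, \<not> e) (pmult A (2, \<not> e) (pmult A (2, \<not> e) c d) (fourier A e (pmult A (2, e) a b))) =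
    scalar A (\<not> e) (act A (trace_mult (\<not> e)) [pmult A (2, \<not> e) c d, fourier A e (pmult A (2, e) a b)])"
    using a b c d by (simp add: act_trace_mult pmult_closed fourier_closed)
  also have "act A (trace_mult (\<not> e)) [pmult A (2, \<not> e) c d, fourier A e (pmult A (2, e) a b)] =
    act A (trace_mult3 (\<not> e)) [c, d, fourier A e (pmult A (2, e) a b)]"
    using act_glued[OF _ _ glued_trace_mult3[of "\<not> e"], of "[c, d]" "[]" "[fourier A e (pmult A (2, e) a b)]"]
      a b c d pmult_closed[of 2 c "\<not> e" d] fourier_closed[OF pmult_closed[of 2 a e b]]
    by (simp add: inputs_iff planar_tangles pmult_def)
  also have "act A (trace_mult3 (\<not> e)) [c, d, fourier A e (pmult A (2, e) a b)] =
      act A (trace_mult_fourier_mult e) [c, d, a, b]"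
    unfolding F using act_glued[OF _ _ glued_trace_mult_fourier_mult[of e], of "[a, b]" "[c, d]" "[]"] a b c d
      act_in_2[of "fourier_mult e" "(2, \<not> e)" "(2, e)" "(2, e)" a b]
    by (simp add: act_simps)
  also have "\<dots> = act A (bridge_cobridge e) [c, a, b, d]"
    by (rule act_isotopic[OF _ _ isotopic_bridge_cobridge])
      (use a b c d in \<open>auto simp: act_simps less_Suc_eq\<close>)
  also have "\<dots> = act A (bridge_3 e) [c, a, \<eta>]"
    using act_glued[OF _ _ glued_bridge_cobridge[of e], of "[b, d]" "[c, a]" "[]"] a b c d \<eta>
    by (simp add: inputs_iff planar_tangles \<eta>_def)
  also have "\<dots> = act A (trace_mult_3 (\<not> e)) [\<xi>, \<eta>]" by (rule bridge_3[OF \<eta>, symmetric])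
  also have "scalar A (\<not> e) \<dots> = tr A (3, \<not> e) (pmult A (3, \<not> e) (star A (3, \<not> e) \<xi>') \<eta>)"
    using tr_3[OF \<xi> \<eta>] star_star[OF \<xi>] by (simp add: \<xi>'_def)
  finally have main: "tr A (2, \<not> e) (pmult A (2, \<not> e) (pmult A (2, \<not> e) c d) (fourier A e (pmult A (2, e) a b))) =
      tr A (3, \<not> e) (pmult A (3, \<not> e) (star A (3, \<not> e) \<xi>') \<eta>)" .
  \<comment> \<open>squared norm of the first half: $a a^*$ collapses to a string\<close>
  have n\<xi>: "Re (tr A (3, \<not> e) (pmult A (3, \<not> e) (star A (3, \<not> e) \<xi>') \<xi>')) = norm_sq e a * norm_sq (\<not> e) c / delta A"
  proof -
    have lc: "act A (left_closure_mult e) [a, ?s a] = cscale A (norm_sq e a / delta A) (strand (\<not> e))"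
      using act_glued[OF _ _ glued_left_closure_mult[of e], of "[a, ?s a]" "[]" "[]"] a st
        pmult_closed[of 2 a e "?s a"] left_closure[of "pmult A (2, e) a (?s a)" e] norm_sq_eq'[OF a]
      by (simp add: inputs_iff planar_tangles pmult_def)
    have "tr A (3, \<not> e) (pmult A (3, \<not> e) (star A (3, \<not> e) \<xi>') \<xi>') =
      scalar A (\<not> e) (act A (bridge_3 e) [c, a, \<xi>'])"
      using tr_3[OF \<xi> \<xi>'] bridge_3[OF \<xi>'] star_star[OF \<xi>] by (simp add: \<xi>'_def)
    also have "act A (bridge_3 e) [c, a, \<xi>'] = act A (bridge_bridge e) [c, a, ?s a, ?t c]"
      using act_glued[OF _ _ glued_bridge_bridge[of e], of "[?s a, ?t c]" "[c, a]" "[]"] a c st \<xi>'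
      by (simp add: inputs_iff planar_tangles \<xi>'_eq)
    also have "\<dots> = act A (left_insert e) [c, act A (left_closure_mult e) [a, ?s a], ?t c]"
      using act_glued[OF _ _ glued_left_insert[of e], of "[a, ?s a]" "[c]" "[?t c]"] a c st
        act_in_2[of "left_closure_mult e" "(1, \<not> e)" "(2, e)" "(2, e)" a "?s a"]
      by (simp add: inputs_iff planar_tangles del: One_nat_def)
    also have "\<dots> = cscale A (norm_sq e a / delta A) (act A (left_insert e) [c, strand (\<not> e), ?t c])"
      unfolding lc using act_scale[of "left_insert e" "[c]" "strand (\<not> e)" "[?t c]"] c st punit_closed(1)[of "\<not> e"]
      by (simp add: inputs_iff planar_tangles del: One_nat_def)
    also have "act A (left_insert e) [c, strand (\<not> e), ?t c] = act A (trace_mult (\<not> e)) [c, ?t c]"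
      using act_glued[OF _ _ glued_left_insert_unit[of e], of "[]" "[c]" "[?t c]"] c st punit_closed(1)[of "\<not> e"]
      by (simp add: inputs_iff planar_tangles punit_def del: One_nat_def)
    finally have "tr A (3, \<not> e) (pmult A (3, \<not> e) (star A (3, \<not> e) \<xi>') \<xi>') =
      scalar A (\<not> e) (cscale A (norm_sq e a / delta A) (act A (trace_mult (\<not> e)) [c, ?t c]) + 0)" by simp
    also have "\<dots> = norm_sq e a / delta A * scalar A (\<not> e) (act A (trace_mult (\<not> e)) [c, ?t c]) + scalar A (\<not> e) 0"
      by (rule scalar_lin[OF act_in_2]) (use c st in \<open>auto simp: planar_tangles\<close>)
    also have "scalar A (\<not> e) 0 = 0" using scalar_scale[of "\<not> e" 0] by simp
    finally show ?thesis using act_trace_mult[OF c st(3)] norm_sq_eq'[OF c] by simp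
  qed
  \<comment> \<open>squared norm of the second half: $b^* b$ collapses to a string\<close>
  have n\<eta>: "Re (tr A (3, \<not> e) (pmult A (3, \<not> e) (star A (3, \<not> e) \<eta>) \<eta>)) = norm_sq e b * norm_sq (\<not> e) d / delta A"
  proof -
    have rc: "act A (right_closure_mult e) [?s b, b] = cscale A (norm_sq e b / delta A) (strand e)"
      using act_glued[OF _ _ glued_right_closure_mult[of e], of "[?s b, b]" "[]" "[]"] b st
        pmult_closed[of 2 "?s b" e b] right_closure[of "pmult A (2, e) (?s b) b" e] norm_sq_eq[OF b]
      by (simp add: inputs_iff planar_tangles pmult_def)
    have "tr A (3, \<not> e) (pmult A (3, \<not> e) \<eta>' \<eta>) = scalar A (\<not> e) (act A (trace_mult_3 (\<not> e)) [\<eta>', \<eta>])"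
      by (rule tr_3[OF \<eta>' \<eta>])
    also have "act A (trace_mult_3 (\<not> e)) [\<eta>', \<eta>] = act A (three_cobridge e) [\<eta>', b, d]"
      using act_glued[OF _ _ glued_three_cobridge[of e], of "[b, d]" "[\<eta>']" "[]"] b d \<eta>' \<eta>
      by (simp add: inputs_iff planar_tangles \<eta>_def)
    also have "\<dots> = act A (cobridge_cobridge e) [?t d, ?s b, b, d]"
      using act_glued[OF _ _ glued_cobridge_cobridge[of e], of "[?t d, ?s b]" "[]" "[b, d]"] b d st \<eta>'
      by (simp add: inputs_iff planar_tangles \<eta>'_eq)
    also have "\<dots> = act A (right_insert e) [?t d, act A (right_closure_mult e) [?s b, b], d]"
      using act_glued[OF _ _ glued_right_insert[of e], of "[?s b, b]" "[?t d]" "[d]"] b d st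
        act_in_2[of "right_closure_mult e" "(1, e)" "(2, e)" "(2, e)" "?s b" b]
      by (simp add: inputs_iff planar_tangles del: One_nat_def)
    also have "\<dots> = cscale A (norm_sq e b / delta A) (act A (right_insert e) [?t d, strand e, d])"
      unfolding rc using act_scale[of "right_insert e" "[?t d]" "strand e" "[d]"] d st punit_closed(1)[of e]
      by (simp add: inputs_iff planar_tangles del: One_nat_def)
    also have "act A (right_insert e) [?t d, strand e, d] = act A (trace_mult (\<not> e)) [?t d, d]"
      using act_glued[OF _ _ glued_right_insert_unit[of e], of "[]" "[?t d]" "[d]"] d st punit_closed(1)[of e]
      by (simp add: inputs_iff planar_tangles punit_def del: One_nat_def)
    finally have "tr A (3, \<not> e) (pmult A (3, \<not> e) \<eta>' \<eta>) =
      scalar A (\<not> e) (cscale A (norm_sq e b / delta A) (act A (trace_mult (\<not> e)) [?t d, d]) + 0)" by simp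
    also have "\<dots> = norm_sq e b / delta A * scalar A (\<not> e) (act A (trace_mult (\<not> e)) [?t d, d]) + scalar A (\<not> e) 0"
      by (rule scalar_lin[OF act_in_2]) (use d st in \<open>auto simp: planar_tangles\<close>)
    also have "scalar A (\<not> e) 0 = 0" using scalar_scale[of "\<not> e" 0] by simp
    finally show ?thesis using act_trace_mult[OF st(4) d] norm_sq_eq[OF d] by (simp add: \<eta>'_def)
  qed
  show ?thesis
    unfolding main n\<xi>[symmetric] n\<eta>[symmetric]
    by (rule positive_form.cauchy_schwarz[OF positive_form]) (use \<xi>' \<eta> in auto)
qed

end

section \<open>Entropies and the Fourier transform as a matrix\<close>

context irreducible_subfactor_planar_algebra
begin

interpretation T: tracial_star_algebra "cscale A" "pbox A (2, e)" "pmult A (2, e)" "punit A (2, e)"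
    "star A (2, e)" "tr A (2, e)" for e
  by (rule two_box)

lemma spectral_decomp_iff: "spectral_decomp A (2, e) = T.spectral e"
  by (simp add: fun_eq_iff spectral_decomp_def T.spectral_def)

lemma fcalc_eq:
  assumes "T.spectral e a \<Lambda> P"
  shows "fcalc A (2, e) f a = (\<Sum>t\<in>\<Lambda>. cscale A (of_real (f t)) (P t))"
  unfolding fcalc_def spectral_decomp_iff
  by (rule the_equality) (use assms T.spectral_unique[OF _ assms] in blast)+

lemma fcalc_comp:
  assumes S: "T.spectral e a \<Lambda> P" and g: "inj_on g \<Lambda>"
  shows "fcalc A (2, e) f (\<Sum>t\<in>\<Lambda>. cscale A (of_real (g t)) (P t)) =
    (\<Sum>t\<in>\<Lambda>. cscale A (of_real (f (g t))) (P t))"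
  unfolding fcalc_eq[OF T.spectral_image[OF S g]] sum.reindex[OF g] using g by (intro sum.cong) auto

text \<open>
  The weights of the finite $\ell^p$ spaces: traces of spectral projections.
\<close>

definition weight :: "bool \<Rightarrow> (real \<Rightarrow> 'a) \<Rightarrow> real \<Rightarrow> real" where
  "weight e P t = Re (tr A (2, e) (P t))"

context
  fixes e :: bool and x :: 'a and \<Lambda> :: "real set" and P :: "real \<Rightarrow> 'a"
  assumes x: "x \<in> pbox A (2, e)"
    and S: "T.spectral e (pmult A (2, e) (star A (2, e) x) x) \<Lambda> P"
begin

lemma spectrum: "finite \<Lambda>" "\<And>t. t \<in> \<Lambda> \<Longrightarrow> P t \<in> pbox A (2, e)" "\<And>t. t \<in> \<Lambda> \<Longrightarrow> 0 \<le> t"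
  using S T.spectral_nonneg[OF x S] unfolding T.spectral_def by blast+

lemma weight: "t \<in> \<Lambda> \<Longrightarrow> tr A (2, e) (P t) = of_real (weight e P t)" "t \<in> \<Lambda> \<Longrightarrow> 0 < weight e P t"
  using S T.tr_projection[of "P t" e] unfolding T.spectral_def weight_def by blast+

lemma tr_fcalc: "Re (tr A (2, e) (\<Sum>t\<in>\<Lambda>. cscale A (of_real (f t)) (P t))) = (\<Sum>t\<in>\<Lambda>. f t * weight e P t)"
  using spectrum by (subst T.tr_sum) (auto simp: T.tr_scale T.scale_closed weight)

lemma weight_total: "sum (weight e P) \<Lambda> = (delta A)\<^sup>2"
proof -
  have "tr A (2, e) (sum P \<Lambda>) = of_real ((delta A)\<^sup>2)" using S tr_unit unfolding T.spectral_def by simp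
  then have "Re (tr A (2, e) (sum P \<Lambda>)) = (delta A)\<^sup>2" by simp
  then show ?thesis using tr_fcalc[of "\<lambda>_. 1"] by simp
qed

lemma absval_eq: "absval A (2, e) x = (\<Sum>t\<in>\<Lambda>. cscale A (of_real (sqrt t)) (P t))"
  unfolding absval_def by (rule fcalc_eq[OF S])

lemma absval_sq: "pmult A (2, e) (absval A (2, e) x) (absval A (2, e) x) = pmult A (2, e) (star A (2, e) x) x"
proof -
  have "pmult A (2, e) (absval A (2, e) x) (absval A (2, e) x) =
      (\<Sum>t\<in>\<Lambda>. cscale A (of_real (sqrt t) * of_real (sqrt t)) (P t))"
    unfolding absval_eq by (rule T.spectral_mul_sums[OF S])
  also have "\<dots> = (\<Sum>t\<in>\<Lambda>. cscale A (of_real t) (P t))"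
    using spectrum by (intro sum.cong) (auto simp flip: of_real_mult)
  finally show ?thesis using S unfolding T.spectral_def by simp
qed

lemma pnorm_2: "pnorm A (2, e) 2 x = sqrt (\<Sum>t\<in>\<Lambda>. t * weight e P t)"
proof -
  have i: "inj_on sqrt \<Lambda>" by (auto intro: inj_onI)
  have "fcalc A (2, e) (\<lambda>t. t powr 2) (absval A (2, e) x) =
      (\<Sum>t\<in>\<Lambda>. cscale A (of_real (sqrt t powr 2)) (P t))"
    unfolding absval_eq by (rule fcalc_comp[OF S i])
  also have "\<dots> = (\<Sum>t\<in>\<Lambda>. cscale A (of_real t) (P t))"
    using spectrum by (intro sum.cong) auto
  finally have "Re (tr A (2, e) (fcalc A (2, e) (\<lambda>t. t powr 2) (absval A (2, e) x))) = (\<Sum>t\<in>\<Lambda>. t * weight e P t)"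
    by (simp add: tr_fcalc)
  moreover have "0 \<le> (\<Sum>t\<in>\<Lambda>. t * weight e P t)"
    using spectrum weight by (intro sum_nonneg) (auto simp: less_imp_le)
  ultimately show ?thesis by (simp add: pnorm_def powr_half_sqrt)
qed

text \<open>
  The element $x^* x$ is its own absolute value: its square has the eigenvalues $t^2$, which are distinct for
  distinct $t$ as $t \ge 0$.
\<close>

lemma pnorm_sq: "pnorm A (2, e) r (pmult A (2, e) (star A (2, e) x) x) = (\<Sum>t\<in>\<Lambda>. t powr r * weight e P t) powr (1 / r)"
proof -
  let ?a = "pmult A (2, e) (star A (2, e) x) x"
  have a: "?a = (\<Sum>t\<in>\<Lambda>. cscale A (of_real t) (P t))" using S unfolding T.spectral_def by simp
  have i: "inj_on (\<lambda>t. t\<^sup>2) \<Lambda>" using spectrum by (auto intro!: inj_onI)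
  have "star A (2, e) ?a = ?a" unfolding a by (rule T.spectral_star_sum[OF S])
  then have "pmult A (2, e) (star A (2, e) ?a) ?a = (\<Sum>t\<in>\<Lambda>. cscale A (of_real (t\<^sup>2)) (P t))"
    using T.spectral_mul_sums[OF S, of "\<lambda>t. of_real t" "\<lambda>t. of_real t"] a by (simp add: power2_eq_square)
  then have "absval A (2, e) ?a = (\<Sum>t\<in>\<Lambda>. cscale A (of_real (sqrt (t\<^sup>2))) (P t))"
    unfolding absval_def using fcalc_comp[OF S i] by simp
  also have "\<dots> = ?a" unfolding a using spectrum by (intro sum.cong) auto
  finally have "absval A (2, e) ?a = ?a" .
  then show ?thesis unfolding pnorm_def by (simp add: fcalc_eq[OF S] tr_fcalc)
qed

text \<open>
  The coefficient $1/p - 1/2$ turns the entropy into the logarithm of $\|x\|_p$.  At $p = 2$ both sides vanish, the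
  right one because $\|x\|_2 = 1$.  The eigenvalue 0 contributes to neither side.
\<close>

lemma entropy_term:
  assumes 1: "pnorm A (2, e) 2 x = 1" and p: "0 < p"
  shows "(1 / p - 1 / 2) * renyi_entropy A (2, e) (p / 2) (pmult A (2, e) (absval A (2, e) x) (absval A (2, e) x)) =
    ln (\<Sum>t\<in>{t \<in> \<Lambda>. 0 < t}. weight e P t * sqrt t powr p) / p"
    and "(\<Sum>t\<in>{t \<in> \<Lambda>. 0 < t}. weight e P t * (sqrt t)\<^sup>2) = 1"
proof -
  let ?I = "{t \<in> \<Lambda>. 0 < t}"
  let ?S = "\<Sum>t\<in>?I. weight e P t * sqrt t powr p"
  have "(\<Sum>t\<in>\<Lambda>. t * weight e P t) = 1" using 1 unfolding pnorm_2 by simp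
  moreover have "(\<Sum>t\<in>\<Lambda>. t * weight e P t) = (\<Sum>t\<in>?I. weight e P t * (sqrt t)\<^sup>2)"
    using spectrum by (intro sum.mono_neutral_cong_right) (auto simp: order.order_iff_strict)
  ultimately show two: "(\<Sum>t\<in>?I. weight e P t * (sqrt t)\<^sup>2) = 1" by simp
  have sp: "t powr (p / 2) = sqrt t powr p" if "0 < t" for t
    using that by (simp add: powr_half_sqrt[symmetric] powr_powr)
  have s: "(\<Sum>t\<in>\<Lambda>. t powr (p / 2) * weight e P t) = ?S"
    using spectrum p by (intro sum.mono_neutral_cong_right) (auto simp: order.order_iff_strict sp)
  have "?I \<noteq> {}" using two by force
  then have S0: "0 < ?S" using spectrum weight by (intro weighted_sum_pos) auto
  show "(1 / p - 1 / 2) * renyi_entropy A (2, e) (p / 2) (pmult A (2, e) (absval A (2, e) x) (absval A (2, e) x)) = ln ?S / p"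
  proof (cases "p = 2")
    case True
    have "?S = 1" unfolding two[symmetric] using True by (intro sum.cong) auto
    then show ?thesis using True by simp
  next
    case False
    have "renyi_entropy A (2, e) (p / 2) (pmult A (2, e) (absval A (2, e) x) (absval A (2, e) x)) =
        (p / 2) / (1 - p / 2) * ((2 / p) * ln ?S)"
      using False p S0 unfolding renyi_entropy_def absval_sq pnorm_sq s by (simp add: ln_powr)
    then show ?thesis using False p by (simp add: field_simps)
  qed
qed

end

lemma fourier_0: "fourier A e 0 = 0"
  using fourier_lin[of 0 e 0 1] by simp

lemma fourier_sum:
  "(\<And>i. i \<in> I \<Longrightarrow> f i \<in> pbox A (2, e)) \<Longrightarrow>
    fourier A e (\<Sum>i\<in>I. cscale A (c i) (f i)) = (\<Sum>i\<in>I. cscale A (c i) (fourier A e (f i)))"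
  by (induction I rule: infinite_finite_induct)
    (auto simp: fourier_0 fourier_lin T.sum_closed T.scale_closed)

lemma tr_polar:
  assumes y: "y \<in> pbox A (2, e)" and S: "T.spectral e (pmult A (2, e) (star A (2, e) y) y) \<Lambda> Q"
    and j: "j \<in> \<Lambda>" "0 < j"
  shows "tr A (2, e) (pmult A (2, e) (star A (2, e) (cscale A (of_real (1 / sqrt j)) (pmult A (2, e) y (Q j)))) y) =
    of_real (sqrt j * weight e Q j)"
  using T.polar(5)[OF y S, of j] j spectrum(2)[OF y S] weight(1)[OF y S] by (simp add: T.tr_scale)

text \<open>
  The key inequality with $u = u p$ and $v^* = q v^*$; as \<open>u\<close> and \<open>p\<close> have the same 2-norm, and so have \<open>v\<close> and \<open>q\<close>, the
  square roots disappear.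
\<close>

lemma partial_isometries_bound:
  assumes u: "u \<in> pbox A (2, e)" and p: "p \<in> pbox A (2, e)" "pmult A (2, e) u p = u"
      "norm_sq e u = w" "norm_sq e p = w" "0 \<le> w"
    and v: "v \<in> pbox A (2, \<not> e)" and q: "q \<in> pbox A (2, \<not> e)" "star A (2, \<not> e) q = q" "pmult A (2, \<not> e) v q = v"
      "norm_sq (\<not> e) v = w'" "norm_sq (\<not> e) q = w'" "0 \<le> w'"
  shows "norm (tr A (2, \<not> e) (pmult A (2, \<not> e) (star A (2, \<not> e) v) (fourier A e u))) \<le> 1 / delta A * w * w'"
proof (rule power2_le_imp_le)
  let ?v = "star A (2, \<not> e) v"
  have qv: "pmult A (2, \<not> e) q ?v = ?v"
    using T.star_mul[OF v q(1)] q by simp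
  have nv: "norm_sq (\<not> e) ?v = w'"
    using norm_sq_eq'[OF v] star_star[OF v] q(4) by (simp add: norm_sq_def)
  show "(norm (tr A (2, \<not> e) (pmult A (2, \<not> e) ?v (fourier A e u))))\<^sup>2 \<le> (1 / delta A * w * w')\<^sup>2"
    using key_inequality[OF u p(1) q(1) star_closed[OF v]] p q nv qv by (simp add: power2_eq_square mult_ac)
  show "0 \<le> 1 / delta A * w * w'" using p q delta_pos by simp
qed

lemma norm_sq_projection:
  "p \<in> pbox A (2, e) \<Longrightarrow> star A (2, e) p = p \<Longrightarrow> pmult A (2, e) p p = p \<Longrightarrow> norm_sq e p = Re (tr A (2, e) p)"
  by (simp add: norm_sq_def)

lemma norm_sq_fourier: "x \<in> pbox A (2, e) \<Longrightarrow> norm_sq (\<not> e) (fourier A e x) = norm_sq e x"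
  by (simp add: norm_sq_def plancherel)

lemma norm_sq_spectral:
  assumes x: "x \<in> pbox A (2, e)" and S: "T.spectral e (pmult A (2, e) (star A (2, e) x) x) \<Lambda> P"
  shows "norm_sq e x = (\<Sum>t\<in>\<Lambda>. t * weight e P t)"
proof -
  have "pmult A (2, e) (star A (2, e) x) x = (\<Sum>t\<in>\<Lambda>. cscale A (of_real t) (P t))"
    using S unfolding T.spectral_def by simp
  then show ?thesis unfolding norm_sq_def using tr_fcalc[OF x S, of "\<lambda>t. t"] by simp
qed

lemma spectral_exists_sq:
  assumes "x \<in> pbox A (2, e)"
  obtains \<Lambda> P where "T.spectral e (pmult A (2, e) (star A (2, e) x) x) \<Lambda> P"
  using T.spectral_exists[of "pmult A (2, e) (star A (2, e) x) x" e] assms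
  by (auto simp: T.closed T.star_mul T.star_star)

text \<open>
  Let $w = tr_2(p)$.  The bound from $L^1$ to $L^\infty$ shows that the eigenvalues of $|\mathfrak{F}_s(p)|$ are at most
  $w / \delta$, hence $w = \|p\|_2^2 = \|\mathfrak{F}_s(p)\|_2^2 \le (w / \delta)^2\, tr_2(1) = w^2$.
\<close>

lemma projection_trace_ge_1:
  assumes p: "p \<in> pbox A (2, e)" "p \<noteq> 0" "star A (2, e) p = p" "pmult A (2, e) p p = p"
  shows "1 \<le> Re (tr A (2, e) p)"
proof -
  let ?w = "Re (tr A (2, e) p)"
  have w: "0 < ?w" using T.tr_projection[OF p] by simp
  let ?y = "fourier A e p"
  have y: "?y \<in> pbox A (2, \<not> e)" by (rule fourier_closed[OF p(1)])
  obtain \<Lambda> Q where S: "T.spectral (\<not> e) (pmult A (2, \<not> e) (star A (2, \<not> e) ?y) ?y) \<Lambda> Q"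
    using spectral_exists_sq[OF y] .
  note PS = spectrum[OF y S] weight[OF y S] T.polar[OF y S]
  have bd: "j * weight (\<not> e) Q j \<le> (?w / delta A)\<^sup>2 * weight (\<not> e) Q j" if j: "j \<in> \<Lambda>" for j
  proof (cases "0 < j")
    case True
    define v where "v = cscale A (of_real (1 / sqrt j)) (pmult A (2, \<not> e) ?y (Q j))"
    have Q: "Q j \<in> pbox A (2, \<not> e)" "star A (2, \<not> e) (Q j) = Q j" "pmult A (2, \<not> e) (Q j) (Q j) = Q j"
      using S j unfolding T.spectral_def by blast+
    have v: "v \<in> pbox A (2, \<not> e)" "pmult A (2, \<not> e) v (Q j) = v" "pmult A (2, \<not> e) (star A (2, \<not> e) v) v = Q j"
      using PS(6-8)[of j] PS(8)[of j j] j True by (auto simp: v_def)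
    have wj: "0 < weight (\<not> e) Q j" by (rule weight(2)[OF y S j])
    have "norm (tr A (2, \<not> e) (pmult A (2, \<not> e) (star A (2, \<not> e) v) ?y)) \<le> 1 / delta A * ?w * weight (\<not> e) Q j"
      by (rule partial_isometries_bound[OF p(1,1,4) _ _ _ v(1) Q(1,2) v(2)])
        (use p Q v w wj in \<open>auto simp: norm_sq_def weight_def\<close>)
    moreover have "tr A (2, \<not> e) (pmult A (2, \<not> e) (star A (2, \<not> e) v) ?y) = of_real (sqrt j * weight (\<not> e) Q j)"
      unfolding v_def by (rule tr_polar[OF y S]) (use j True in auto)
    ultimately have "sqrt j * weight (\<not> e) Q j \<le> ?w / delta A * weight (\<not> e) Q j"
      using wj True by (simp add: norm_mult)
    then have "sqrt j \<le> ?w / delta A" using wj by (simp only: mult_le_cancel_right_pos)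
    then have "(sqrt j)\<^sup>2 \<le> (?w / delta A)\<^sup>2" using True by (intro power_mono) auto
    then show ?thesis using True wj by (simp add: mult_right_mono)
  next
    case False
    then have "j = 0" using PS(3)[OF j] by simp
    then show ?thesis using weight(2)[OF y S j] by simp
  qed
  have "?w = norm_sq (\<not> e) ?y" using p by (simp add: norm_sq_fourier norm_sq_projection)
  also have "\<dots> = (\<Sum>j\<in>\<Lambda>. j * weight (\<not> e) Q j)" by (rule norm_sq_spectral[OF y S])
  also have "\<dots> \<le> (\<Sum>j\<in>\<Lambda>. (?w / delta A)\<^sup>2 * weight (\<not> e) Q j)" by (rule sum_mono) (rule bd)
  also have "\<dots> = (?w / delta A)\<^sup>2 * (delta A)\<^sup>2"
    unfolding sum_distrib_left[symmetric] weight_total[OF y S] ..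
  also have "\<dots> = ?w * ?w" using delta_pos by (simp add: power2_eq_square)
  finally show ?thesis using w by simp
qed

text \<open>
  The Fourier transform in the two polar decompositions is a matrix \<open>M\<close> to which \<open>matrix_norm_bound\<close> applies.
\<close>

theorem renyi_uncertainty:
  assumes x: "x \<in> pbox A (2, e)" and 1: "pnorm A (2, e) 2 x = 1" and p: "0 < p" and q: "0 < q"
  shows "(1 / p - 1 / 2) * renyi_entropy A (2, e) (p / 2)
        (pmult A (2, e) (absval A (2, e) x) (absval A (2, e) x)) +
     (1 / 2 - 1 / q) * renyi_entropy A (2, \<not> e) (q / 2)
        (pmult A (2, \<not> e) (absval A (2, \<not> e) (fourier A e x)) (absval A (2, \<not> e) (fourier A e x)))
     \<ge> - ln (K (delta A) (1 / p) (1 / q))"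
proof -
  let ?y = "fourier A e x"
  have y: "?y \<in> pbox A (2, \<not> e)" by (rule fourier_closed[OF x])
  obtain \<Lambda> P where S: "T.spectral e (pmult A (2, e) (star A (2, e) x) x) \<Lambda> P"
    using spectral_exists_sq[OF x] .
  obtain \<Lambda>' Q where S': "T.spectral (\<not> e) (pmult A (2, \<not> e) (star A (2, \<not> e) ?y) ?y) \<Lambda>' Q"
    using spectral_exists_sq[OF y] .
  define I J where "I = {t \<in> \<Lambda>. 0 < t}" and "J = {t \<in> \<Lambda>'. 0 < t}"
  define u where "u t = cscale A (of_real (1 / sqrt t)) (pmult A (2, e) x (P t))" for t
  define v where "v t = cscale A (of_real (1 / sqrt t)) (pmult A (2, \<not> e) ?y (Q t))" for t
  define a b where "a = weight e P" and "b = weight (\<not> e) Q"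
  define M where "M j i = tr A (2, \<not> e) (pmult A (2, \<not> e) (star A (2, \<not> e) (v j)) (fourier A e (u i)))" for j i
  note u = T.polar[OF x S, folded u_def I_def]
  note v = T.polar[OF y S', folded v_def J_def]
  have fin: "finite I" "finite J" using spectrum(1)[OF x S] spectrum(1)[OF y S'] by (simp_all add: I_def J_def)
  have one': "pnorm A (2, \<not> e) 2 ?y = 1"
    using 1 norm_sq_fourier[OF x] norm_sq_spectral[OF x S] norm_sq_spectral[OF y S'] by (simp add: pnorm_2[OF x S] pnorm_2[OF y S'])
  note ex = entropy_term[OF x S 1 p, folded I_def a_def] and ey = entropy_term[OF y S' one' q, folded J_def b_def]
  have ne: "I \<noteq> {}" "J \<noteq> {}" using ex(2) ey(2) by force+
  have PI: "P i \<in> pbox A (2, e)" "P i \<noteq> 0" "star A (2, e) (P i) = P i" "pmult A (2, e) (P i) (P i) = P i" if "i \<in> I" for i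
    using S that unfolding T.spectral_def I_def by blast+
  have QJ: "Q j \<in> pbox A (2, \<not> e)" "Q j \<noteq> 0" "star A (2, \<not> e) (Q j) = Q j" "pmult A (2, \<not> e) (Q j) (Q j) = Q j" if "j \<in> J" for j
    using S' that unfolding T.spectral_def J_def by blast+
  have a1: "1 \<le> a i" if "i \<in> I" for i
    unfolding a_def weight_def by (rule projection_trace_ge_1[OF PI[OF that]])
  have b0: "0 < b j" if "j \<in> J" for j
    unfolding b_def using that by (intro weight(2)[OF y S']) (auto simp: J_def)
  have aI: "sum a I \<le> (delta A)\<^sup>2"
    unfolding weight_total[OF x S, symmetric] a_def
    using spectrum(1)[OF x S] weight(2)[OF x S] by (intro sum_mono2) (auto simp: I_def less_imp_le)
  have bJ: "sum b J \<le> (delta A)\<^sup>2"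
    unfolding weight_total[OF y S', symmetric] b_def
    using spectrum(1)[OF y S'] weight(2)[OF y S'] by (intro sum_mono2) (auto simp: J_def less_imp_le)
  have tP: "tr A (2, e) (P i) = of_real (a i)" if "i \<in> I" for i
    unfolding a_def using that by (intro weight(1)[OF x S]) (auto simp: I_def)
  have tQ: "tr A (2, \<not> e) (Q j) = of_real (b j)" if "j \<in> J" for j
    unfolding b_def using that by (intro weight(1)[OF y S']) (auto simp: J_def)
  have M1: "norm (M j i) \<le> 1 / delta A * a i * b j" if i: "i \<in> I" and j: "j \<in> J" for i j
    unfolding M_def
    by (rule partial_isometries_bound[OF u(1)[OF i] PI(1)[OF i] u(2)[OF i] _ _ _ v(1)[OF j] QJ(1)[OF j] QJ(3)[OF j] v(2)[OF j]])
      (use i j a1 b0 PI QJ in \<open>auto simp: norm_sq_def u(3) v(3) tP tQ less_imp_le intro: order_trans[OF zero_le_one]\<close>)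
  have M3: "(\<Sum>i\<in>I. M j i * of_real (sqrt i)) = of_real (sqrt j * b j)" if j: "j \<in> J" for j
  proof -
    have "(\<Sum>i\<in>I. M j i * of_real (sqrt i)) =
        tr A (2, \<not> e) (pmult A (2, \<not> e) (star A (2, \<not> e) (v j)) (\<Sum>i\<in>I. cscale A (of_real (sqrt i)) (fourier A e (u i))))"
      using u(1) v(1)[OF j] unfolding M_def
      by (subst T.mul_sum_right, simp_all add: T.closed fourier_closed, subst T.tr_sum)
        (auto simp: T.closed fourier_closed T.mul_scale_right T.tr_scale mult.commute)
    also have "(\<Sum>i\<in>I. cscale A (of_real (sqrt i)) (fourier A e (u i))) = ?y"
      using arg_cong[OF u(4), of "fourier A e"] fourier_sum[of I u e "\<lambda>i. of_real (sqrt i)"] u(1) by simp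
    also have "tr A (2, \<not> e) (pmult A (2, \<not> e) (star A (2, \<not> e) (v j)) ?y) = of_real (sqrt j * b j)"
      unfolding v_def b_def by (rule tr_polar[OF y S']) (use j in \<open>auto simp: J_def\<close>)
    finally show ?thesis .
  qed
  have M2: "(norm (\<Sum>j\<in>J. \<Sum>i\<in>I. d j * M j i * c i))\<^sup>2 \<le>
      (\<Sum>j\<in>J. b j * (norm (d j))\<^sup>2) * (\<Sum>i\<in>I. a i * (norm (c i))\<^sup>2)" for c d
  proof -
    define X where "X = (\<Sum>i\<in>I. cscale A (c i) (u i))"
    define Y where "Y = (\<Sum>j\<in>J. cscale A (cnj (d j)) (v j))"
    have X: "X \<in> pbox A (2, e)" and Y: "Y \<in> pbox A (2, \<not> e)"
      using u(1) v(1) by (auto simp: X_def Y_def T.closed intro!: T.sum_closed)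
    have sY: "star A (2, \<not> e) Y = (\<Sum>j\<in>J. cscale A (d j) (star A (2, \<not> e) (v j)))"
      using v(1) unfolding Y_def by (subst T.star_sum) (auto simp: T.closed T.star_scale)
    have FX: "fourier A e X = (\<Sum>i\<in>I. cscale A (c i) (fourier A e (u i)))"
      unfolding X_def by (rule fourier_sum) (rule u(1))
    have "tr A (2, \<not> e) (pmult A (2, \<not> e) (star A (2, \<not> e) Y) (fourier A e X)) = (\<Sum>j\<in>J. \<Sum>i\<in>I. d j * M j i * c i)"
      unfolding sY FX M_def
      by (rule T.tr_mul_sums) (use u(1) v(1) in \<open>auto simp: T.closed fourier_closed\<close>)
    moreover have "(norm (tr A (2, \<not> e) (pmult A (2, \<not> e) (star A (2, \<not> e) Y) (fourier A e X))))\<^sup>2 \<le>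
        norm_sq (\<not> e) Y * norm_sq (\<not> e) (fourier A e X)"
      unfolding norm_sq_def
      by (rule positive_form.cauchy_schwarz[OF positive_form]) (use Y fourier_closed[OF X] in auto)
    moreover have "norm_sq (\<not> e) Y = (\<Sum>j\<in>J. b j * (norm (d j))\<^sup>2)"
      unfolding norm_sq_def Y_def using T.tr_orthogonal[OF fin(2) v(1) v(3) tQ, of "\<lambda>j. cnj (d j)"] by simp
    moreover have "norm_sq (\<not> e) (fourier A e X) = (\<Sum>i\<in>I. a i * (norm (c i))\<^sup>2)"
      unfolding norm_sq_fourier[OF X] unfolding norm_sq_def X_def
      using T.tr_orthogonal[OF fin(1) u(1) u(3) tP, of c] by simp
    ultimately show ?thesis by simp
  qed
  have "- ln (K (delta A) (1 / p) (1 / q)) \<le>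
      ln (\<Sum>i\<in>I. a i * sqrt i powr p) / p - ln (\<Sum>j\<in>J. b j * sqrt j powr q) / q"
    by (rule matrix_norm_bound[OF fin ne a1 b0 _ _ delta_pos aI bJ M1 M2 M3 ex(2) ey(2) p q])
      (auto simp: I_def J_def)
  then show ?thesis using ex(1) ey(1) by (simp add: algebra_simps)
qed

end

theorem theorem1p2:
  fixes A :: "'a::ab_group_add palg" and e :: bool and x :: 'a and p q :: real
  assumes "irreducible_subfactor_planar_algebra A"
    and "x \<in> pbox A (2, e)"
    and "pnorm A (2, e) 2 x = 1"
    and "0 < p" and "0 < q"
  shows
    "(1 / p - 1 / 2) * renyi_entropy A (2, e) (p / 2)
        (pmult A (2, e) (absval A (2, e) x) (absval A (2, e) x)) +
     (1 / 2 - 1 / q) * renyi_entropy A (2, \<not> e) (q / 2)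
        (pmult A (2, \<not> e) (absval A (2, \<not> e) (fourier A e x)) (absval A (2, \<not> e) (fourier A e x)))
     \<ge> - ln (K (delta A) (1 / p) (1 / q))"
  using irreducible_subfactor_planar_algebra.renyi_uncertainty[OF assms] .

end
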